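(* Let $\Omega\subset\mathbb{R}^2$ be a bounded polygonal domain, $\mathcal{T}$ a regular triangulation of $\Omega$, and $p\in\mathbb{N}$. A basis for the Crouzeix-Raviart space $CR_{p,0}(\mathcal{T})$ is given - for even $p$ by $$\left\{B_{p,\mathbf{z}}:\ \mathbf{z}\in\mathcal{N}_{p,\Omega}(\mathcal{T})\right\}\ \cup\ \left\{B^{\mathrm{CR}}_{p,K}:\ K\in\mathcal{T}\right\},$$ - for odd $p$ by $$\left\{B_{p,\mathbf{z}}:\ \mathbf{z}\in\mathcal{N}_{p,\Omega}(\mathcal{T})\setminus\mathcal{V}_\Omega\right\}\ \cup\ \left\{B^{\mathrm{CR}}_{p,E}:\ E\in\mathcal{E}_\Omega\right\}.$$
   Context: A regular triangulation $\mathcal{T}$ of $\Omega$ is a finite set of closed (nondegenerate) triangles such that the intersection of two different triangles is either empty, a common edge, or a common point (vertex), and $\Omega$ is the interior of $\bigcup_{K\in\mathcal{T}}K$. $\mathcal{E}$ is the set of edges, $\mathcal{E}_{\partial\Omega}=\{E\in\mathcal{E}:E\subset\partial\Omega\}$, $\mathcal{E}_\Omega=\mathcal{E}\setminus\mathcal{E}_{\partial\Omega}$; $\mathcal{V}_\Omega$ is the set of triangle vertices not on $\partial\Omega$. For $E\in\mathcal{E}$: $\mathcal{T}_E=\{K\in\mathcal{T}:E\subset K\}$, $\omega_E=\bigcup_{K\in\mathcal{T}_E}K$. $\mathbb{P}_k(\mathcal{T})=\{q\in L^2(\Omega):q|_K\text{ is a polynomial of total degree}\le k\ \forall K\in\mathcal{T}\}$.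 $CR_{k,0}(\mathcal{T})$ consists of all $v\in\mathbb{P}_k(\mathcal{T})$ such that $\int_E[v]_E\,q=0$ for all $E\in\mathcal{E}_\Omega$ and all polynomials $q$ of degree $\le k-1$ on $E$, and $\int_Ev\,q=0$ for all $E\in\mathcal{E}_{\partial\Omega}$ and all polynomials $q$ of degree $\le k-1$ on $E$; $[v]_E$ is the jump of $v$ across $E$. Nodal points: for $k\ge1$ let $\widehat{\mathcal{N}}_k=\{\tfrac1k\boldsymbol{\mu}:\boldsymbol{\mu}\in\mathbb{N}_0^2,\ \mu_1+\mu_2\le k\}$ on the reference triangle $\widehat K$ with vertices $(0,0),(1,0),(0,1)$; for a triangle $K$ with affine bijection $\chi_K:\widehat K\to K$, $\mathcal{N}_k(K)=\chi_K(\widehat{\mathcal{N}}_k)$; $\mathcal{N}_k(\mathcal{T})=\bigcup_{K\in\mathcal{T}}\mathcal{N}_k(K)$ and $\mathcal{N}_{k,\Omega}(\mathcal{T})=\mathcal{N}_k(\mathcal{T})\cap\Omega$. $S_k(\mathcal{T})$ is the space of continuous functions which are polynomials of total degree $\le k$ on each $K\in\mathcal{T}$, and $B_{k,\mathbf{z}}\in S_k(\mathcal{T})$ is the Lagrange basis function with $B_{k,\mathbf{z}}(\mathbf{z}')=\delta_{\mathbf{z},\mathbf{z}'}$ for all $\mathbf{z}'\in\mathcal{N}_k(\mathcal{T})$. $P_p^{(0,0)}$ is the Legendre polynomial of degree $p$ (normalized by $P_p^{(0,0)}(1)=1$). For a triangle $K$ with vertices $\mathbf{A}_1,\mathbf{A}_2,\mathbf{A}_3$,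 $\lambda_{K,\mathbf{A}}$ is the barycentric coordinate of $K$ for the vertex $\mathbf{A}$ (the affine function on $K$ equal to $1$ at $\mathbf{A}$ and $0$ at the other two vertices), and $\lambda_{K,i}=\lambda_{K,\mathbf{A}_i}$. For $p$ even and $K\in\mathcal{T}$ the non-conforming triangle bubble is $$B^{\mathrm{CR}}_{p,K}=\begin{cases}\dfrac12\left(-1+\sum_{i=1}^3P_p^{(0,0)}(1-2\lambda_{K,i})\right)&\text{on }K,\\0&\text{on }\Omega\setminus K.\end{cases}$$ For $p$ odd and $E\in\mathcal{E}$ the non-conforming edge bubble is $$B^{\mathrm{CR}}_{p,E}=\begin{cases}P_p^{(0,0)}(1-2\lambda_{K,\mathbf{A}_{K,E}})&\text{on }K\text{ for }K\in\mathcal{T}_E,\\0&\text{on }\Omega\setminus\omega_E,\end{cases}$$ where $\mathbf{A}_{K,E}$ is the vertex of $K$ opposite to $E$.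
   Formalization: For even p the domain is additionally assumed simply connected; if the polygonal domain has a hole, the stated set for even p does not span the Crouzeix-Raviart space. The odd case is stated for all bounded polygonal domains. *)

theory Defs
  imports "HOL-Analysis.Analysis" "HOL-Computational_Algebra.Polynomial"
begin

section \<open>Functions modulo equality almost everywhere\<close>

quotient_type ae_fun = "real^2 \<Rightarrow> real" / "\<lambda>f g. AE x in lebesgue. f x = g x"
  morphisms rep_ae ae_class
proof (rule equivpI)
  show "reflp (\<lambda>f g :: real^2 \<Rightarrow> real. AE x in lebesgue. f x = g x)"
    by (simp add: reflp_def)
  show "symp (\<lambda>f g :: real^2 \<Rightarrow> real. AE x in lebesgue. f x = g x)"
    by (simp add: symp_def eq_commute)
  show "transp (\<lambda>f g :: real^2 \<Rightarrow> real. AE x in lebesgue. f x = g x)"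
  proof (rule transpI)
    fix f g h :: "real^2 \<Rightarrow> real"
    assume "AE x in lebesgue. f x = g x" "AE x in lebesgue. g x = h x"
    then show "AE x in lebesgue. f x = h x" by eventually_elim simp
  qed
qed

instantiation ae_fun :: real_vector
begin

lift_definition zero_ae_fun :: ae_fun is "\<lambda>_. 0" .

lift_definition plus_ae_fun :: "ae_fun \<Rightarrow> ae_fun \<Rightarrow> ae_fun" is "\<lambda>f g x. f x + g x"
proof -
  fix f f' g g' :: "real^2 \<Rightarrow> real"
  assume "AE x in lebesgue. f x = f' x" "AE x in lebesgue. g x = g' x"
  then show "AE x in lebesgue. f x + g x = f' x + g' x" by eventually_elim simp
qed

lift_definition minus_ae_fun :: "ae_fun \<Rightarrow> ae_fun \<Rightarrow> ae_fun" is "\<lambda>f g x. f x - g x"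
proof -
  fix f f' g g' :: "real^2 \<Rightarrow> real"
  assume "AE x in lebesgue. f x = f' x" "AE x in lebesgue. g x = g' x"
  then show "AE x in lebesgue. f x - g x = f' x - g' x" by eventually_elim simp
qed

lift_definition uminus_ae_fun :: "ae_fun \<Rightarrow> ae_fun" is "\<lambda>f x. - f x"
proof -
  fix f f' :: "real^2 \<Rightarrow> real"
  assume "AE x in lebesgue. f x = f' x"
  then show "AE x in lebesgue. - f x = - f' x" by eventually_elim simp
qed

lift_definition scaleR_ae_fun :: "real \<Rightarrow> ae_fun \<Rightarrow> ae_fun" is "\<lambda>c f x. c * f x"
proof -
  fix c :: real and f f' :: "real^2 \<Rightarrow> real"
  assume "AE x in lebesgue. f x = f' x"
  then show "AE x in lebesgue. c * f x = c * f' x" by eventually_elim simp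
qed

instance
  by standard (transfer; simp add: algebra_simps)+

end

lift_definition ae_eq_on :: "(real^2) set \<Rightarrow> ae_fun \<Rightarrow> (real^2 \<Rightarrow> real) \<Rightarrow> bool"
  is "\<lambda>S f g. AE x in lebesgue. x \<in> S \<longrightarrow> f x = g x"
proof -
  fix S and f f' :: "real^2 \<Rightarrow> real" 
  assume "AE x in lebesgue. f x = f' x"
  then have "(AE x in lebesgue. x \<in> S \<longrightarrow> f x = g x) \<longleftrightarrow> (AE x in lebesgue. x \<in> S \<longrightarrow> f' x = g x)"
    for g by (intro AE_cong_simp eventually_subst) (auto elim: eventually_mono)
  then show "(\<lambda>g. AE x in lebesgue. x \<in> S \<longrightarrow> f x = g x) = (\<lambda>g. AE x in lebesgue. x \<in> S \<longrightarrow> f' x = g x)"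
    by blast
qed

text \<open>An element of $L^2(\Omega)$ is identified with its extension by zero to the plane.\<close>

definition L2 :: "(real^2) set \<Rightarrow> ae_fun set" where
  "L2 \<Omega> = {ae_class f | f. f \<in> borel_measurable lebesgue
              \<and> integrable lebesgue (\<lambda>x. (f x)\<^sup>2) \<and> (\<forall>x. x \<notin> \<Omega> \<longrightarrow> f x = 0)}"

section \<open>Polynomials\<close>

definition poly2_le :: "nat \<Rightarrow> (real^2 \<Rightarrow> real) \<Rightarrow> bool" where
  "poly2_le k q \<longleftrightarrow> (\<exists>c. \<forall>x. q x = (\<Sum>i\<le>k. \<Sum>j\<le>k - i. c i j * (x$1)^i * (x$2)^j))"

text \<open>Rodrigues' formula; it has the normalization $P_n(1) = 1$.\<close>

definition legendre :: "nat \<Rightarrow> real poly" where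
  "legendre n = smult (1 / (2 ^ n * fact n)) ((pderiv ^^ n) ([:-1, 0, 1:] ^ n))"

section \<open>Domains and triangulations\<close>

text \<open>
  Polygonal domains may be multiply connected here; simple connectedness is imposed separately
  where it is needed. It is needed for even $p$: if $C$ is a bounded component of the complement
  of $\Omega$, there is a continuous piecewise polynomial of degree $p$ whose trace is the (affinely
  transplanted) Legendre polynomial of degree $p$ on each edge contained in $\partial C$ and zero
  on all other boundary edges. It lies in the Crouzeix-Raviart space, but not in the span of the
  interior Lagrange functions and the triangle bubbles: the only continuous combinations of
  triangle bubbles are the multiples of the sum of all of them, and the trace of that sum is the
  transplanted Legendre polynomial on every boundary edge.
\<close>

definition polygonal_domain :: "(real^2) set \<Rightarrow> bool" where
  "polygonal_domain \<Omega> \<longleftrightarrow> \<Omega> \<noteq> {} \<and> open \<Omega> \<and> connected \<Omega>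
     \<and> (\<exists>S. finite S \<and> (\<forall>s\<in>S. \<exists>a b. s = closed_segment a b) \<and> frontier \<Omega> = \<Union>S)"

definition regular_triangulation :: "(real^2) set set \<Rightarrow> (real^2) set \<Rightarrow> bool" where
  "regular_triangulation T \<Omega> \<longleftrightarrow> finite T \<and> (\<forall>K\<in>T. 2 simplex K)
     \<and> (\<forall>K\<in>T. \<forall>K'\<in>T. K \<noteq> K' \<longrightarrow>
          K \<inter> K' = {}
          \<or> (\<exists>E. E edge_of K \<and> E edge_of K' \<and> K \<inter> K' = E)
          \<or> (\<exists>z. z extreme_point_of K \<and> z extreme_point_of K' \<and> K \<inter> K' = {z}))
     \<and> \<Omega> = interior (\<Union>T)"

definition edges :: "(real^2) set set \<Rightarrow> (real^2) set set" where
  "edges T = {E. \<exists>K\<in>T. E edge_of K}"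

definition boundary_edges :: "(real^2) set \<Rightarrow> (real^2) set set \<Rightarrow> (real^2) set set" where
  "boundary_edges \<Omega> T = {E \<in> edges T. E \<subseteq> frontier \<Omega>}"

definition interior_edges :: "(real^2) set \<Rightarrow> (real^2) set set \<Rightarrow> (real^2) set set" where
  "interior_edges \<Omega> T = edges T - boundary_edges \<Omega> T"

definition interior_vertices :: "(real^2) set \<Rightarrow> (real^2) set set \<Rightarrow> (real^2) set" where
  "interior_vertices \<Omega> T = {z. (\<exists>K\<in>T. z extreme_point_of K) \<and> z \<notin> frontier \<Omega>}"

definition triangles_at :: "(real^2) set set \<Rightarrow> (real^2) set \<Rightarrow> (real^2) set set" where
  "triangles_at T E = {K \<in> T. E \<subseteq> K}"

text \<open>
  The integral with respect to arc length over a segment given as a point set; it does not depend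
  on which endpoint is called \<open>a\<close>.
\<close>

definition edge_integral :: "(real^2) set \<Rightarrow> (real^2 \<Rightarrow> real) \<Rightarrow> real" where
  "edge_integral E f = (THE I. \<exists>a b. E = closed_segment a b
      \<and> I = dist a b * integral {0..1} (\<lambda>t. f (linepath a b t)))"

section \<open>The Crouzeix-Raviart space\<close>

definition piecewise_poly :: "(real^2) set \<Rightarrow> (real^2) set set \<Rightarrow> nat \<Rightarrow> ae_fun set" where
  "piecewise_poly \<Omega> T k = {v \<in> L2 \<Omega>. \<forall>K\<in>T. \<exists>q. poly2_le k q \<and> ae_eq_on K v q}"

text \<open>
  The polynomial that \<open>v\<close> equals on \<open>K\<close> (unique if \<open>K\<close> has positive measure); its values on
  an edge of \<open>K\<close> are the trace of \<open>v\<close> from \<open>K\<close>.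
\<close>

definition piece :: "ae_fun \<Rightarrow> (real^2) set \<Rightarrow> real^2 \<Rightarrow> real" where
  "piece v K = (THE q. (\<exists>n. poly2_le n q) \<and> ae_eq_on K v q)"

definition jump :: "ae_fun \<Rightarrow> (real^2) set \<Rightarrow> (real^2) set \<Rightarrow> real^2 \<Rightarrow> real" where
  "jump v K K' x = piece v K x - piece v K' x"

text \<open>
  The jump is determined only up to its sign, which is irrelevant below. The condition is
  therefore imposed for both orders of the two triangles sharing an interior edge. The test
  polynomials on an edge are the restrictions of the bivariate ones of the same degree. The
  definition is meant for \<open>k \<ge> 1\<close>.
\<close>

definition crouzeix_raviart0 :: "(real^2) set \<Rightarrow> (real^2) set set \<Rightarrow> nat \<Rightarrow> ae_fun set" where
  "crouzeix_raviart0 \<Omega> T k = {v \<in> piecewise_poly \<Omega> T k.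
     (\<forall>E\<in>interior_edges \<Omega> T. \<forall>K\<in>triangles_at T E. \<forall>K'\<in>triangles_at T E. K \<noteq> K' \<longrightarrow>
        (\<forall>q. poly2_le (k - 1) q \<longrightarrow> edge_integral E (\<lambda>x. jump v K K' x * q x) = 0))
   \<and> (\<forall>E\<in>boundary_edges \<Omega> T. \<forall>K\<in>triangles_at T E.
        (\<forall>q. poly2_le (k - 1) q \<longrightarrow> edge_integral E (\<lambda>x. piece v K x * q x) = 0))}"

section \<open>Lagrange basis functions\<close>

definition ref_triangle :: "(real^2) set" where
  "ref_triangle = convex hull {vector [0, 0], vector [1, 0], vector [0, 1]}"

definition ref_nodes :: "nat \<Rightarrow> (real^2) set" where
  "ref_nodes k = {vector [real i / real k, real j / real k] | i j. i + j \<le> k}"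

definition ref_map :: "(real^2) set \<Rightarrow> real^2 \<Rightarrow> real^2" where
  "ref_map K = (SOME h. (\<exists>(A :: real^2^2) b. \<forall>x. h x = A *v x + b) \<and> bij_betw h ref_triangle K)"

definition nodes :: "(real^2) set set \<Rightarrow> nat \<Rightarrow> (real^2) set" where
  "nodes T k = (\<Union>K\<in>T. ref_map K ` ref_nodes k)"

text \<open>The functions of \<open>S_space T k\<close> live on the closed set \<open>\<Union>T\<close>; they are set to zero elsewhere.\<close>

definition S_space :: "(real^2) set set \<Rightarrow> nat \<Rightarrow> (real^2 \<Rightarrow> real) set" where
  "S_space T k = {v. continuous_on (\<Union>T) v
     \<and> (\<forall>K\<in>T. \<exists>q. poly2_le k q \<and> (\<forall>x\<in>K. v x = q x)) \<and> (\<forall>x. x \<notin> \<Union>T \<longrightarrow> v x = 0)}"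

definition lagrange :: "(real^2) set set \<Rightarrow> nat \<Rightarrow> real^2 \<Rightarrow> real^2 \<Rightarrow> real" where
  "lagrange T k z = (THE b. b \<in> S_space T k
     \<and> (\<forall>z'\<in>nodes T k. b z' = (if z' = z then 1 else 0)))"

section \<open>Non-conforming bubbles\<close>

definition bary :: "(real^2) set \<Rightarrow> real^2 \<Rightarrow> real^2 \<Rightarrow> real" where
  "bary K A = (THE l. (\<exists>a b. \<forall>x. l x = a \<bullet> x + b) \<and> l A = 1
     \<and> (\<forall>B. B extreme_point_of K \<and> B \<noteq> A \<longrightarrow> l B = 0))"

definition triangle_bubble :: "nat \<Rightarrow> (real^2) set \<Rightarrow> real^2 \<Rightarrow> real" where
  "triangle_bubble p K x = (if x \<in> K
     then 1/2 * (-1 + (\<Sum>A | A extreme_point_of K. poly (legendre p) (1 - 2 * bary K A x)))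
     else 0)"

definition opposite_vertex :: "(real^2) set \<Rightarrow> (real^2) set \<Rightarrow> real^2" where
  "opposite_vertex K E = (THE A. A extreme_point_of K \<and> A \<notin> E)"

text \<open>
  On \<open>E\<close> itself the choice of \<open>K\<close> does not matter: the barycentric coordinate vanishes there, so
  the value is $P_p(1) = 1$.
\<close>

definition edge_bubble :: "(real^2) set set \<Rightarrow> nat \<Rightarrow> (real^2) set \<Rightarrow> real^2 \<Rightarrow> real" where
  "edge_bubble T p E x = (if x \<in> \<Union>(triangles_at T E)
     then let K = SOME K. K \<in> triangles_at T E \<and> x \<in> K
          in poly (legendre p) (1 - 2 * bary K (opposite_vertex K E) x)
     else 0)"

definition basis_of :: "ae_fun set \<Rightarrow> ae_fun set \<Rightarrow> bool" where
  "basis_of V B \<longleftrightarrow> independent B \<and> span B = V"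

end

theory Submission
  imports Defs
begin

text \<open>
  A function of the Crouzeix-Raviart space is given by one polynomial on each triangle. Its trace
  on an edge, or the jump of its traces, has degree at most \<open>p\<close> and is orthogonal to all
  polynomials of degree at most \<open>p - 1\<close>; it is therefore a multiple of the Legendre polynomial of
  the edge (\<open>orthogonal_imp_edge_legendre\<close>). If all these multiples are zero, the function is
  continuous and vanishes on the frontier, so it is a combination of Lagrange functions of interior
  nodes (\<open>conforming_expansion\<close>). In both cases of the theorem the bubbles are used to remove the
  Legendre parts, and \<open>basis_criterion\<close> reduces the claim to two questions: can they be removed,
  and are the coefficients of the bubbles unique?

  For odd \<open>p\<close> both questions are local. The Legendre polynomial of an edge has opposite values at
  its endpoints, so the mean of the endpoint values of a piece on an edge is the same from both
  sides, and zero on the frontier. With these means as coefficients the edge bubbles reproduce the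
  values at all vertices, because the three bubbles of a triangle have values \<open>-1\<close> at the opposite
  vertex and \<open>1\<close> at the other two. What remains vanishes at the vertices, and a multiple of the
  Legendre polynomial that vanishes at an endpoint is zero.

  For even \<open>p\<close> the bubble of a triangle has the Legendre polynomial as trace on all three edges. One
  has to find numbers \<open>d K\<close> whose differences across the shared edges are the given Legendre
  coefficients of the jumps, and which equal the given coefficients at the frontier. These
  coefficients are the jumps of the values at either endpoint of the edge, so they satisfy a cycle
  condition at every vertex, and the number sought for a triangle is the winding number, around its
  interior points, of the cycle formed by the edges weighted with the coefficients
  (\<open>simply_connected_exact\<close>). It is locally constant off the edges, jumps by the right amount across
  each edge, and vanishes outside the triangulation because \<open>y - x\<close> has a continuous logarithm on the
  simply connected \<open>\<Omega>\<close> for every \<open>x\<close> outside. The coefficients are unique because all triangle bubbles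
  have the value \<open>1\<close> at the vertices: a combination that is cancelled by Lagrange functions has the
  same coefficient on all triangles at a vertex, and zero at vertices on the frontier
  (\<open>bubble_coefficients_zero\<close>).

  Continuity is needed at the vertices as well, while the conditions concern edges only. This gap
  is closed by the connectedness of a punctured disc (\<open>full_fan\<close>).
\<close>

section \<open>Polynomials in two variables\<close>

lemma poly2_le_pairs:
  "poly2_le k q \<longleftrightarrow> (\<exists>c. \<forall>x. q x = (\<Sum>(i,j) | i + j \<le> k. c i j * (x$1)^i * (x$2)^j))"
proof -
  have *: "{(i,j). i + j \<le> k} = (SIGMA i:{..k}. {..k - i})" by auto
  have "(\<Sum>i\<le>k. \<Sum>j\<le>k - i. c i j * (x$1)^i * (x$2)^j)
      = (\<Sum>(i,j) | i + j \<le> k. c i j * (x$1)^i * (x$2)^j)" for c :: "nat \<Rightarrow> nat \<Rightarrow> real" and x :: "real^2"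
    unfolding * by (subst sum.Sigma) auto
  then show ?thesis unfolding poly2_le_def by simp
qed

lemma poly2_leI:
  "(\<And>x. q x = (\<Sum>(i,j) | i + j \<le> k. c i j * (x$1)^i * (x$2)^j)) \<Longrightarrow> poly2_le k q"
  unfolding poly2_le_pairs by (intro exI[of _ c]) simp

lemma poly2_leE:
  assumes "poly2_le k q"
  obtains c where "q = (\<lambda>x. \<Sum>(i,j) | i + j \<le> k. c i j * (x$1)^i * (x$2)^j)"
proof -
  obtain c where "\<forall>x. q x = (\<Sum>(i,j) | i + j \<le> k. c i j * (x$1)^i * (x$2)^j)"
    using assms unfolding poly2_le_pairs by (elim exE)
  then have "q = (\<lambda>x. \<Sum>(i,j) | i + j \<le> k. c i j * (x$1)^i * (x$2)^j)" by (intro ext) simp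
  then show ?thesis by (rule that)
qed

lemma poly2_leE':
  assumes "poly2_le k q"
  obtains c where
    "q = (\<lambda>x. \<Sum>u | fst u + snd u \<le> k. c (fst u) (snd u) * ((x$1)^(fst u) * (x$2)^(snd u)))"
proof -
  obtain c where "q = (\<lambda>x. \<Sum>(i,j) | i + j \<le> k. c i j * (x$1)^i * (x$2)^j)"
    using assms by (rule poly2_leE)
  then show ?thesis by (intro that[of c]) (simp add: case_prod_unfold mult.assoc)
qed

lemma finite_pairs_le [simp]: "finite {(i,j). i + j \<le> (k::nat)}"
  by (rule finite_subset[of _ "{..k} \<times> {..k}"]) auto

lemma poly2_le_mono: "poly2_le k q \<Longrightarrow> k \<le> l \<Longrightarrow> poly2_le l q"
proof -
  assume q: "poly2_le k q" and kl: "k \<le> l"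
  obtain c where c: "q = (\<lambda>x. \<Sum>(i,j) | i + j \<le> k. c i j * (x$1)^i * (x$2)^j)"
    using q by (rule poly2_leE)
  have "q x = (\<Sum>(i,j) | i + j \<le> l. (if i + j \<le> k then c i j else 0) * (x$1)^i * (x$2)^j)" for x
    unfolding c using kl by (intro sum.mono_neutral_cong_left) (auto split: if_splits)
  then show ?thesis by (rule poly2_leI)
qed

lemma poly2_le_add:
  assumes "poly2_le k f" "poly2_le k g"
  shows "poly2_le k (\<lambda>x. f x + g x)"
proof -
  obtain c where c: "f = (\<lambda>x. \<Sum>(i,j) | i + j \<le> k. c i j * (x$1)^i * (x$2)^j)"
    using assms(1) by (rule poly2_leE)
  obtain d where d: "g = (\<lambda>x. \<Sum>(i,j) | i + j \<le> k. d i j * (x$1)^i * (x$2)^j)"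
    using assms(2) by (rule poly2_leE)
  from c d have "f x + g x = (\<Sum>(i,j) | i + j \<le> k. (c i j + d i j) * (x$1)^i * (x$2)^j)" for x
    by (simp add: case_prod_unfold algebra_simps sum.distrib)
  then show ?thesis by (rule poly2_leI)
qed

lemma poly2_le_cmult:
  assumes "poly2_le k f"
  shows "poly2_le k (\<lambda>x. r * f x)"
proof -
  obtain c where "f = (\<lambda>x. \<Sum>(i,j) | i + j \<le> k. c i j * (x$1)^i * (x$2)^j)"
    using assms by (rule poly2_leE)
  then have "r * f x = (\<Sum>(i,j) | i + j \<le> k. (r * c i j) * (x$1)^i * (x$2)^j)" for x
    by (simp add: case_prod_unfold algebra_simps sum_distrib_left)
  then show ?thesis by (rule poly2_leI)
qed

lemma poly2_le_monom:
  assumes "a + b \<le> k"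
  shows "poly2_le k (\<lambda>x. (x$1)^a * (x$2)^b)"
proof -
  have "(x$1)^a * (x$2)^b = (\<Sum>(i,j) | i + j \<le> k. (if i = a \<and> j = b then 1 else 0) * (x$1)^i * (x$2)^j)"
    for x :: "real^2"
  proof -
    have "(\<Sum>(i,j) | i + j \<le> k. (if i = a \<and> j = b then 1 else 0) * (x$1)^i * (x$2)^j)
       = (\<Sum>(i,j) \<in> {(a,b)}. (x$1)^i * (x$2)^j)"
      using assms by (intro sum.mono_neutral_cong_right) (auto split: if_splits)
    then show ?thesis by simp
  qed
  then show ?thesis by (rule poly2_leI)
qed

lemma poly2_le_const: "poly2_le k (\<lambda>x. r)"
  using poly2_le_cmult[OF poly2_le_monom[of 0 0 k], of r] by simp

lemma poly2_le_sum:
  "(\<And>i. i \<in> I \<Longrightarrow> poly2_le k (f i)) \<Longrightarrow> poly2_le k (\<lambda>x. \<Sum>i\<in>I. f i x)"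
  by (induction I rule: infinite_finite_induct) (auto intro: poly2_le_const poly2_le_add)

lemma poly2_le_diff:
  "poly2_le k f \<Longrightarrow> poly2_le k g \<Longrightarrow> poly2_le k (\<lambda>x. f x - g x)"
  using poly2_le_add[of k f "\<lambda>x. -1 * g x"] poly2_le_cmult[of k g "-1"] by simp

lemma poly2_le_mult:
  assumes "poly2_le k f" "poly2_le l g"
  shows "poly2_le (k + l) (\<lambda>x. f x * g x)"
proof -
  obtain c where c: "f = (\<lambda>x. \<Sum>(i,j) | i + j \<le> k. c i j * (x$1)^i * (x$2)^j)"
    using assms(1) by (rule poly2_leE)
  obtain d where d: "g = (\<lambda>x. \<Sum>(i,j) | i + j \<le> l. d i j * (x$1)^i * (x$2)^j)"
    using assms(2) by (rule poly2_leE)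
  note fg = c d
  have "f x * g x = (\<Sum>u | fst u + snd u \<le> k. \<Sum>v | fst v + snd v \<le> l.
       (c (fst u) (snd u) * d (fst v) (snd v)) * ((x$1)^(fst u + fst v) * (x$2)^(snd u + snd v)))" for x
    unfolding fg sum_product case_prod_unfold by (simp add: power_add mult_ac)
  then have eq: "(\<lambda>x. f x * g x) = (\<lambda>x. \<Sum>u | fst u + snd u \<le> k. \<Sum>v | fst v + snd v \<le> l.
       (c (fst u) (snd u) * d (fst v) (snd v)) * ((x$1)^(fst u + fst v) * (x$2)^(snd u + snd v)))"
    by blast
  show ?thesis unfolding eq
    by (intro poly2_le_sum poly2_le_cmult poly2_le_monom) auto
qed

lemma poly2_le_affine: "k \<ge> 1 \<Longrightarrow> poly2_le k (\<lambda>x. a * x$1 + b * x$2 + c)"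
  using poly2_le_add[OF poly2_le_add[OF poly2_le_cmult[OF poly2_le_monom[of 1 0 k], of a]
     poly2_le_cmult[OF poly2_le_monom[of 0 1 k], of b]] poly2_le_const[of k c]] by simp

lemma poly2_le_power: "poly2_le k f \<Longrightarrow> poly2_le (n * k) (\<lambda>x. f x ^ n)"
  by (induction n) (auto intro: poly2_le_const poly2_le_mult)

lemma poly2_le_poly:
  assumes "poly2_le 1 f" "degree r \<le> k"
  shows "poly2_le k (\<lambda>x. poly r (f x))"
proof -
  have "poly2_le k (\<lambda>x. \<Sum>i\<le>degree r. coeff r i * f x ^ i)"
    using assms by (intro poly2_le_sum poly2_le_cmult poly2_le_mono[OF poly2_le_power[OF assms(1)]]) auto
  then show ?thesis by (simp add: poly_altdef)
qed

lemma poly2_le_prod: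
  "finite I \<Longrightarrow> (\<And>i. i \<in> I \<Longrightarrow> poly2_le (k i) (f i)) \<Longrightarrow> poly2_le (\<Sum>i\<in>I. k i) (\<lambda>x. \<Prod>i\<in>I. f i x)"
  by (induction I rule: finite_induct) (auto intro: poly2_le_const poly2_le_mult)

lemma poly2_le_compose:
  assumes q: "poly2_le k q" and h: "poly2_le 1 (\<lambda>x. h x $ 1)" "poly2_le 1 (\<lambda>x. h x $ 2)"
  shows "poly2_le k (\<lambda>x. q (h x))"
proof -
  obtain c where c: "q = (\<lambda>x. \<Sum>u | fst u + snd u \<le> k. c (fst u) (snd u) * ((x$1)^(fst u) * (x$2)^(snd u)))"
    using q by (rule poly2_leE')
  have "poly2_le (fst u * 1 + snd u * 1) (\<lambda>x. (h x $ 1)^(fst u) * (h x $ 2)^(snd u))" for u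
    using h by (intro poly2_le_mult poly2_le_power)
  then show ?thesis unfolding c
    by (intro poly2_le_sum poly2_le_cmult) (auto intro: poly2_le_mono)
qed

lemma poly2_le_on_line:
  assumes "poly2_le k q"
  obtains r where "degree r \<le> k" "\<And>t. q (a + t *\<^sub>R b) = poly r t"
proof -
  obtain c where c: "q = (\<lambda>x. \<Sum>u | fst u + snd u \<le> k. c (fst u) (snd u) * ((x$1)^(fst u) * (x$2)^(snd u)))"
    using assms by (rule poly2_leE')
  define r where "r = (\<Sum>u | fst u + snd u \<le> k.
     smult (c (fst u) (snd u)) ([:a$1, b$1:] ^ fst u * [:a$2, b$2:] ^ snd u))"
  have "degree ([:a$1, b$1:] ^ fst u * [:a$2, b$2:] ^ snd u) \<le> fst u + snd u" for u :: "nat \<times> nat"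
    by (rule order.trans[OF degree_mult_le]) (intro add_mono order.trans[OF degree_power_le], auto)
  then have "degree r \<le> k" unfolding r_def
    by (intro degree_sum_le) (auto intro!: order.trans[OF degree_smult_le] intro: order.trans simp: case_prod_unfold
        finite_pairs_le[unfolded case_prod_unfold])
  moreover have "q (a + t *\<^sub>R b) = poly r t" for t
    unfolding c r_def by (simp add: poly_sum)
  ultimately show ?thesis using that by blast
qed

lemma poly2_le_on_linepath:
  assumes "poly2_le k q"
  obtains r where "degree r \<le> k" "\<And>t. q (linepath a b t) = poly r t"
proof -
  obtain r where r: "degree r \<le> k" "\<And>t. q (a + t *\<^sub>R (b - a)) = poly r t"
    using poly2_le_on_line[OF assms, of a "b - a"] by blast
  have "linepath a b t = a + t *\<^sub>R (b - a)" for t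
    by (simp add: linepath_def algebra_simps)
  then have "q (linepath a b t) = poly r t" for t using r(2) by simp
  with r(1) show ?thesis by (rule that)
qed

lemma poly2_le_continuous:
  assumes "poly2_le k q" shows "continuous_on S q"
proof -
  obtain c where "q = (\<lambda>x. \<Sum>u | fst u + snd u \<le> k. c (fst u) (snd u) * ((x$1)^(fst u) * (x$2)^(snd u)))"
    using assms by (rule poly2_leE')
  then show ?thesis by (simp add: continuous_intros)
qed

text \<open>Along every line through a point of the open set the polynomial has infinitely many zeros.\<close>

lemma poly2_le_zero_on_open:
  assumes q: "poly2_le k q" and U: "open U" "U \<noteq> {}" "\<And>x. x \<in> U \<Longrightarrow> q x = 0"
  shows "q x = 0"
proof -
  obtain a where a: "a \<in> U" using U by blast
  obtain r where r: "\<And>t. q (a + t *\<^sub>R (x - a)) = poly r t"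
    using poly2_le_on_line[OF q, of a "x - a"] by blast
  have "open ((\<lambda>t. a + t *\<^sub>R (x - a)) -` U)"
    by (rule open_vimage[OF U(1)]) (auto intro!: continuous_intros)
  moreover have "0 \<in> (\<lambda>t. a + t *\<^sub>R (x - a)) -` U" using a by simp
  ultimately have "infinite ((\<lambda>t. a + t *\<^sub>R (x - a)) -` U)"
    using finite_imp_not_open by blast
  moreover have "(\<lambda>t. a + t *\<^sub>R (x - a)) -` U \<subseteq> {t. poly r t = 0}"
    using U(3) unfolding r[symmetric] by auto
  ultimately have "r = 0" using poly_roots_finite finite_subset by blast
  then show ?thesis using r[of 1] by simp
qed

lemma poly2_le_eq_on_open:
  assumes "poly2_le k q" "poly2_le l q'" "open U" "U \<noteq> {}" "\<And>x. x \<in> U \<Longrightarrow> q x = q' x"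
  shows "q = q'"
proof
  fix x
  have "poly2_le (max k l) (\<lambda>x. q x - q' x)"
    using assms(1,2) by (intro poly2_le_diff) (auto elim: poly2_le_mono)
  from poly2_le_zero_on_open[OF this assms(3,4)] assms(5) show "q x = q' x" by force
qed

lemma poly_eq_0_of_many_roots:
  fixes r :: "real poly"
  assumes "degree r \<le> k" "\<And>i. i \<le> k \<Longrightarrow> poly r (real i / real m) = 0" "m > 0"
  shows "r = 0"
proof (rule ccontr)
  assume "r \<noteq> 0"
  have "(\<lambda>i. real i / real m) ` {..k} \<subseteq> {x. poly r x = 0}" using assms by auto
  then have "card ((\<lambda>i. real i / real m) ` {..k}) \<le> card {x. poly r x = 0}"
    using \<open>r \<noteq> 0\<close> by (intro card_mono poly_roots_finite)
  moreover have "card ((\<lambda>i. real i / real m) ` {..k}) = Suc k"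
    using assms(3) by (subst card_image) (auto simp: inj_on_def)
  moreover have "card {x. poly r x = 0} \<le> degree r" by (rule card_poly_roots_bound) fact
  ultimately show False using assms(1) by simp
qed

text \<open>
  The \<open>k + 1\<close> zeros on the line \<open>x$1 = 0\<close> force the polynomial to vanish on this line, so it is
  divisible by \<open>x$1\<close>. The quotient vanishes on the remaining lattice triangle of size \<open>k - 1\<close>, which is
  shifted back to the origin for the induction.
\<close>

lemma poly2_le_unisolvent:
  assumes "poly2_le k q" "\<And>i j::nat. i + j \<le> k \<Longrightarrow> q (vector [real i, real j]) = 0"
  shows "q x = 0"
  using assms
proof (induction k arbitrary: q x)
  case 0
  obtain c where c: "\<And>x. q x = c" using "0.prems"(1) unfolding poly2_le_def by auto
  then show ?case using "0.prems"(2)[of 0 0] by simp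
next
  case (Suc k)
  obtain c where c: "\<And>x. q x = (\<Sum>i\<le>Suc k. \<Sum>j\<le>Suc k - i. c i j * (x$1)^i * (x$2)^j)"
    using Suc.prems unfolding poly2_le_def by blast
  define r where "r = (\<Sum>j\<le>Suc k. monom (c 0 j) j)"
  have q0: "q (vector [0, s]) = poly r s" for s
  proof -
    have "(\<Sum>i\<le>Suc k. \<Sum>j\<le>Suc k - i. c i j * 0^i * s^j) = (\<Sum>i\<in>{0}. \<Sum>j\<le>Suc k - i. c i j * 0^i * s^j)"
      by (rule sum.mono_neutral_right) (auto intro!: sum.neutral simp: power_0_left)
    then show ?thesis unfolding c r_def by (simp add: poly_sum poly_monom)
  qed
  have "r = 0"
  proof (rule poly_eq_0_of_many_roots[of _ "Suc k" 1])
    show "degree r \<le> Suc k" unfolding r_def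
      by (intro degree_sum_le) (auto intro: order.trans[OF degree_monom_le])
    show "poly r (real i / real 1) = 0" if "i \<le> Suc k" for i
      using Suc.prems(2)[of 0 i] that q0[of "real i"] by simp
  qed simp
  have c0: "c 0 j = 0" if "j \<le> Suc k" for j
  proof -
    have "coeff r j = c 0 j"
      using that unfolding r_def by (simp add: coeff_sum del: sum.atMost_Suc)
    then show ?thesis using \<open>r = 0\<close> by simp
  qed
  define q' where "q' = (\<lambda>x::real^2. \<Sum>i\<le>k. \<Sum>j\<le>k - i. c (Suc i) j * (x$1)^i * (x$2)^j)"
  have q': "q x = x$1 * q' x" for x
  proof -
    have "q x = (\<Sum>i\<in>Suc ` {..k}. \<Sum>j\<le>Suc k - i. c i j * (x$1)^i * (x$2)^j)"
      unfolding c
    proof (rule sum.mono_neutral_right)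
      show "\<forall>i\<in>{..Suc k} - Suc ` {..k}. (\<Sum>j\<le>Suc k - i. c i j * (x$1)^i * (x$2)^j) = 0"
      proof
        fix i assume "i \<in> {..Suc k} - Suc ` {..k}"
        then have "i = 0" by (cases i) auto
        then show "(\<Sum>j\<le>Suc k - i. c i j * (x$1)^i * (x$2)^j) = 0" using c0 by (intro sum.neutral) auto
      qed
    qed auto
    also have "\<dots> = (\<Sum>i\<le>k. \<Sum>j\<le>k - i. c (Suc i) j * (x$1)^(Suc i) * (x$2)^j)"
      by (subst sum.reindex) auto
    also have "\<dots> = x$1 * q' x" unfolding q'_def by (simp add: sum_distrib_left mult_ac)
    finally show ?thesis .
  qed
  define h where "h = (\<lambda>x::real^2. vector [x$1 + 1, x$2] :: real^2)"
  have "poly2_le k q'" unfolding poly2_le_def q'_def by (intro exI[of _ "\<lambda>i. c (Suc i)"]) simp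
  then have "poly2_le k (\<lambda>x. q' (h x))"
    by (rule poly2_le_compose) (use poly2_le_affine[of 1 1 0 1] poly2_le_affine[of 1 0 1 0] in \<open>auto simp: h_def\<close>)
  moreover have "q' (h (vector [real i, real j])) = 0" if "i + j \<le> k" for i j
    using Suc.prems(2)[of "Suc i" j] that by (simp add: q' h_def add.commute)
  ultimately have "q' (h y) = 0" for y by (rule Suc.IH)
  from this[of "vector [x$1 - 1, x$2]"] have "q' (vector [x$1, x$2]) = 0" by (simp add: h_def)
  moreover have "vector [x$1, x$2] = x" by (simp add: vec_eq_iff forall_2)
  ultimately show ?case using q' by simp
qed

section \<open>Legendre polynomials\<close>

lemma degree_legendre: "degree (legendre n) = n"
proof -
  have "degree ([:-1, 0, 1::real:] ^ n) = 2 * n" by (simp add: degree_power_eq)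
  then show ?thesis unfolding legendre_def by (simp add: degree_higher_pderiv)
qed

text \<open>In the product rule only the term without a factor \<open>X - a\<close> survives.\<close>

lemma higher_pderiv_at_root:
  fixes g :: "real poly"
  shows "poly ((pderiv ^^ n) ([:-a, 1:] ^ n * g)) a = fact n * poly g a"
proof (induction n arbitrary: g)
  case (Suc n)
  have *: "pderiv (r ^ Suc n * g) = r ^ n * (smult (of_nat (Suc n)) g + r * pderiv g)"
    if "pderiv r = 1" for r
    unfolding pderiv_mult pderiv_power_Suc that by (simp add: algebra_simps del: of_nat_Suc)
  have "pderiv ([:-a, 1:] ^ Suc n * g) = [:-a, 1:] ^ n * (smult (of_nat (Suc n)) g + [:-a, 1:] * pderiv g)"
    by (rule *) (simp add: pderiv_pCons)
  then have "(pderiv ^^ Suc n) ([:-a, 1:] ^ Suc n * g)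
     = (pderiv ^^ n) ([:-a, 1:] ^ n * (smult (of_nat (Suc n)) g + [:-a, 1:] * pderiv g))"
    by (simp only: funpow_Suc_right o_def)
  then show ?case using Suc[of "smult (of_nat (Suc n)) g + [:-a, 1:] * pderiv g"]
    by (simp add: algebra_simps)
qed simp

lemma legendre_at_1: "poly (legendre n) 1 = 1"
proof -
  have "[:-1, 0, 1::real:] ^ n = [:-1, 1:] ^ n * [:1, 1:] ^ n"
    by (simp flip: power_mult_distrib)
  then have "poly ((pderiv ^^ n) ([:-1, 0, 1::real:] ^ n)) 1 = fact n * 2 ^ n"
    using higher_pderiv_at_root[of n 1 "[:1, 1:] ^ n"] by (simp add: poly_power)
  then show ?thesis unfolding legendre_def by simp
qed

lemma legendre_minus: "poly (legendre n) (- x) = (-1) ^ n * poly (legendre n) x"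
proof -
  have *: "pcompose ((pderiv ^^ n) f) [:0, -1:] = smult ((-1) ^ n) ((pderiv ^^ n) (pcompose f [:0, -1:]))"
    for f :: "real poly"
  proof (induction n arbitrary: f)
    case (Suc n)
    have "pcompose (pderiv f) [:0, -1:] = - pderiv (pcompose f [:0, -1:])" for f :: "real poly"
      by (simp add: pderiv_pcompose pderiv_pCons)
    moreover have "(pderiv ^^ n) (- g) = - (pderiv ^^ n) g" for g :: "real poly"
      using higher_pderiv_smult[of n "-1" g] by simp
    ultimately show ?case using Suc[of "pderiv f"]
      by (simp add: funpow_Suc_right del: funpow.simps)
  qed simp
  have "pcompose (f ^ n) g = pcompose f g ^ n" for f g :: "real poly"
    by (induction n) (simp_all add: pcompose_mult pcompose_1)
  moreover have "pcompose [:-1, 0, 1:] [:0, -1:] = [:-1, 0, 1::real:]"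
    by (simp add: pcompose_pCons)
  ultimately have "pcompose ([:-1, 0, 1:] ^ n) [:0, -1:] = [:-1, 0, 1::real:] ^ n" by simp
  then have "pcompose ((pderiv ^^ n) ([:-1, 0, 1:] ^ n)) [:0, -1:]
      = smult ((-1) ^ n) ((pderiv ^^ n) ([:-1, 0, 1::real:] ^ n))"
    using *[of "[:-1, 0, 1:] ^ n"] by (simp only:)
  from arg_cong[OF this, of "\<lambda>r. poly r x"]
  have "poly ((pderiv ^^ n) ([:-1, 0, 1:] ^ n)) (- x) = (-1) ^ n * poly ((pderiv ^^ n) ([:-1, 0, 1:] ^ n)) x"
    by (simp add: poly_pcompose)
  then show ?thesis unfolding legendre_def by simp
qed

lemma power_dvd_higher_pderiv:
  fixes f r :: "real poly"
  shows "r ^ (j + m) dvd f \<Longrightarrow> r ^ m dvd (pderiv ^^ j) f"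
proof (induction j arbitrary: f)
  case (Suc j)
  then obtain g where "f = r ^ Suc (j + m) * g" by (metis add_Suc dvdE)
  then have "pderiv f = pderiv (r ^ Suc (j + m) * g)" by simp
  then have "pderiv f = r ^ (j + m) * (smult (of_nat (Suc (j + m))) (pderiv r * g) + r * pderiv g)"
    unfolding pderiv_mult pderiv_power_Suc by (simp add: algebra_simps del: of_nat_Suc)
  then have "r ^ m dvd (pderiv ^^ j) (pderiv f)" by (intro Suc.IH) simp
  then show ?case by (simp add: funpow_Suc_right del: funpow.simps)
qed simp

lemma continuous_on_real_poly [continuous_intros]: "continuous_on S (\<lambda>t. poly (r::real poly) t)"
  by (intro continuous_intros)

lemma integral_by_parts_poly:
  fixes f g :: "real poly"
  assumes "poly f (-1) = 0" "poly f 1 = 0"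
  shows "integral {-1..1} (\<lambda>t. poly (pderiv f * g) t) = - integral {-1..1} (\<lambda>t. poly (f * pderiv g) t)"
proof -
  have "((\<lambda>t. poly (pderiv (f * g)) t) has_integral poly (f * g) 1 - poly (f * g) (-1)) {-1..1}"
  proof (rule fundamental_theorem_of_calculus)
    fix x :: real
    show "(poly (f * g) has_vector_derivative poly (pderiv (f * g)) x) (at x within {-1..1})"
      unfolding has_real_derivative_iff_has_vector_derivative[symmetric]
      by (rule has_field_derivative_at_within[OF poly_DERIV])
  qed simp
  then have "integral {-1..1} (\<lambda>t. poly (pderiv f * g) t + poly (f * pderiv g) t) = 0"
    using assms by (intro integral_unique) (simp add: pderiv_mult algebra_simps)
  then show ?thesis
    by (subst (asm) integral_add)
      (auto intro!: integrable_continuous_real continuous_intros simp del: poly_mult)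
qed

lemma poly_0_fun [simp]: "poly 0 = (\<lambda>x. 0)"
  by auto

text \<open>
  Integration by parts moves the derivatives onto \<open>q\<close>, whose degree is less than their number. The
  boundary terms vanish since fewer than \<open>n\<close> derivatives of \<open>(X\<^sup>2 - 1)\<^sup>n\<close> leave a factor
  \<open>X\<^sup>2 - 1\<close>.
\<close>

lemma legendre_orthogonal_aux:
  fixes q :: "real poly"
  shows "j \<le> n \<Longrightarrow> q = 0 \<or> degree q < j \<Longrightarrow>
    integral {-1..1} (\<lambda>t. poly ((pderiv ^^ j) ([:-1, 0, 1:] ^ n) * q) t) = 0"
proof (induction j arbitrary: q)
  case (Suc j)
  let ?F = "(pderiv ^^ j) ([:-1, 0, 1::real:] ^ n)"
  have "[:-1, 0, 1::real:] ^ (n - j) dvd ?F" using Suc.prems by (intro power_dvd_higher_pderiv) simp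
  then have "[:-1, 0, 1::real:] dvd ?F" using Suc.prems
    by (metis Suc_le_eq dvd_power dvd_trans zero_less_diff)
  then obtain g where "?F = [:-1, 0, 1::real:] * g" by (auto elim: dvdE)
  then have "poly ?F (-1) = 0" "poly ?F 1 = 0" by simp_all
  then have "integral {-1..1} (\<lambda>t. poly (pderiv ?F * q) t) = - integral {-1..1} (\<lambda>t. poly (?F * pderiv q) t)"
    by (rule integral_by_parts_poly)
  moreover have "pderiv q = 0 \<or> degree (pderiv q) < j"
    using Suc.prems by (cases "degree q = 0") (auto simp: degree_pderiv pderiv_eq_0_iff)
  ultimately show ?case using Suc by simp
qed auto

lemma legendre_orthogonal:
  fixes q :: "real poly"
  assumes "degree q < n"
  shows "integral {-1..1} (\<lambda>t. poly (legendre n) t * poly q t) = 0"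
proof -
  have "(\<lambda>t. poly (legendre n) t * poly q t)
     = (\<lambda>t. (1 / (2 ^ n * fact n)) *\<^sub>R poly ((pderiv ^^ n) ([:-1, 0, 1:] ^ n) * q) t)"
    unfolding legendre_def by (simp add: mult_ac)
  then have "integral {-1..1} (\<lambda>t. poly (legendre n) t * poly q t)
     = (1 / (2 ^ n * fact n)) *\<^sub>R integral {-1..1} (\<lambda>t. poly ((pderiv ^^ n) ([:-1, 0, 1:] ^ n) * q) t)"
    by (simp only: integral_cmul)
  then show ?thesis using legendre_orthogonal_aux[of n n q] assms by (simp only: order_refl simp_thms) simp
qed

text \<open>The Legendre polynomial transplanted to the parameter interval of \<open>linepath\<close>.\<close>

definition edge_legendre :: "nat \<Rightarrow> real \<Rightarrow> real" where
  "edge_legendre p t = poly (legendre p) (2 * t - 1)"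

definition edge_legendre_poly :: "nat \<Rightarrow> real poly" where
  "edge_legendre_poly p = pcompose (legendre p) [:-1, 2:]"

lemma poly_edge_legendre [simp]: "poly (edge_legendre_poly p) t = edge_legendre p t"
  by (simp add: edge_legendre_poly_def edge_legendre_def poly_pcompose algebra_simps)

lemma degree_edge_legendre: "degree (edge_legendre_poly p) = p"
  by (simp add: edge_legendre_poly_def degree_pcompose degree_legendre)

lemma edge_legendre_1 [simp]: "edge_legendre p 1 = 1"
  by (simp add: edge_legendre_def legendre_at_1)

lemma edge_legendre_reflect: "edge_legendre p (1 - t) = (-1) ^ p * edge_legendre p t"
  using legendre_minus[of p "2 * t - 1"] by (simp add: edge_legendre_def algebra_simps)

lemma edge_legendre_0 [simp]: "edge_legendre p 0 = (-1) ^ p"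
  using edge_legendre_reflect[of p 1] by simp

lemma legendre_edge: "poly (legendre p) (1 - 2 * t) = (-1) ^ p * edge_legendre p t"
  using edge_legendre_reflect[of p t] by (simp add: edge_legendre_def algebra_simps)

lemma edge_legendre_orthogonal:
  assumes "degree q < p"
  shows "integral {0..1} (\<lambda>t. edge_legendre p t * poly q t) = 0"
proof -
  let ?g = "\<lambda>s. poly (legendre p) s * poly (pcompose q [:1/2, 1/2:]) s"
  have "degree (pcompose q [:1/2, 1/2:]) < p" using assms by (simp add: degree_pcompose)
  then have 0: "integral {-1..1} ?g = 0" by (rule legendre_orthogonal)
  have "(?g has_integral 0) (cbox (-1) 1)"
    using 0 integrable_integral[OF integrable_continuous_real[of "-1" 1 ?g]]
    by (auto intro!: continuous_intros)
  from has_integral_affinity[OF this, of 2 "-1"]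
  moreover have "(\<lambda>x. x / 2 + 1 / 2) ` {-1..1} = {0..1::real}"
    using image_affinity_atLeastAtMost[of "1/2" "1/2" "-1" "1::real"] by simp
  ultimately have "((\<lambda>t. ?g (2 * t - 1)) has_integral 0) {0..1}"
    by (simp add: cbox_interval)
  then show ?thesis
    by (intro integral_unique) (simp add: edge_legendre_def poly_pcompose algebra_simps add_divide_distrib[symmetric])
qed

text \<open>
  Subtracting a multiple of the Legendre polynomial lowers the degree, and the difference is
  then orthogonal to itself.
\<close>

lemma orthogonal_imp_edge_legendre:
  fixes r :: "real poly"
  assumes "degree r \<le> p" "p \<ge> 1"
    and orth: "\<And>q. degree q \<le> p - 1 \<Longrightarrow> integral {0..1} (\<lambda>t. poly r t * poly q t) = 0"
  obtains c where "\<And>t. poly r t = c * edge_legendre p t"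
proof -
  define c where "c = coeff r p / coeff (edge_legendre_poly p) p"
  define s where "s = r - smult c (edge_legendre_poly p)"
  have "coeff (edge_legendre_poly p) p \<noteq> 0"
    using degree_edge_legendre[of p] assms(2) by (metis degree_0 leading_coeff_0_iff not_one_le_zero)
  then have "coeff s p = 0" by (simp add: s_def c_def)
  moreover have "degree s \<le> p" unfolding s_def
    using assms(1) degree_edge_legendre by (metis degree_diff_le degree_smult_le)
  ultimately have ds: "degree s \<le> p - 1"
    using assms(2) eq_zero_or_degree_less[of s p] by auto
  have "integral {0..1} (\<lambda>t. poly r t * poly s t - c * (edge_legendre p t * poly s t)) = 0"
  proof (subst integral_diff)
    show "(\<lambda>t. poly r t * poly s t) integrable_on {0..1}"
      "(\<lambda>t. c * (edge_legendre p t * poly s t)) integrable_on {0..1}"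
      by (auto intro!: integrable_continuous_real continuous_intros simp flip: poly_edge_legendre)
    show "integral {0..1} (\<lambda>t. poly r t * poly s t) - integral {0..1} (\<lambda>t. c * (edge_legendre p t * poly s t)) = 0"
      using orth[OF ds] edge_legendre_orthogonal[of s p] ds assms(2) by simp
  qed
  then have "integral {0..1} (\<lambda>t. (poly s t)\<^sup>2) = 0"
    by (simp add: s_def power2_eq_square algebra_simps)
  moreover have "continuous_on {0..1} (\<lambda>t. (poly s t)\<^sup>2)" by (intro continuous_intros)
  ultimately have "\<forall>t\<in>{0..1}. (poly s t)\<^sup>2 = 0"
    using integral_eq_0_iff[of 0 1 "\<lambda>t. (poly s t)\<^sup>2"] by auto
  then have "{0..1} \<subseteq> {t. poly s t = 0}" by auto
  moreover have "infinite {0..1::real}" by (simp add: infinite_Icc_iff)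
  ultimately have "s = 0" using poly_roots_finite[of s] finite_subset by blast
  then have "poly r t = c * edge_legendre p t" for t
    unfolding s_def by (metis eq_iff_diff_eq_0 poly_edge_legendre poly_smult)
  then show ?thesis using that by blast
qed

section \<open>Triangles\<close>

definition det2 :: "real^2 \<Rightarrow> real^2 \<Rightarrow> real" where
  "det2 u v = u$1 * v$2 - u$2 * v$1"

text \<open>The sign of the determinant says that the vertices are listed counterclockwise.\<close>

definition tri :: "real^2 \<Rightarrow> real^2 \<Rightarrow> real^2 \<Rightarrow> (real^2) set \<Rightarrow> bool" where
  "tri a b c K \<longleftrightarrow> K = convex hull {a, b, c} \<and> det2 (b - a) (c - a) > 0"

definition verts :: "(real^2) set \<Rightarrow> (real^2) set" where
  "verts K = {z. z extreme_point_of K}"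

text \<open>Cramer's rule for the barycentric coordinate of \<open>a\<close>.\<close>

definition bary_coord :: "real^2 \<Rightarrow> real^2 \<Rightarrow> real^2 \<Rightarrow> real^2 \<Rightarrow> real" where
  "bary_coord a b c x = det2 (b - x) (c - x) / det2 (b - a) (c - a)"

lemma vec2_eq_iff: "(x :: real^2) = y \<longleftrightarrow> x$1 = y$1 \<and> x$2 = y$2"
  by (simp add: vec_eq_iff forall_2)

lemma det2_rot: "det2 (c - b) (a - b) = det2 (b - a) (c - a)"
  by (simp add: det2_def algebra_simps)

lemma det2_minus: "det2 (- u) v = - det2 u v" "det2 u (- v) = - det2 u v"
  by (simp_all add: det2_def)

lemma tri_rot: "tri a b c K \<Longrightarrow> tri b c a K"
  using det2_rot[of c b a] by (simp add: tri_def insert_commute)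

lemma bary_coord_combination:
  assumes "det2 (b - a) (c - a) \<noteq> 0" "u + v + w = 1"
  shows "bary_coord a b c (u *\<^sub>R a + v *\<^sub>R b + w *\<^sub>R c) = u"
proof -
  have u: "u = 1 - v - w" using assms(2) by simp
  have "det2 (b - (u *\<^sub>R a + v *\<^sub>R b + w *\<^sub>R c)) (c - (u *\<^sub>R a + v *\<^sub>R b + w *\<^sub>R c))
      = u * det2 (b - a) (c - a)"
    unfolding u det2_def by (simp add: algebra_simps)
  then show ?thesis using assms(1) by (simp add: bary_coord_def)
qed

lemma bary_coord_sum:
  assumes "det2 (b - a) (c - a) \<noteq> 0"
  shows "bary_coord a b c x + bary_coord b c a x + bary_coord c a b x = 1"
proof -
  have "bary_coord a b c x + bary_coord b c a x + bary_coord c a b x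
     = (det2 (b - x) (c - x) + det2 (c - x) (a - x) + det2 (a - x) (b - x)) / det2 (b - a) (c - a)"
    unfolding bary_coord_def by (simp add: det2_rot[of c b a] det2_rot[of b a c] add_divide_distrib)
  also have "det2 (b - x) (c - x) + det2 (c - x) (a - x) + det2 (a - x) (b - x) = det2 (b - a) (c - a)"
    by (simp add: det2_def algebra_simps)
  finally show ?thesis using assms by simp
qed

lemma bary_coord_recover:
  assumes "det2 (b - a) (c - a) \<noteq> 0"
  shows "bary_coord a b c x *\<^sub>R a + bary_coord b c a x *\<^sub>R b + bary_coord c a b x *\<^sub>R c = x"
proof -
  let ?D = "det2 (b - a) (c - a)"
  have r: "det2 (c - b) (a - b) = ?D" "det2 (a - c) (b - c) = ?D"
    by (simp_all add: det2_def algebra_simps)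
  have "?D *\<^sub>R (bary_coord a b c x *\<^sub>R a + bary_coord b c a x *\<^sub>R b + bary_coord c a b x *\<^sub>R c)
     = det2 (b - x) (c - x) *\<^sub>R a + det2 (c - x) (a - x) *\<^sub>R b + det2 (a - x) (b - x) *\<^sub>R c"
    using assms unfolding bary_coord_def r by (simp add: scaleR_add_right)
  also have "\<dots> = ?D *\<^sub>R x"
    by (simp add: vec2_eq_iff det2_def algebra_simps)
  finally show ?thesis using assms by simp
qed

text \<open>An affine function commutes with affine combinations.\<close>

lemma affine_eq_barycentric:
  assumes "det2 (b - a) (c - a) \<noteq> 0" "\<And>x. l x = \<alpha> \<bullet> x + \<beta>"
  shows "l x = bary_coord a b c x * l a + bary_coord b c a x * l b + bary_coord c a b x * l c"
proof -
  have "l x = \<alpha> \<bullet> (bary_coord a b c x *\<^sub>R a + bary_coord b c a x *\<^sub>R b + bary_coord c a b x *\<^sub>R c)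
     + (bary_coord a b c x + bary_coord b c a x + bary_coord c a b x) * \<beta>"
    using bary_coord_recover[OF assms(1)] bary_coord_sum[OF assms(1)] assms(2) by simp
  then show ?thesis unfolding assms(2) by (simp add: inner_add_right algebra_simps)
qed

lemma det2_eq_0_iff_collinear: "det2 (b - a) (c - a) = 0 \<longleftrightarrow> collinear {a, b, c}"
proof -
  have *: "det2 x y = 0 \<longleftrightarrow> x = 0 \<or> y = 0 \<or> (\<exists>r. y = r *\<^sub>R x)" for x y :: "real^2"
  proof
    assume d: "det2 x y = 0"
    show "x = 0 \<or> y = 0 \<or> (\<exists>r. y = r *\<^sub>R x)"
    proof (cases "x$1 = 0")
      case True
      then have "y$1 = 0 \<or> x$2 = 0" using d by (auto simp: det2_def)
      moreover have "y = (y$2 / x$2) *\<^sub>R x" if "y$1 = 0" "x$2 \<noteq> 0"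
        using True that by (simp add: vec2_eq_iff)
      ultimately show ?thesis using True by (metis vec2_eq_iff zero_index)
    next
      case False
      then have "y = (y$1 / x$1) *\<^sub>R x"
        using d by (simp add: vec2_eq_iff det2_def field_simps)
      then show ?thesis by blast
    qed
  qed (auto simp: det2_def)
  have "collinear {a, b, c} \<longleftrightarrow> collinear {b, a, c}" by (simp add: insert_commute)
  also have "\<dots> \<longleftrightarrow> collinear {0, b - a, c - a}" by (rule collinear_3) (simp add: NO_MATCH_def)
  finally show ?thesis using *[of "b - a" "c - a"] by (simp add: collinear_lemma)
qed

lemma tri_exists:
  assumes "2 simplex K"
  obtains a b c where "tri a b c K"
proof -
  obtain C where C: "\<not> affine_dependent C" "int (card C) = 2 + 1" "K = convex hull C"
    using assms unfolding simplex by blast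
  then have "card C = 3" by simp
  then obtain a b c where abc: "C = {a, b, c}" "a \<noteq> b" "a \<noteq> c" "b \<noteq> c"
    by (auto simp: card_3_iff)
  then have "\<not> collinear {a, b, c}" using C(1) by (simp add: collinear_3_eq_affine_dependent)
  then have "det2 (b - a) (c - a) \<noteq> 0" by (simp add: det2_eq_0_iff_collinear)
  moreover have "det2 (c - a) (b - a) = - det2 (b - a) (c - a)" by (simp add: det2_def)
  ultimately have "tri a b c K \<or> tri a c b K"
    unfolding tri_def C(3) abc(1) by (auto simp: insert_commute)
  then show ?thesis using that by blast
qed

context
  fixes a b c :: "real^2" and K
  assumes tri: "tri a b c K"
begin

lemma tri_nz: "det2 (b - a) (c - a) \<noteq> 0" "det2 (c - b) (a - b) \<noteq> 0" "det2 (a - c) (b - c) \<noteq> 0"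
  using tri det2_rot[of b a c] det2_rot[of c b a] by (auto simp: tri_def)

lemma tri_independent: "\<not> affine_dependent {a, b, c}"
  and tri_distinct: "a \<noteq> b" "b \<noteq> c" "c \<noteq> a"
  using tri_nz(1) by (auto simp: det2_eq_0_iff_collinear collinear_3_eq_affine_dependent)

lemma tri_verts: "verts K = {a, b, c}"
  using tri tri_independent extreme_point_of_convex_hull_affine_independent[of "{a, b, c}"]
  by (auto simp: verts_def tri_def)

lemma bary_coord_at: "bary_coord a b c a = 1" "bary_coord a b c b = 0" "bary_coord a b c c = 0"
  using tri_nz by (simp_all add: bary_coord_def det2_def)

lemma bary_coord_affine: "\<exists>\<alpha> \<beta>. \<forall>x. bary_coord a b c x = \<alpha> \<bullet> x + \<beta>"
proof -
  let ?D = "det2 (b - a) (c - a)"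
  have "bary_coord a b c x = vector [(b$2 - c$2) / ?D, (c$1 - b$1) / ?D] \<bullet> x + det2 b c / ?D" for x
    using tri_nz(1) unfolding inner_vec_def sum_2
    by (simp add: bary_coord_def det2_def[of "b - x"] det2_def[of b] divide_simps) (simp add: algebra_simps)
  then show ?thesis by blast
qed

lemma bary_eq: "bary K a = bary_coord a b c"
  unfolding bary_def
proof (rule the_equality)
  have "B \<in> {a, b, c} \<longleftrightarrow> B extreme_point_of K" for B using tri_verts by (auto simp: verts_def)
  then show "(\<exists>\<alpha> \<beta>. \<forall>x. bary_coord a b c x = \<alpha> \<bullet> x + \<beta>) \<and> bary_coord a b c a = 1
     \<and> (\<forall>B. B extreme_point_of K \<and> B \<noteq> a \<longrightarrow> bary_coord a b c B = 0)"
    using bary_coord_affine bary_coord_at by auto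
  fix l assume l: "(\<exists>\<alpha> \<beta>. \<forall>x. l x = \<alpha> \<bullet> x + \<beta>) \<and> l a = 1 \<and> (\<forall>B. B extreme_point_of K \<and> B \<noteq> a \<longrightarrow> l B = 0)"
  have "b extreme_point_of K" "c extreme_point_of K" using tri_verts by (auto simp: verts_def)
  then have l0: "l a = 1" "l b = 0" "l c = 0" using l tri_distinct by auto
  obtain \<alpha> \<beta> where l: "\<forall>x. l x = \<alpha> \<bullet> x + \<beta>"
    using conjunct1[OF l] by (elim exE)
  show "l = bary_coord a b c"
  proof
    fix x
    show "l x = bary_coord a b c x" using affine_eq_barycentric[OF tri_nz(1) l[rule_format], of x] unfolding l0 by simp
  qed
qed

lemma poly2_le_bary_coord: "poly2_le 1 (bary_coord a b c)"
proof -
  obtain \<alpha> \<beta> where "\<forall>x. bary_coord a b c x = \<alpha> \<bullet> x + \<beta>" using bary_coord_affine by (elim exE)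
  then have *: "bary_coord a b c x = \<alpha> \<bullet> x + \<beta>" for x by simp
  have "bary_coord a b c = (\<lambda>x. \<alpha>$1 * x$1 + \<alpha>$2 * x$2 + \<beta>)"
    by (intro ext) (simp add: * inner_vec_def sum_2)
  then show ?thesis using poly2_le_affine[of 1] by simp
qed

lemma bary_coord_linepath: "bary_coord a b c (linepath x y t) = (1 - t) * bary_coord a b c x + t * bary_coord a b c y"
proof -
  obtain \<alpha> \<beta> where "\<forall>x. bary_coord a b c x = \<alpha> \<bullet> x + \<beta>" using bary_coord_affine by (elim exE)
  then have *: "bary_coord a b c x = \<alpha> \<bullet> x + \<beta>" for x by simp
  show ?thesis unfolding * linepath_def by (simp add: inner_add_right algebra_simps)
qed

lemma tri_mem_iff: "x \<in> K \<longleftrightarrow> 0 \<le> bary_coord a b c x \<and> 0 \<le> bary_coord b c a x \<and> 0 \<le> bary_coord c a b x"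
proof
  assume "x \<in> K"
  then obtain u v w where uvw: "0 \<le> u" "0 \<le> v" "0 \<le> w" "u + v + w = 1"
    and x: "x = u *\<^sub>R a + v *\<^sub>R b + w *\<^sub>R c"
    using tri unfolding tri_def convex_hull_3 by blast
  have "bary_coord a b c x = u" unfolding x using bary_coord_combination[OF tri_nz(1) uvw(4)] .
  moreover have "bary_coord b c a (v *\<^sub>R b + w *\<^sub>R c + u *\<^sub>R a) = v"
    using bary_coord_combination[OF tri_nz(2), of v w u] uvw(4) by (simp add: ac_simps)
  then have "bary_coord b c a x = v" unfolding x by (simp add: ac_simps)
  moreover have "bary_coord c a b (w *\<^sub>R c + u *\<^sub>R a + v *\<^sub>R b) = w"
    using bary_coord_combination[OF tri_nz(3), of w u v] uvw(4) by (simp add: ac_simps)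
  then have "bary_coord c a b x = w" unfolding x by (simp add: ac_simps)
  ultimately show "0 \<le> bary_coord a b c x \<and> 0 \<le> bary_coord b c a x \<and> 0 \<le> bary_coord c a b x" using uvw by simp
next
  assume *: "0 \<le> bary_coord a b c x \<and> 0 \<le> bary_coord b c a x \<and> 0 \<le> bary_coord c a b x"
  have "x = bary_coord a b c x *\<^sub>R a + bary_coord b c a x *\<^sub>R b + bary_coord c a b x *\<^sub>R c"
    using bary_coord_recover[OF tri_nz(1)] by simp
  with * bary_coord_sum[OF tri_nz(1), of x] show "x \<in> K"
    using tri unfolding tri_def convex_hull_3 by blast
qed

lemma continuous_bary_coord: "continuous_on S (bary_coord a b c)"
  using poly2_le_bary_coord by (rule poly2_le_continuous)

lemma bary_coord_eventually_pos: "0 < bary_coord a b c x \<Longrightarrow> \<forall>\<^sub>F y in nhds x. 0 < bary_coord a b c y"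
  using continuous_bary_coord[of UNIV] by (auto simp: continuous_on_eq_continuous_at isCont_def
      intro: order_tendstoD tendsto_at_iff_tendsto_nhds[THEN iffD1])

lemma tri_edge_iff:
  "E edge_of K \<longleftrightarrow> E \<in> {closed_segment a b, closed_segment b c, closed_segment c a}"
proof -
  have K: "K = convex hull {a, b, c}" using tri by (simp add: tri_def)
  have e1: "E edge_of K \<longleftrightarrow> (\<exists>S\<subseteq>{a, b, c}. E = convex hull S \<and> card S = 2)"
  proof
    assume "E edge_of K"
    then have E: "E face_of K" "aff_dim E = 1" by (auto simp: edge_of_def)
    then obtain S where S: "S \<subseteq> {a, b, c}" "E = convex hull S"
      using face_of_convex_hull_affine_independent[OF tri_independent] unfolding K by blast
    then have "\<not> affine_dependent S" using tri_independent affine_dependent_subset by blast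
    then have "int (card S) = 2"
      using E(2) aff_dim_affine_independent[of S] unfolding S(2) by (simp add: aff_dim_convex_hull)
    then show "\<exists>S\<subseteq>{a, b, c}. E = convex hull S \<and> card S = 2" using S by auto
  next
    assume "\<exists>S\<subseteq>{a, b, c}. E = convex hull S \<and> card S = 2"
    then obtain S where S: "S \<subseteq> {a, b, c}" "E = convex hull S" "card S = 2" by blast
    then have "\<not> affine_dependent S" using tri_independent affine_dependent_subset by blast
    then have "aff_dim E = 1"
      using aff_dim_affine_independent[of S] S by (simp add: aff_dim_convex_hull)
    moreover have "E face_of K"
      using S face_of_convex_hull_affine_independent[OF tri_independent] unfolding K by blast
    ultimately show "E edge_of K" by (simp add: edge_of_def)
  qed
  have *: "S \<subseteq> {a, b, c} \<and> card S = 2 \<longleftrightarrow> S = {a, b} \<or> S = {b, c} \<or> S = {c, a}" for S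
    using tri_distinct by (auto simp: card_2_iff doubleton_eq_iff)
  have "(\<exists>S\<subseteq>{a, b, c}. E = convex hull S \<and> card S = 2)
     \<longleftrightarrow> (\<exists>S. (S = {a, b} \<or> S = {b, c} \<or> S = {c, a}) \<and> E = convex hull S)"
    unfolding *[symmetric] by auto
  also have "\<dots> \<longleftrightarrow> E \<in> {closed_segment a b, closed_segment b c, closed_segment c a}"
    unfolding segment_convex_hull by (simp add: conj_disj_distribR ex_disj_distrib)
  finally show ?thesis using e1 by simp
qed

end

lemma tri_interiorI:
  assumes "tri a b c K" "0 < bary_coord a b c x" "0 < bary_coord b c a x" "0 < bary_coord c a b x"
  shows "x \<in> interior K"
proof -
  note t = assms(1) tri_rot[OF assms(1)] tri_rot[OF tri_rot[OF assms(1)]]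
  have "\<forall>\<^sub>F y in nhds x. y \<in> K"
    using bary_coord_eventually_pos[OF t(1) assms(2)] bary_coord_eventually_pos[OF t(2) assms(3)]
      bary_coord_eventually_pos[OF t(3) assms(4)]
    by eventually_elim (simp add: tri_mem_iff[OF t(1)])
  then show ?thesis by (auto simp: eventually_nhds interior_def)
qed

lemma tri_interior_nonempty: "tri a b c K \<Longrightarrow> interior K \<noteq> {}"
proof -
  assume t: "tri a b c K"
  let ?g = "(1/3) *\<^sub>R a + (1/3) *\<^sub>R b + (1/3) *\<^sub>R c"
  have "bary_coord a b c ?g = 1/3" "bary_coord b c a ?g = 1/3" "bary_coord c a b ?g = 1/3"
    using bary_coord_combination[OF tri_nz(1)[OF t], of "1/3" "1/3" "1/3"]
      bary_coord_combination[OF tri_nz(2)[OF t], of "1/3" "1/3" "1/3"]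
      bary_coord_combination[OF tri_nz(3)[OF t], of "1/3" "1/3" "1/3"] by (simp_all add: ac_simps)
  then show ?thesis using tri_interiorI[OF t, of ?g] by auto
qed

lemma tri_ordered:
  assumes "tri a b c K" "u \<in> verts K" "v \<in> verts K" "u \<noteq> v"
  shows "(\<exists>w. tri u v w K) \<or> (\<exists>w. tri v u w K)"
proof -
  have "u \<in> {a, b, c}" "v \<in> {a, b, c}" using assms(2,3) by (simp_all add: tri_verts[OF assms(1)])
  then have "(u = a \<and> v = b \<or> u = b \<and> v = c \<or> u = c \<and> v = a) \<or> (v = a \<and> u = b \<or> v = b \<and> u = c \<or> v = c \<and> u = a)"
    using assms(4) by auto
  then show ?thesis
    using assms(1) tri_rot[OF assms(1)] tri_rot[OF tri_rot[OF assms(1)]] by auto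
qed

lemma tri_bary_coord_edge:
  assumes t: "tri u v w K" and x: "x \<in> open_segment u v"
  shows "bary_coord w u v y = det2 (v - u) (y - x) / det2 (v - u) (w - u)" "bary_coord u v w x > 0" "bary_coord v w u x > 0"
    "bary_coord w u v x = 0"
proof -
  obtain s where s: "0 < s" "s < 1" "x = linepath u v s"
    using x by (auto simp: in_segment linepath_def)
  show "bary_coord w u v y = det2 (v - u) (y - x) / det2 (v - u) (w - u)"
    unfolding bary_coord_def s(3) linepath_def by (simp add: det2_def algebra_simps)
  show "bary_coord u v w x > 0" "bary_coord v w u x > 0" "bary_coord w u v x = 0" unfolding s(3)
    using s bary_coord_linepath[OF t] bary_coord_linepath[OF tri_rot[OF t]] bary_coord_linepath[OF tri_rot[OF tri_rot[OF t]]]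
      bary_coord_at[OF t] bary_coord_at[OF tri_rot[OF t]] bary_coord_at[OF tri_rot[OF tri_rot[OF t]]] by simp_all
qed

text \<open>
  The coordinates of \<open>u\<close> and \<open>v\<close> stay positive near \<open>x\<close>, and the coordinate of \<open>w\<close> is a positive
  multiple of the determinant. So the triangle is a half plane near \<open>x\<close>.
\<close>

lemma tri_half_plane:
  assumes t: "tri u v w K" and x: "x \<in> open_segment u v"
  shows "\<forall>\<^sub>F y in nhds x. (det2 (v - u) (y - x) > 0 \<longrightarrow> y \<in> interior K)
     \<and> (det2 (v - u) (y - x) \<ge> 0 \<longrightarrow> y \<in> K)"
proof -
  note t' = t tri_rot[OF t] tri_rot[OF tri_rot[OF t]]
  have D: "det2 (v - u) (w - u) > 0" using t by (simp add: tri_def)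
  show ?thesis
    using bary_coord_eventually_pos[OF t'(1) tri_bary_coord_edge(2)[OF t x]] bary_coord_eventually_pos[OF t'(2) tri_bary_coord_edge(3)[OF t x]]
  proof eventually_elim
    case (elim y)
    have "0 < det2 (v - u) (y - x) \<Longrightarrow> 0 < bary_coord w u v y" "0 \<le> det2 (v - u) (y - x) \<Longrightarrow> 0 \<le> bary_coord w u v y"
      unfolding tri_bary_coord_edge(1)[OF t x] using D by simp_all
    then show ?case using elim tri_mem_iff[OF t] tri_interiorI[OF t] by auto
  qed
qed

lemma tri_half_plane_mem:
  assumes t: "tri u v w K" and x: "x \<in> open_segment u v" and y: "y \<in> K"
  shows "det2 (v - u) (y - x) \<ge> 0"
proof -
  have "bary_coord w u v y \<ge> 0" using y tri_mem_iff[OF t] by simp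
  then show ?thesis unfolding tri_bary_coord_edge(1)[OF t x]
    using t by (simp add: tri_def zero_le_divide_iff)
qed

lemma tri_verts_face:
  assumes t: "tri a b c K" and S: "S \<subseteq> verts K" "a \<notin> S" and x: "x \<in> convex hull S"
  shows "bary_coord a b c x = 0"
proof -
  have "S \<subseteq> {b, c}" using S unfolding tri_verts[OF t] by blast
  then have "x \<in> closed_segment b c" using x hull_mono unfolding segment_convex_hull by blast
  then obtain s where "x = linepath b c s" by (auto simp: in_segment linepath_def)
  then show ?thesis using bary_coord_linepath[OF t] bary_coord_at[OF t] by simp
qed

lemma verts_subset: "verts K \<subseteq> K"
  by (auto simp: verts_def extreme_point_of_def)

lemma tri_at:
  assumes "tri a b c K" "z \<in> verts K"
  obtains u v where "tri z u v K"
proof -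
  have "z \<in> {a, b, c}" using assms(2) by (simp add: tri_verts[OF assms(1)])
  then show ?thesis
    using assms(1) tri_rot[OF assms(1)] tri_rot[OF tri_rot[OF assms(1)]] that by auto
qed

lemma tri_edge_verts:
  assumes t: "tri a b c K" and E: "E edge_of K"
  obtains u v where "u \<noteq> v" "E = closed_segment u v" "verts K \<inter> E = {u, v}"
proof -
  have *: "verts K \<inter> closed_segment u v = {u, v}" if t: "tri u v w K" for u v w
  proof -
    have "w \<notin> closed_segment u v"
    proof
      assume "w \<in> closed_segment u v"
      then have "bary_coord w u v w = 0"
        using tri_distinct[OF t] unfolding segment_convex_hull
        by (intro tri_verts_face[OF tri_rot[OF tri_rot[OF t]], of "{u, v}"]) (auto simp: tri_verts[OF t])
      then show False using bary_coord_at(1)[OF tri_rot[OF tri_rot[OF t]]] by simp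
    qed
    then show ?thesis by (auto simp: tri_verts[OF t])
  qed
  consider "E = closed_segment a b" | "E = closed_segment b c" | "E = closed_segment c a"
    using E unfolding tri_edge_iff[OF t] by auto
  then show ?thesis
    using that tri_distinct[OF t] *[OF t] *[OF tri_rot[OF t]] *[OF tri_rot[OF tri_rot[OF t]]]
    by cases auto
qed

text \<open>The quarter turn; it points to the left of \<open>u\<close>.\<close>

definition perp :: "real^2 \<Rightarrow> real^2" where
  "perp u = vector [- u$2, u$1]"

lemma det2_perp: "det2 u (r *\<^sub>R perp u) = r * (u \<bullet> u)"
  by (simp add: det2_def perp_def inner_vec_def sum_2 algebra_simps)

lemma tendsto_ray: "((\<lambda>e. x + e *\<^sub>R n) \<longlongrightarrow> x) (at_right 0)" for x n :: "real^2"
proof -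
  have "((\<lambda>e. x + e *\<^sub>R n) \<longlongrightarrow> x + 0 *\<^sub>R n) (at_right 0)" by (intro tendsto_intros)
  then show ?thesis by simp
qed

lemma eventually_ray:
  fixes x n :: "real^2"
  assumes "\<forall>\<^sub>F y in nhds x. P y"
  shows "\<forall>\<^sub>F e in at_right 0. P (x + e *\<^sub>R n)"
  using assms tendsto_ray[of x n] by (rule eventually_compose_filterlim)

lemma ray_exists:
  fixes x n :: "real^2"
  assumes "\<forall>\<^sub>F y in nhds x. P y"
  obtains e where "e > 0" "P (x + e *\<^sub>R n)"
proof -
  have "\<forall>\<^sub>F e in at_right 0. 0 < e \<and> P (x + e *\<^sub>R n)"
    using eventually_at_right_less eventually_ray[OF assms] by (rule eventually_conj)
  then obtain e where "0 < e \<and> P (x + e *\<^sub>R n)"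
    using eventually_happens'[OF trivial_limit_at_right_real] by blast
  then show ?thesis using that by blast
qed

section \<open>Geometry of a triangulation\<close>

locale triangulation =
  fixes \<Omega> :: "(real^2) set" and T :: "(real^2) set set"
  assumes reg: "regular_triangulation T \<Omega>"
begin

lemma finite_T [simp]: "finite T"
  and Omega_eq: "\<Omega> = interior (\<Union>T)"
  and simplex_T: "K \<in> T \<Longrightarrow> 2 simplex K"
  using reg by (auto simp: regular_triangulation_def)

lemma open_Omega: "open \<Omega>"
  by (simp add: Omega_eq)

lemma triE:
  assumes "K \<in> T" obtains a b c where "tri a b c K"
  using tri_exists[OF simplex_T[OF assms]] by blast

lemma triangle_facts:
  assumes "K \<in> T"
  shows "compact K" "convex K" "interior K \<noteq> {}" "finite (verts K)" "card (verts K) = 3"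
    "K = convex hull (verts K)"
proof -
  obtain a b c where t: "tri a b c K" using triE[OF assms] .
  then have K: "K = convex hull {a, b, c}" by (simp add: tri_def)
  then show "compact K" "convex K" by (simp_all add: finite_imp_compact_convex_hull)
  show "interior K \<noteq> {}" using tri_interior_nonempty[OF t] .
  show "finite (verts K)" "card (verts K) = 3" "K = convex hull (verts K)"
    using tri_distinct[OF t] K unfolding tri_verts[OF t] by auto
qed

lemma closed_T: "K \<in> T \<Longrightarrow> closed K"
  using triangle_facts(1) compact_imp_closed by blast

lemma tri_atE:
  assumes "K \<in> T" "z \<in> verts K" obtains u v where "tri z u v K"
  using triE[OF assms(1)] tri_at assms(2) by metis

text \<open>
  In each of the three cases of the definition the intersection is the face of \<open>K\<close> spanned by the
  common vertices, and it is not all of \<open>K\<close>, which has three vertices.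
\<close>

lemma triangle_intersection:
  assumes K: "K \<in> T" "K' \<in> T" "K \<noteq> K'"
  shows "K \<inter> K' = convex hull (verts K \<inter> verts K')"
    and "\<exists>w\<in>verts K. w \<notin> K'"
    and "interior K \<inter> K' = {}"
proof -
  obtain a b c where t: "tri a b c K" using triE[OF K(1)] .
  obtain a' b' c' where t': "tri a' b' c' K'" using triE[OF K(2)] .
  have VV: "verts K \<inter> verts K' \<subseteq> verts K \<inter> (K \<inter> K')" using verts_subset by blast
  have face: "K \<inter> K' = convex hull (verts K \<inter> verts K') \<and> card (verts K \<inter> (K \<inter> K')) \<le> 2
     \<and> (K \<inter> K') face_of K"
  proof -
    have "K \<inter> K' = {}
          \<or> (\<exists>E. E edge_of K \<and> E edge_of K' \<and> K \<inter> K' = E)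
          \<or> (\<exists>z. z extreme_point_of K \<and> z extreme_point_of K' \<and> K \<inter> K' = {z})"
      using reg K unfolding regular_triangulation_def by simp
    then consider "K \<inter> K' = {}" | E where "E edge_of K" "E edge_of K'" "K \<inter> K' = E"
      | z where "z extreme_point_of K" "z extreme_point_of K'" "K \<inter> K' = {z}"
      by (elim disjE exE conjE)
    then show ?thesis
    proof cases
      case 1
      then have "verts K \<inter> verts K' = {}" using VV by blast
      then show ?thesis using 1 by simp
    next
      case (2 E)
      obtain u v where uv: "u \<noteq> v" "E = closed_segment u v" "verts K \<inter> E = {u, v}"
        using tri_edge_verts[OF t 2(1)] .
      obtain u' v' where uv': "u' \<noteq> v'" "E = closed_segment u' v'" "verts K' \<inter> E = {u', v'}"
        using tri_edge_verts[OF t' 2(2)] .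
      have "{u, v} = {u', v'}" using uv(2) uv'(2) by (simp add: closed_segment_eq)
      then have "verts K \<inter> verts K' = {u, v}" using VV uv(3) uv'(3) 2(3) by blast
      then show ?thesis using 2 uv edge_of_imp_subset by (auto simp: segment_convex_hull edge_of_def card_2_iff)
    next
      case (3 z)
      then have "z \<in> verts K \<inter> verts K'" by (simp add: verts_def)
      then have "verts K \<inter> verts K' = {z}" using VV 3(3) by blast
      moreover have "card (verts K \<inter> {z}) \<le> 2" using card_mono[of "{z}" "verts K \<inter> {z}"] by simp
      ultimately show ?thesis using 3 by (simp add: face_of_singleton)
    qed
  qed
  show "K \<inter> K' = convex hull (verts K \<inter> verts K')" using face by blast
  show w: "\<exists>w\<in>verts K. w \<notin> K'"
  proof (rule ccontr)
    assume "\<not> (\<exists>w\<in>verts K. w \<notin> K')"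
    then have "verts K \<inter> (K \<inter> K') = verts K" using verts_subset by blast
    moreover have "card (verts K \<inter> (K \<inter> K')) \<le> 2" using face by blast
    ultimately have "card (verts K) \<le> 2" by (simp only:)
    then show False using triangle_facts(5)[OF K(1)] by simp
  qed
  have "K \<inter> K' \<noteq> K" using w verts_subset by blast
  then have "(K \<inter> K') \<inter> interior K = {}" using face face_of_disjoint_interior by blast
  then show "interior K \<inter> K' = {}" using interior_subset by blast
qed

lemma vertex_of_incident_triangle:
  assumes "z \<in> verts K" "K \<in> T" "K' \<in> T" "z \<in> K'"
  shows "z \<in> verts K'"
proof (rule ccontr)
  assume z: "z \<notin> verts K'"
  then have ne: "K \<noteq> K'" using assms by blast
  have "z \<in> K \<inter> K'" using assms verts_subset by blast
  then have zh: "z \<in> convex hull (verts K \<inter> verts K')" using triangle_intersection(1)[OF assms(2,3) ne] by simp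
  obtain u v where t: "tri z u v K" using tri_atE[OF assms(2,1)] .
  show False using tri_verts_face[OF t _ _ zh] z bary_coord_at(1)[OF t] by simp
qed

text \<open>
  The coordinates of \<open>u\<close> and \<open>v\<close> at \<open>x\<close> are positive, so \<open>x\<close> does not lie in a face of \<open>K\<close> that
  omits one of them.
\<close>

lemma edge_of_incident_triangle:
  assumes x: "x \<in> open_segment u v" and uv: "u \<noteq> v" "{u, v} \<subseteq> verts K" and K: "K \<in> T" "K' \<in> T" "x \<in> K'"
  shows "{u, v} \<subseteq> verts K'"
proof (cases "K = K'")
  case False
  obtain a b c where abc: "tri a b c K" using triE[OF K(1)] .
  have xK: "x \<in> K"
  proof -
    have "closed_segment u v \<subseteq> K"
      using uv verts_subset triangle_facts(2)[OF K(1)] by (intro closed_segment_subset) auto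
    then show ?thesis using x segment_open_subset_closed by blast
  qed
  then have xh: "x \<in> convex hull (verts K \<inter> verts K')" using triangle_intersection(1)[OF K(1,2) False] K(3) by blast
  have *: "u \<in> verts K' \<and> v \<in> verts K'" if t: "tri u v w K" and x: "x \<in> open_segment u v" for u v w
    using tri_bary_coord_edge(2,3)[OF t x] tri_verts_face[OF t _ _ xh] tri_verts_face[OF tri_rot[OF t] _ _ xh]
    by (metis Int_lower1 IntD2 less_irrefl)
  have "(\<exists>w. tri u v w K) \<or> (\<exists>w. tri v u w K)" using tri_ordered[OF abc] uv by simp
  then show ?thesis using *[of u v] *[of v u] x by (auto simp: open_segment_commute)
qed (use uv in simp)

text \<open>Two triangles on the same side of a common edge would overlap.\<close>

lemma shared_opposite:
  assumes t: "tri u v w K" and K: "K \<in> T" "K' \<in> T" "K \<noteq> K'" and uv: "{u, v} \<subseteq> verts K'"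
  obtains w' where "tri v u w' K'"
proof -
  have ne: "u \<noteq> v" using tri_distinct[OF t] by simp
  have "\<not> tri u v w' K'" for w'
  proof
    assume t': "tri u v w' K'"
    obtain x where x: "x \<in> open_segment u v" using ne by (metis midpoint_in_open_segment)
    have pos: "det2 (v - u) (e *\<^sub>R perp (v - u)) > 0" if "e > 0" for e
      using ne that by (simp add: det2_perp)
    obtain e where "e > 0"
      "((det2 (v - u) (x + e *\<^sub>R perp (v - u) - x) > 0 \<longrightarrow> x + e *\<^sub>R perp (v - u) \<in> interior K)
        \<and> (det2 (v - u) (x + e *\<^sub>R perp (v - u) - x) \<ge> 0 \<longrightarrow> x + e *\<^sub>R perp (v - u) \<in> K))
       \<and> ((det2 (v - u) (x + e *\<^sub>R perp (v - u) - x) > 0 \<longrightarrow> x + e *\<^sub>R perp (v - u) \<in> interior K')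
        \<and> (det2 (v - u) (x + e *\<^sub>R perp (v - u) - x) \<ge> 0 \<longrightarrow> x + e *\<^sub>R perp (v - u) \<in> K'))"
      by (rule ray_exists[OF eventually_conj[OF tri_half_plane[OF t x] tri_half_plane[OF t' x]]])
    then have "x + e *\<^sub>R perp (v - u) \<in> interior K \<inter> interior K'" using pos by simp
    then show False using triangle_intersection(3)[OF K] interior_subset by blast
  qed
  moreover obtain a b c where "tri a b c K'" using triE[OF K(2)] .
  ultimately show ?thesis using that tri_ordered[of a b c K' u v] uv ne by auto
qed

lemma eventually_incident:
  "\<forall>\<^sub>F y in nhds x. \<forall>K\<in>T. y \<in> K \<longrightarrow> x \<in> K"
proof (rule eventually_ball_finite[OF finite_T], rule)
  fix K assume "K \<in> T"
  show "\<forall>\<^sub>F y in nhds x. y \<in> K \<longrightarrow> x \<in> K"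
  proof (cases "x \<in> K")
    case False
    then have "\<forall>\<^sub>F y in nhds x. y \<in> - K" using closed_T[OF \<open>K \<in> T\<close>]
      by (intro eventually_nhds_in_open) auto
    then show ?thesis by eventually_elim simp
  qed simp
qed

lemma shared_near:
  assumes t: "tri u v w K" and t': "tri v u w' K'" and x: "x \<in> open_segment u v"
  shows "\<forall>\<^sub>F y in nhds x. y \<in> K \<union> K'"
proof -
  have x': "x \<in> open_segment v u" using x by (simp add: open_segment_commute)
  show ?thesis using tri_half_plane[OF t x] tri_half_plane[OF t' x']
  proof eventually_elim
    case (elim y)
    have "det2 (u - v) (y - x) = - det2 (v - u) (y - x)" by (simp add: det2_def algebra_simps)
    then show ?case using elim by (cases "det2 (v - u) (y - x) \<ge> 0") auto
  qed
qed

lemma shared_subset_Omega: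
  assumes K: "K \<in> T" "K' \<in> T" "K \<noteq> K'" and uv: "u \<noteq> v" "{u, v} \<subseteq> verts K" "{u, v} \<subseteq> verts K'"
  shows "open_segment u v \<subseteq> \<Omega>"
proof
  fix x assume x: "x \<in> open_segment u v"
  obtain a b c where abc: "tri a b c K" using triE[OF K(1)] .
  have *: "x \<in> \<Omega>" if t: "tri u v w K" and uv: "{u, v} \<subseteq> verts K'" and x: "x \<in> open_segment u v" for u v w
  proof -
    obtain w' where t': "tri v u w' K'" using shared_opposite[OF t K uv] .
    have "\<forall>\<^sub>F y in nhds x. y \<in> K \<union> K'" by (rule shared_near[OF t t' x])
    then have "\<forall>\<^sub>F y in nhds x. y \<in> \<Union>T" by eventually_elim (use K in auto)
    then show ?thesis unfolding Omega_eq eventually_nhds interior_def by auto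
  qed
  have "(\<exists>w. tri u v w K) \<or> (\<exists>w. tri v u w K)" using tri_ordered[OF abc] uv by simp
  then show "x \<in> \<Omega>" using *[of u v] *[of v u] x uv by (auto simp: open_segment_commute)
qed

lemma interior_subset_Omega: "K \<in> T \<Longrightarrow> interior K \<subseteq> \<Omega>"
  unfolding Omega_eq by (intro interior_mono) auto

lemma closure_interior_T: "K \<in> T \<Longrightarrow> closure (interior K) = K"
  using convex_closure_interior[of K] triangle_facts closed_T by simp

lemma T_subset_closure: "\<Union>T \<subseteq> closure \<Omega>"
  using closure_interior_T closure_mono[OF interior_subset_Omega] by blast

lemma frontier_iff: "x \<in> \<Union>T \<Longrightarrow> x \<in> frontier \<Omega> \<longleftrightarrow> x \<notin> \<Omega>"
  using T_subset_closure open_Omega by (auto simp: frontier_def interior_open)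

lemma Omega_subset: "\<Omega> \<subseteq> \<Union>T"
  unfolding Omega_eq by (rule interior_subset)

definition shared :: "(real^2) set \<Rightarrow> (real^2) set \<Rightarrow> real^2 \<Rightarrow> real^2 \<Rightarrow> bool" where
  "shared K K' u v \<longleftrightarrow> K \<in> T \<and> K' \<in> T \<and> K \<noteq> K' \<and> u \<noteq> v \<and> {u, v} \<subseteq> verts K \<and> {u, v} \<subseteq> verts K'"

text \<open>
  The condition is combinatorial; \<open>frontier_edge_iff\<close> shows that it singles out the edges on the
  frontier of \<open>\<Omega>\<close>.
\<close>

definition bedge :: "(real^2) set \<Rightarrow> real^2 \<Rightarrow> real^2 \<Rightarrow> bool" where
  "bedge K u v \<longleftrightarrow> K \<in> T \<and> u \<noteq> v \<and> {u, v} \<subseteq> verts K \<and> (\<forall>K'\<in>T. {u, v} \<subseteq> verts K' \<longrightarrow> K' = K)"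

lemma shared_sym: "shared K K' u v \<Longrightarrow> shared K' K u v" "shared K K' u v \<Longrightarrow> shared K K' v u"
  by (auto simp: shared_def)

lemma bedge_sym: "bedge K u v \<Longrightarrow> bedge K v u"
  by (auto simp: bedge_def)

lemma edge_cases:
  assumes "K \<in> T" "u \<noteq> v" "u \<in> verts K" "v \<in> verts K"
  obtains "bedge K u v" | K' where "shared K K' u v"
proof (cases "bedge K u v")
  case False
  then have "\<exists>K'\<in>T. {u, v} \<subseteq> verts K' \<and> K' \<noteq> K" using assms by (simp add: bedge_def)
  then obtain K' where "K' \<in> T" "{u, v} \<subseteq> verts K'" "K' \<noteq> K" by (elim bexE conjE)
  then have "shared K K' u v" using assms by (simp add: shared_def)
  then show ?thesis by (rule that(2))
qed (rule that(1))

lemma edge_subset_triangle: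
  assumes "K \<in> T" "u \<in> verts K" "v \<in> verts K" "x \<in> closed_segment u v" shows "x \<in> K"
  using assms verts_subset triangle_facts(2)[OF assms(1)] by (meson closed_segment_subset subsetD)

text \<open>A triangle with points near \<open>x\<close> contains \<open>x\<close>, hence the edge, so it can only be \<open>K\<close>.\<close>

lemma bedge_outside:
  assumes b: "bedge K u v" and t: "tri u v w K" and x: "x \<in> open_segment u v"
  shows "\<forall>\<^sub>F y in nhds x. det2 (v - u) (y - x) < 0 \<longrightarrow> y \<notin> \<Union>T"
  using eventually_incident[of x]
proof eventually_elim
  case (elim y)
  show ?case
  proof (intro impI notI)
    assume d: "det2 (v - u) (y - x) < 0" and "y \<in> \<Union>T"
    then obtain K' where K': "K' \<in> T" "y \<in> K'" by blast
    then have "x \<in> K'" using elim by blast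
    then have "{u, v} \<subseteq> verts K'" using b x K' unfolding bedge_def by (meson edge_of_incident_triangle)
    then have "K' = K" using b K' by (simp add: bedge_def)
    then show False using tri_half_plane_mem[OF t x] K' d by force
  qed
qed

lemma bedge_not_Omega:
  assumes b: "bedge K u v"
  shows "closed_segment u v \<inter> \<Omega> = {}"
proof -
  have *: "open_segment u v \<inter> \<Omega> = {}" if b: "bedge K u v" and t: "tri u v w K" for u v w
  proof (rule ccontr)
    assume "open_segment u v \<inter> \<Omega> \<noteq> {}"
    then obtain x where x: "x \<in> open_segment u v" "x \<in> \<Omega>" by blast
    have ne: "u \<noteq> v" using tri_distinct[OF t] by simp
    have "\<forall>\<^sub>F y in nhds x. y \<in> \<Omega>" using open_Omega x(2) by (rule eventually_nhds_in_open)
    obtain e where e: "e > 0"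
      "(det2 (v - u) (x + e *\<^sub>R (- perp (v - u)) - x) < 0 \<longrightarrow> x + e *\<^sub>R (- perp (v - u)) \<notin> \<Union>T)
        \<and> x + e *\<^sub>R (- perp (v - u)) \<in> \<Omega>"
      by (rule ray_exists[OF eventually_conj[OF bedge_outside[OF b t x(1)] \<open>\<forall>\<^sub>F y in nhds x. y \<in> \<Omega>\<close>]])
    have "det2 (v - u) (e *\<^sub>R (- perp (v - u))) < 0"
      using det2_perp[of "v - u" "- e"] ne e(1) by simp
    then show False using e Omega_subset by auto
  qed
  have K: "K \<in> T" "u \<noteq> v" "{u, v} \<subseteq> verts K" using b by (auto simp: bedge_def)
  obtain a c d where "tri a c d K" using triE[OF K(1)] .
  then have "(\<exists>w. tri u v w K) \<or> (\<exists>w. tri v u w K)" using tri_ordered K by simp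
  then have "open_segment u v \<inter> \<Omega> = {}"
    using *[of u v] *[of v u] b bedge_sym[OF b] by (auto simp: open_segment_commute)
  then have "closure (open_segment u v) \<inter> \<Omega> = {}"
    using open_Omega open_Int_closure_eq_empty[of \<Omega> "open_segment u v"] by (simp add: Int_commute)
  then show ?thesis using K(2) by (simp add: closure_open_segment)
qed

text \<open>
  Inner points of a shared edge are covered from both sides. An edge of one triangle only has points
  outside of the triangulation arbitrarily near.
\<close>

lemma frontier_edge_iff:
  assumes K: "K \<in> T" "u \<noteq> v" "u \<in> verts K" "v \<in> verts K"
  shows "closed_segment u v \<subseteq> frontier \<Omega> \<longleftrightarrow> bedge K u v"
proof
  assume *: "closed_segment u v \<subseteq> frontier \<Omega>"
  show "bedge K u v"
  proof (rule edge_cases[OF K])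
    fix K' assume "shared K K' u v"
    then have "open_segment u v \<subseteq> \<Omega>" unfolding shared_def using shared_subset_Omega by blast
    moreover have "midpoint u v \<in> open_segment u v" using K(2) by simp
    ultimately have "midpoint u v \<in> \<Omega>" "midpoint u v \<in> frontier \<Omega>"
      using * segment_open_subset_closed by blast+
    then show ?thesis using frontier_iff Omega_subset by blast
  qed
next
  assume b: "bedge K u v"
  show "closed_segment u v \<subseteq> frontier \<Omega>"
  proof
    fix x assume x: "x \<in> closed_segment u v"
    then have "x \<in> \<Union>T" using edge_subset_triangle[OF K(1,3,4)] K(1) by blast
    then show "x \<in> frontier \<Omega>" using frontier_iff bedge_not_Omega[OF b] x by blast
  qed
qed

lemma triangles_at_edge:
  assumes K: "K \<in> T" "u \<noteq> v" "u \<in> verts K" "v \<in> verts K"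
  shows "triangles_at T (closed_segment u v) = {K'\<in>T. {u, v} \<subseteq> verts K'}"
proof (intro set_eqI iffI)
  fix K' assume "K' \<in> triangles_at T (closed_segment u v)"
  then have K': "K' \<in> T" "closed_segment u v \<subseteq> K'" by (auto simp: triangles_at_def)
  have mid: "midpoint u v \<in> open_segment u v" using K(2) by simp
  then have "midpoint u v \<in> K'" using K'(2) segment_open_subset_closed by blast
  then have "{u, v} \<subseteq> verts K'" using edge_of_incident_triangle[OF mid K(2) _ K(1) K'(1)] K by simp
  then show "K' \<in> {K'\<in>T. {u, v} \<subseteq> verts K'}" using K'(1) by simp
next
  fix K' assume "K' \<in> {K'\<in>T. {u, v} \<subseteq> verts K'}"
  then show "K' \<in> triangles_at T (closed_segment u v)"
    using edge_subset_triangle by (auto simp: triangles_at_def)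
qed

lemma edgesE:
  assumes "E \<in> edges T"
  obtains K u v where "K \<in> T" "u \<noteq> v" "u \<in> verts K" "v \<in> verts K" "E = closed_segment u v"
proof -
  obtain K where K: "K \<in> T" "E edge_of K" using assms by (auto simp: edges_def)
  obtain a b c where t: "tri a b c K" using triE[OF K(1)] .
  obtain u v where "u \<noteq> v" "E = closed_segment u v" "verts K \<inter> E = {u, v}"
    using tri_edge_verts[OF t K(2)] .
  then show ?thesis using that[OF K(1), of u v] by blast
qed

lemma edgesI:
  assumes K: "K \<in> T" "u \<noteq> v" "u \<in> verts K" "v \<in> verts K"
  shows "closed_segment u v \<in> edges T"
proof -
  obtain a b c where t: "tri a b c K" using triE[OF K(1)] .
  have "closed_segment u v \<in> {closed_segment a b, closed_segment b c, closed_segment c a}"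
    using K tri_distinct[OF t] unfolding tri_verts[OF t] by (auto simp: closed_segment_commute)
  then have "closed_segment u v edge_of K" using tri_edge_iff[OF t] by blast
  then show ?thesis using K(1) by (auto simp: edges_def)
qed

lemma interior_edge_iff:
  assumes K: "K \<in> T" "u \<noteq> v" "u \<in> verts K" "v \<in> verts K"
  shows "closed_segment u v \<in> interior_edges \<Omega> T \<longleftrightarrow> \<not> bedge K u v"
    and "closed_segment u v \<in> boundary_edges \<Omega> T \<longleftrightarrow> bedge K u v"
  using edgesI[OF K] frontier_edge_iff[OF K] by (auto simp: interior_edges_def boundary_edges_def)

end

section \<open>The triangles around a vertex\<close>

text \<open>
  A neighbourhood of a vertex meets only the interior and the two edges at this vertex: if the
  coordinate of \<open>z\<close> is positive, only the other two can vanish, and not both.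
\<close>

lemma tri_near_vertex:
  assumes t: "tri z b c K" and y: "y \<in> K" "y \<noteq> z" "bary_coord z b c y > 0"
  shows "y \<in> interior K \<or> y \<in> open_segment z b \<or> y \<in> open_segment z c"
proof -
  have nn: "bary_coord b c z y \<ge> 0" "bary_coord c z b y \<ge> 0" using y(1) tri_mem_iff[OF t] by simp_all
  have s: "bary_coord z b c y + bary_coord b c z y + bary_coord c z b y = 1" using bary_coord_sum[OF tri_nz(1)[OF t]] .
  have r: "bary_coord z b c y *\<^sub>R z + bary_coord b c z y *\<^sub>R b + bary_coord c z b y *\<^sub>R c = y" using bary_coord_recover[OF tri_nz(1)[OF t]] .
  consider "bary_coord b c z y > 0" "bary_coord c z b y > 0" | "bary_coord b c z y = 0" | "bary_coord c z b y = 0"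
    using nn by linarith
  then show ?thesis
  proof cases
    case 1
    then show ?thesis using tri_interiorI[OF t y(3)] by blast
  next
    case 2
    have l: "bary_coord z b c y = 1 - bary_coord c z b y" using s 2 by simp
    have eq: "y = (1 - bary_coord c z b y) *\<^sub>R z + bary_coord c z b y *\<^sub>R c"
      using r unfolding l 2 by simp
    have "bary_coord c z b y \<noteq> 0" using eq y(2) by auto
    then have "0 < bary_coord c z b y" "bary_coord c z b y < 1" using nn y(3) l by linarith+
    then have "y \<in> open_segment z c"
      using eq tri_distinct[OF t] unfolding in_segment by blast
    then show ?thesis by blast
  next
    case 3
    have l: "bary_coord z b c y = 1 - bary_coord b c z y" using s 3 by simp
    have eq: "y = (1 - bary_coord b c z y) *\<^sub>R z + bary_coord b c z y *\<^sub>R b"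
      using r unfolding l 3 by simp
    have "bary_coord b c z y \<noteq> 0" using eq y(2) by auto
    then have "0 < bary_coord b c z y" "bary_coord b c z y < 1" using nn y(3) l by linarith+
    then have "y \<in> open_segment z b"
      using eq tri_distinct[OF t] unfolding in_segment by blast
    then show ?thesis by blast
  qed
qed

context triangulation
begin

text \<open>
  Consider a family of triangles at \<open>z\<close> that contains with each triangle its neighbours across both
  edges at \<open>z\<close>. In a small punctured disc around \<open>z\<close> its union is relatively closed, and relatively
  open because a shared edge is covered from both sides. The punctured disc is connected, so the
  family covers it, and no room is left for other triangles.
\<close>

lemma full_fan:
  assumes S: "S \<subseteq> {K\<in>T. z \<in> verts K}" "S \<noteq> {}"
    and step: "\<And>K u. K \<in> S \<Longrightarrow> u \<in> verts K \<Longrightarrow> u \<noteq> z \<Longrightarrow> \<exists>K'\<in>S. shared K K' z u"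
  shows "z \<in> \<Omega>" "S = {K\<in>T. z \<in> verts K}"
proof -
  have pos: "\<forall>\<^sub>F y in nhds z. \<forall>K\<in>S. 0 < bary K z y"
  proof (rule eventually_ball_finite, safe)
    show "finite S" using S(1) finite_subset[OF _ finite_T] by blast
    fix K assume "K \<in> S"
    then have "K \<in> T" "z \<in> verts K" using S by auto
    then obtain u v where t: "tri z u v K" by (rule tri_atE)
    show "\<forall>\<^sub>F y in nhds z. 0 < bary K z y"
      unfolding bary_eq[OF t] using bary_coord_at(1)[OF t] by (intro bary_coord_eventually_pos[OF t]) simp
  qed
  then obtain U where U: "open U" "z \<in> U" "\<And>y K. y \<in> U \<Longrightarrow> K \<in> S \<Longrightarrow> 0 < bary K z y"
    unfolding eventually_nhds by blast
  then obtain r where r: "r > 0" "ball z r \<subseteq> U" using open_contains_ball by blast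
  define P where "P = ball z r - {z}"
  define X where "X = P \<inter> \<Union>S"
  have ST: "K \<in> T" "z \<in> verts K" if "K \<in> S" for K using S that by auto
  have "connected P" unfolding P_def
    by (rule connected_punctured_ball) simp
  moreover have "closedin (top_of_set P) X"
    unfolding X_def using ST closed_T finite_subset[OF _ finite_T, of S]
    by (intro closedin_closed_Int closed_Union) auto
  moreover have "openin (top_of_set P) X"
  proof (subst openin_subopen, intro ballI)
    fix y assume "y \<in> X"
    then obtain K where y: "y \<in> P" "K \<in> S" "y \<in> K" by (auto simp: X_def)
    obtain b c where t: "tri z b c K" using ST[OF y(2)] by (rule tri_atE)
    have "\<forall>\<^sub>F x in nhds y. x \<in> \<Union>S"
    proof -
      have "0 < bary_coord z b c y" using U(3)[OF _ y(2), of y] y(1) r(2) unfolding bary_eq[OF t] P_def by blast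
      then consider "y \<in> interior K" | u where "u \<in> {b, c}" "y \<in> open_segment z u"
        using tri_near_vertex[OF t y(3)] y(1) unfolding P_def by blast
      then show ?thesis
      proof cases
        case 1
        then have "\<forall>\<^sub>F x in nhds y. x \<in> interior K" by (intro eventually_nhds_in_open) auto
        then show ?thesis by eventually_elim (use y(2) interior_subset in blast)
      next
        case (2 u)
        then have "u \<in> verts K" "u \<noteq> z" using tri_verts[OF t] tri_distinct[OF t] by auto
        then obtain K' where K': "K' \<in> S" "shared K K' z u" using step y(2) by blast
        have near: "\<forall>\<^sub>F x in nhds y. x \<in> K \<union> K'" if t: "tri p q w K" and pq: "{p, q} = {z, u}" for p q w
        proof -
          have sub: "{p, q} \<subseteq> verts K'" using K'(2) pq by (simp add: shared_def)
          obtain w' where t': "tri q p w' K'"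
            using shared_opposite[OF t _ _ _ sub] K'(2) by (auto simp: shared_def)
          have "y \<in> open_segment p q" using 2(2) pq by (auto simp: doubleton_eq_iff open_segment_commute)
          then show ?thesis by (rule shared_near[OF t t'])
        qed
        have "(\<exists>w. tri z u w K) \<or> (\<exists>w. tri u z w K)"
          using tri_ordered[OF t] K'(2) by (auto simp: shared_def)
        then have "\<forall>\<^sub>F x in nhds y. x \<in> K \<union> K'" using near[of z u] near[of u z] by (auto simp: insert_commute)
        then show ?thesis by eventually_elim (use y(2) K'(1) in auto)
      qed
    qed
    then obtain V where V: "open V" "y \<in> V" "V \<subseteq> \<Union>S" unfolding eventually_nhds by blast
    have "openin (top_of_set P) (P \<inter> V)" using V(1) by (rule openin_open_Int)
    then show "\<exists>V. openin (top_of_set P) V \<and> y \<in> V \<and> V \<subseteq> X"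
      using V y(1) by (intro exI[of _ "P \<inter> V"]) (auto simp: X_def)
  qed
  ultimately have "X = {} \<or> X = P" unfolding connected_clopen by blast
  moreover have "X \<noteq> {}"
  proof -
    obtain K where K: "K \<in> S" using S(2) by blast
    obtain b c where t: "tri z b c K" using ST[OF K] by (rule tri_atE)
    have "\<forall>\<^sub>F y in nhds z. y \<in> ball z r" using r(1) by (intro eventually_nhds_in_open) auto
    then have "\<forall>\<^sub>F y in nhds z. y \<in> ball z r" .
    have "z \<in> closure (interior K)" using ST[OF K] verts_subset closure_interior_T by blast
    then obtain y where "y \<in> interior K" "dist y z < r" using r(1) closure_approachable by blast
    moreover have "z \<notin> interior K"
      using ST[OF K] extreme_point_not_in_interior unfolding verts_def by blast
    ultimately have "y \<in> X" using K interior_subset by (auto simp: X_def P_def dist_commute)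
    then show ?thesis by blast
  qed
  ultimately have "P \<subseteq> \<Union>S" unfolding X_def by blast
  moreover have "z \<in> \<Union>S" using S ST verts_subset by blast
  ultimately have ball: "ball z r \<subseteq> \<Union>S" unfolding P_def by blast
  then have "ball z r \<subseteq> \<Union>T" using ST by blast
  then show "z \<in> \<Omega>" unfolding Omega_eq using r(1) by (meson centre_in_ball interior_maximal open_ball subsetD)
  have "K \<in> S" if K: "K \<in> T" "z \<in> verts K" for K
  proof -
    have "z \<in> closure (interior K)" using K verts_subset closure_interior_T by blast
    then obtain y where y: "y \<in> interior K" "dist y z < r" using r(1) closure_approachable by blast
    then have "y \<in> \<Union>S" using subsetD[OF ball, of y] by (simp add: dist_commute)
    then obtain K' where "K' \<in> S" "y \<in> K'" by blast
    then have "K = K'" using triangle_intersection(3)[OF K(1) ST(1)] y(1) by blast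
    then show ?thesis using \<open>K' \<in> S\<close> by simp
  qed
  then show "S = {K\<in>T. z \<in> verts K}" using S(1) by blast
qed

end

section \<open>Piecewise polynomials\<close>

text \<open>The set where the functions differ is open, and nonempty open sets are not null sets.\<close>

lemma ae_eq_on_open:
  fixes f g :: "real^2 \<Rightarrow> real"
  assumes U: "open U" and c: "continuous_on U f" "continuous_on U g"
    and ae: "AE x in lebesgue. x \<in> U \<longrightarrow> f x = g x" and x: "x \<in> U"
  shows "f x = g x"
proof (rule ccontr)
  assume ne: "f x \<noteq> g x"
  define D where "D = U \<inter> (\<lambda>x. f x - g x) -` (- {0})"
  have "open D" unfolding D_def
    by (intro continuous_open_preimage continuous_intros c U open_Compl closed_singleton)
  moreover have "x \<in> D" using ne x by (simp add: D_def)
  ultimately have "\<not> negligible D" using open_not_negligible by blast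
  moreover have "negligible D"
  proof -
    have "AE x in lebesgue. x \<notin> D" using ae by eventually_elim (auto simp: D_def)
    then show ?thesis
      using \<open>open D\<close> AE_iff_null_sets[of D lebesgue] by (simp add: negligible_iff_null_sets)
  qed
  ultimately show False by blast
qed

lemma ae_class_surj: "\<exists>f. v = ae_class f"
  by (induction v rule: ae_fun.abs_induct) blast

context triangulation
begin

text \<open>
  The interiors are disjoint, so at most one summand is nonzero. The value zero on the edges makes
  the function vanish off \<open>\<Omega>\<close> and does not affect its class.
\<close>

definition pw :: "((real^2) set \<Rightarrow> real^2 \<Rightarrow> real) \<Rightarrow> real^2 \<Rightarrow> real" where
  "pw Q x = (\<Sum>K\<in>T. indicator (interior K) x * Q K x)"

definition PW :: "((real^2) set \<Rightarrow> real^2 \<Rightarrow> real) \<Rightarrow> ae_fun" where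
  "PW Q = ae_class (pw Q)"

lemma pw_interior:
  assumes K: "K \<in> T" "x \<in> interior K" shows "pw Q x = Q K x"
proof -
  have "pw Q x = (\<Sum>K\<in>{K}. indicator (interior K) x * Q K x)"
    unfolding pw_def
  proof (rule sum.mono_neutral_right)
    show "\<forall>K'\<in>T - {K}. indicator (interior K') x * Q K' x = 0"
      using triangle_intersection(3)[OF K(1)] K(2) interior_subset by (fastforce simp: indicator_def)
  qed (use K in auto)
  then show ?thesis using K by simp
qed

lemma pw_outside: "(\<And>K. K \<in> T \<Longrightarrow> x \<notin> interior K) \<Longrightarrow> pw Q x = 0"
  unfolding pw_def by (intro sum.neutral) (auto simp: indicator_def)

lemma ae_interior: "AE x in lebesgue. x \<in> \<Union>T \<longrightarrow> (\<exists>K\<in>T. x \<in> interior K)"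
proof -
  have "AE x in lebesgue. x \<notin> frontier K" if "K \<in> T" for K
    using negligible_convex_frontier[OF triangle_facts(2)[OF that]]
    by (intro AE_not_in) (simp add: negligible_iff_null_sets)
  then have "AE x in lebesgue. \<forall>K\<in>T. x \<notin> frontier K" by (simp add: AE_finite_all)
  then show ?thesis
    by eventually_elim (use closed_T in \<open>auto simp: frontier_def\<close>)
qed

lemma ae_class_eq_iff: "ae_class f = ae_class g \<longleftrightarrow> (AE x in lebesgue. f x = g x)"
  by (rule ae_fun.abs_eq_iff)

lemma ae_class_eq_PW:
  assumes "\<And>K x. K \<in> T \<Longrightarrow> x \<in> interior K \<Longrightarrow> f x = Q K x" "\<And>x. x \<notin> \<Union>T \<Longrightarrow> f x = 0"
  shows "ae_class f = PW Q"
  unfolding PW_def ae_class_eq_iff using ae_interior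
proof eventually_elim
  case (elim x)
  show ?case
  proof (cases "x \<in> \<Union>T")
    case True
    then obtain K where "K \<in> T" "x \<in> interior K" using elim by blast
    then show ?thesis using assms(1) pw_interior by simp
  next
    case False
    then have "pw Q x = 0" using interior_subset by (intro pw_outside) blast
    then show ?thesis using assms(2)[OF False] by simp
  qed
qed

lemma PW_add: "PW (\<lambda>K x. Q K x + R K x) = PW Q + PW R"
proof -
  have "pw (\<lambda>K x. Q K x + R K x) = (\<lambda>x. pw Q x + pw R x)"
    unfolding pw_def by (auto simp: algebra_simps sum.distrib)
  then show ?thesis unfolding PW_def by (simp add: plus_ae_fun.abs_eq)
qed

lemma PW_scale: "PW (\<lambda>K x. r * Q K x) = r *\<^sub>R PW Q"
proof -
  have "pw (\<lambda>K x. r * Q K x) = (\<lambda>x. r * pw Q x)"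
    unfolding pw_def sum_distrib_left by (simp only: mult.left_commute)
  then show ?thesis unfolding PW_def by (simp add: scaleR_ae_fun.abs_eq)
qed

lemma PW_zero: "PW (\<lambda>K x. 0) = 0"
  using PW_scale[of 0 "\<lambda>K x. 0"] by simp

lemma PW_sum: "PW (\<lambda>K x. \<Sum>i\<in>I. \<alpha> i * Q i K x) = (\<Sum>i\<in>I. \<alpha> i *\<^sub>R PW (Q i))"
  by (induction I rule: infinite_finite_induct) (simp_all add: PW_zero PW_add PW_scale)

lemma PW_cong: "(\<And>K. K \<in> T \<Longrightarrow> Q K = R K) \<Longrightarrow> PW Q = PW R"
proof -
  assume "\<And>K. K \<in> T \<Longrightarrow> Q K = R K"
  then have "pw Q = pw R" unfolding pw_def by (intro ext sum.cong) auto
  then show ?thesis by (simp add: PW_def)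
qed

lemma ae_eq_on_PW: "K \<in> T \<Longrightarrow> ae_eq_on K (PW Q) (Q K)"
  unfolding PW_def ae_eq_on.abs_eq
proof -
  assume K: "K \<in> T"
  have "AE x in lebesgue. x \<notin> frontier K"
    using negligible_convex_frontier[OF triangle_facts(2)[OF K]]
    by (intro AE_not_in) (simp add: negligible_iff_null_sets)
  then show "AE x in lebesgue. x \<in> K \<longrightarrow> pw Q x = Q K x"
    by eventually_elim (use K closed_T pw_interior in \<open>auto simp: frontier_def\<close>)
qed

lemma ae_eq_on_unique:
  assumes K: "K \<in> T" and q: "ae_eq_on K v q" "ae_eq_on K v q'" and p: "poly2_le n q" "poly2_le m q'"
  shows "q = q'"
proof -
  obtain f where v: "v = ae_class f" using ae_class_surj by blast
  have "AE x in lebesgue. x \<in> interior K \<longrightarrow> q x = q' x"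
    using q unfolding v ae_eq_on.abs_eq
    by eventually_elim (use interior_subset in auto)
  then have "q x = q' x" if "x \<in> interior K" for x
    using ae_eq_on_open[OF open_interior] p poly2_le_continuous that by blast
  then show ?thesis using poly2_le_eq_on_open[OF p open_interior triangle_facts(3)[OF K]] by blast
qed

lemma piece_eq: 
  assumes "K \<in> T" "ae_eq_on K v q" "poly2_le k q" shows "piece v K = q"
  unfolding piece_def
proof (rule the_equality)
  show "(\<exists>n. poly2_le n q) \<and> ae_eq_on K v q" using assms by blast
  show "q' = q" if "(\<exists>n. poly2_le n q') \<and> ae_eq_on K v q'" for q'
    using that ae_eq_on_unique[OF assms(1) _ assms(2) _ assms(3)] by blast
qed

lemma piece_PW:
  assumes "K \<in> T" "poly2_le k (Q K)" shows "piece (PW Q) K = Q K"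
  by (rule piece_eq[where k = k]) (use assms ae_eq_on_PW in auto)

lemma PW_eq_0:
  assumes "PW Q = 0" "K \<in> T" "poly2_le k (Q K)" shows "Q K x = 0"
proof -
  have "Q K = (\<lambda>x. 0)"
    using piece_PW[of K k Q] piece_PW[of K k "\<lambda>K x. 0"] assms PW_zero
    by (simp add: poly2_le_const)
  then show ?thesis by simp
qed

lemma PW_in_L2:
  assumes Q: "\<And>K. K \<in> T \<Longrightarrow> poly2_le k (Q K)"
  shows "PW Q \<in> L2 \<Omega>"
proof -
  have int: "integrable lborel (\<lambda>x. indicator (interior K) x * q x)" and
    meas: "(\<lambda>x. indicator (interior K) x * q x) \<in> borel_measurable borel"
    if "K \<in> T" "continuous_on UNIV q" for K and q :: "real^2 \<Rightarrow> real"
  proof -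
    have K: "integrable lborel (\<lambda>x. indicator K x *\<^sub>R q x)"
      using triangle_facts(1)[OF that(1)] continuous_on_subset[OF that(2)] by (intro borel_integrable_compact) auto
    have "integrable lborel (\<lambda>x. indicator (interior K) x *\<^sub>R (indicator K x *\<^sub>R q x))"
      by (rule integrable_mult_indicator[OF _ K]) simp
    moreover have "(\<lambda>x. indicator (interior K) x *\<^sub>R (indicator K x *\<^sub>R q x)) = (\<lambda>x. indicator (interior K) x * q x)"
      by (intro ext) (auto simp: indicator_def dest: subsetD[OF interior_subset])
    ultimately show "integrable lborel (\<lambda>x. indicator (interior K) x * q x)" by simp
    show "(\<lambda>x. indicator (interior K) x * q x) \<in> borel_measurable borel"
      using borel_measurable_continuous_onI[OF that(2)] by (intro borel_measurable_times borel_measurable_indicator) auto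
  qed
  have cont: "continuous_on UNIV (Q K)" if "K \<in> T" for K using poly2_le_continuous[OF Q[OF that]] .
  have m: "pw Q \<in> borel_measurable borel"
    unfolding pw_def[abs_def] by (intro borel_measurable_sum meas cont)
  then have m': "pw Q \<in> borel_measurable lebesgue"
    by (intro measurable_completion) simp
  have sq: "(\<lambda>x. (pw Q x)\<^sup>2) = (\<lambda>x. \<Sum>K\<in>T. indicator (interior K) x * (Q K x)\<^sup>2)"
  proof
    fix x
    have "(\<Sum>K\<in>T. indicator (interior K) x * (Q K x)\<^sup>2) = pw (\<lambda>K x. (Q K x)\<^sup>2) x" by (simp add: pw_def)
    also have "\<dots> = (pw Q x)\<^sup>2"
      by (cases "\<exists>K\<in>T. x \<in> interior K") (auto simp: pw_interior pw_outside)
    finally show "(pw Q x)\<^sup>2 = (\<Sum>K\<in>T. indicator (interior K) x * (Q K x)\<^sup>2)" by simp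
  qed
  have "integrable lborel (\<lambda>x. (pw Q x)\<^sup>2)"
    unfolding sq by (intro Bochner_Integration.integrable_sum int continuous_intros cont)
  then have i: "integrable lebesgue (\<lambda>x. (pw Q x)\<^sup>2)"
    using m by (subst integrable_completion) auto
  have "pw Q x = 0" if "x \<notin> \<Omega>" for x
    using that interior_subset_Omega by (intro pw_outside) blast
  then show ?thesis unfolding L2_def PW_def using m' i by blast
qed

lemma piecewise_poly_iff:
  "v \<in> piecewise_poly \<Omega> T k \<longleftrightarrow> (\<exists>Q. (\<forall>K\<in>T. poly2_le k (Q K)) \<and> v = PW Q)"
proof
  assume v: "v \<in> piecewise_poly \<Omega> T k"
  then have "\<forall>K\<in>T. \<exists>q. poly2_le k q \<and> ae_eq_on K v q" by (simp add: piecewise_poly_def)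
  from bchoice[OF this] obtain Q where Q: "\<forall>K\<in>T. poly2_le k (Q K) \<and> ae_eq_on K v (Q K)" by blast
  obtain f where f: "v = ae_class f" "\<forall>x. x \<notin> \<Omega> \<longrightarrow> f x = 0"
    using v by (auto simp: piecewise_poly_def L2_def)
  have "\<forall>K\<in>T. AE x in lebesgue. x \<in> K \<longrightarrow> f x = Q K x"
    using Q unfolding f(1) ae_eq_on.abs_eq by blast
  then have "AE x in lebesgue. \<forall>K\<in>T. x \<in> K \<longrightarrow> f x = Q K x" by (simp add: AE_finite_all)
  then have "AE x in lebesgue. f x = pw Q x" using ae_interior
  proof eventually_elim
    case (elim x)
    show ?case
    proof (cases "x \<in> \<Union>T")
      case True
      then obtain K where "K \<in> T" "x \<in> interior K" using elim by blast
      then show ?thesis using elim(1) interior_subset by (simp add: pw_interior) blast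
    next
      case False
      then have "pw Q x = 0" using interior_subset by (intro pw_outside) blast
      then show ?thesis using f(2) False Omega_subset by auto
    qed
  qed
  then have "v = PW Q" unfolding f(1) PW_def ae_class_eq_iff .
  then show "\<exists>Q. (\<forall>K\<in>T. poly2_le k (Q K)) \<and> v = PW Q" using Q by blast
next
  assume "\<exists>Q. (\<forall>K\<in>T. poly2_le k (Q K)) \<and> v = PW Q"
  then obtain Q where Q: "\<forall>K\<in>T. poly2_le k (Q K)" "v = PW Q" by (elim exE conjE)
  then have "v \<in> L2 \<Omega>" using PW_in_L2[of k Q] by simp
  moreover have "\<forall>K\<in>T. \<exists>q. poly2_le k q \<and> ae_eq_on K v q"
    using Q ae_eq_on_PW by blast
  ultimately show "v \<in> piecewise_poly \<Omega> T k" by (simp add: piecewise_poly_def)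
qed

end

section \<open>The Crouzeix-Raviart conditions in terms of the polynomial pieces\<close>

text \<open>The two parametrizations of the segment give the same integral.\<close>

lemma edge_integral_eq:
  fixes f :: "real^2 \<Rightarrow> real"
  assumes "continuous_on UNIV f"
  shows "edge_integral (closed_segment u v) f = dist u v * integral {0..1} (\<lambda>t. f (linepath u v t))"
  unfolding edge_integral_def
proof (rule the_equality)
  show "\<exists>a b. closed_segment u v = closed_segment a b
      \<and> dist u v * integral {0..1} (\<lambda>t. f (linepath u v t)) = dist a b * integral {0..1} (\<lambda>t. f (linepath a b t))"
    by blast
  fix I assume "\<exists>a b. closed_segment u v = closed_segment a b
      \<and> I = dist a b * integral {0..1} (\<lambda>t. f (linepath a b t))"
  then obtain a b where ab: "closed_segment u v = closed_segment a b"
      "I = dist a b * integral {0..1} (\<lambda>t. f (linepath a b t))" by (elim exE conjE)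
  have refl: "integral {0..1} (\<lambda>t. f (linepath v u t)) = integral {0..1} (\<lambda>t. f (linepath u v t))"
  proof -
    have "continuous_on {0..1} (\<lambda>t. f (linepath u v t))"
      by (rule continuous_on_compose2[OF assms]) (auto intro!: continuous_intros)
    then have "((\<lambda>t. f (linepath u v t)) has_integral integral {0..1} (\<lambda>t. f (linepath u v t))) (cbox 0 1)"
      by (simp add: integrable_integral integrable_continuous_real)
    from has_integral_affinity[OF this, of "-1" 1]
    have "((\<lambda>t. f (linepath u v (1 - t))) has_integral integral {0..1} (\<lambda>t. f (linepath u v t))) ((\<lambda>t. 1 - t) ` {0..1})"
      by simp
    moreover have "(\<lambda>t. 1 - t) ` {0..1} = {0..1::real}" by simp
    moreover have "linepath u v (1 - t) = linepath v u t" for t by (simp add: linepath_def)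
    ultimately show ?thesis by (intro integral_unique) simp
  qed
  have "u = a \<and> v = b \<or> u = b \<and> v = a" using ab(1) by (auto simp: doubleton_eq_iff)
  then show "I = dist u v * integral {0..1} (\<lambda>t. f (linepath u v t))"
    using refl by (auto simp: ab(2) dist_commute)
qed

text \<open>
  The trace of \<open>r\<close> is a polynomial in the parameter of the edge, and every polynomial in this
  parameter is the trace of a bivariate one of the same degree, obtained by composition with the
  orthogonal projection to the line through \<open>u\<close> and \<open>v\<close>.
\<close>

lemma edge_orthogonal_iff:
  assumes ne: "u \<noteq> v" and r: "poly2_le p r" and p: "p \<ge> 1"
  shows "(\<forall>q. poly2_le (p - 1) q \<longrightarrow> edge_integral (closed_segment u v) (\<lambda>x. r x * q x) = 0)
     \<longleftrightarrow> (\<exists>c. \<forall>t. r (linepath u v t) = c * edge_legendre p t)"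
proof -
  have ei: "edge_integral (closed_segment u v) (\<lambda>x. r x * q x) = 0 \<longleftrightarrow>
     integral {0..1} (\<lambda>t. r (linepath u v t) * q (linepath u v t)) = 0" if q: "poly2_le k q" for k q
  proof -
    have "continuous_on UNIV (\<lambda>x. r x * q x)"
      using poly2_le_continuous[OF r] poly2_le_continuous[OF q] by (intro continuous_intros)
    then show ?thesis using ne by (simp add: edge_integral_eq)
  qed
  show ?thesis
  proof
    assume orth: "\<forall>q. poly2_le (p - 1) q \<longrightarrow> edge_integral (closed_segment u v) (\<lambda>x. r x * q x) = 0"
    obtain R where R: "degree R \<le> p" "\<And>t. r (linepath u v t) = poly R t"
      using poly2_le_on_linepath[OF r, of u v] by blast
    have "integral {0..1} (\<lambda>t. poly R t * poly s t) = 0" if s: "degree s \<le> p - 1" for s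
    proof -
      \<comment> \<open>The parameter of the orthogonal projection to the line through \<open>u\<close> and \<open>v\<close>.\<close>
      define l where "l = (\<lambda>x. ((x - u) \<bullet> (v - u)) / ((v - u) \<bullet> (v - u)))"
      have "poly2_le 1 l"
      proof -
        have eq: "l = (\<lambda>x. ((v - u)$1 / ((v - u) \<bullet> (v - u))) * x$1 + ((v - u)$2 / ((v - u) \<bullet> (v - u))) * x$2
           + (- (u \<bullet> (v - u)) / ((v - u) \<bullet> (v - u))))"
          unfolding l_def by (intro ext) (simp add: inner_vec_def sum_2 diff_divide_distrib add_divide_distrib algebra_simps)
        show ?thesis unfolding eq by (rule poly2_le_affine) simp
      qed
      then have q: "poly2_le (p - 1) (\<lambda>x. poly s (l x))" using s by (rule poly2_le_poly)
      have "linepath u v t - u = t *\<^sub>R (v - u)" for t by (simp add: linepath_def algebra_simps)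
      then have "l (linepath u v t) = t" for t using ne by (simp add: l_def)
      then show ?thesis using orth q ei[OF q] R(2) by simp
    qed
    from orthogonal_imp_edge_legendre[OF R(1) p this]
    have "\<exists>c. \<forall>t. poly R t = c * edge_legendre p t" by blast
    then show "\<exists>c. \<forall>t. r (linepath u v t) = c * edge_legendre p t" by (simp add: R(2))
  next
    assume "\<exists>c. \<forall>t. r (linepath u v t) = c * edge_legendre p t"
    then obtain c where c: "\<forall>t. r (linepath u v t) = c * edge_legendre p t" by (elim exE)
    show "\<forall>q. poly2_le (p - 1) q \<longrightarrow> edge_integral (closed_segment u v) (\<lambda>x. r x * q x) = 0"
    proof (intro allI impI)
      fix q assume q: "poly2_le (p - 1) q"
      obtain s where s: "degree s \<le> p - 1" "\<And>t. q (linepath u v t) = poly s t"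
        using poly2_le_on_linepath[OF q, of u v] by blast
      have "integral {0..1} (\<lambda>t. c * (edge_legendre p t * poly s t)) = 0"
        using edge_legendre_orthogonal[of s p] s(1) p by simp
      then show "edge_integral (closed_segment u v) (\<lambda>x. r x * q x) = 0"
        unfolding ei[OF q] using c s(2) by (simp add: mult.assoc)
    qed
  qed
qed

context triangulation
begin

text \<open>
  The moment conditions in solved form. No sign has to be attached to the jump since \<open>c\<close> is
  arbitrary.
\<close>

definition cr_pieces :: "nat \<Rightarrow> ((real^2) set \<Rightarrow> real^2 \<Rightarrow> real) \<Rightarrow> bool" where
  "cr_pieces p Q \<longleftrightarrow> (\<forall>K\<in>T. poly2_le p (Q K))
    \<and> (\<forall>K K' u v. shared K K' u v \<longrightarrow>
         (\<exists>c. \<forall>t. Q K (linepath u v t) - Q K' (linepath u v t) = c * edge_legendre p t))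
    \<and> (\<forall>K u v. bedge K u v \<longrightarrow> (\<exists>c. \<forall>t. Q K (linepath u v t) = c * edge_legendre p t))"

lemma cr_piecesD:
  assumes "cr_pieces p Q"
  shows "K \<in> T \<Longrightarrow> poly2_le p (Q K)"
    "shared K K' u v \<Longrightarrow> \<exists>c. \<forall>t. Q K (linepath u v t) - Q K' (linepath u v t) = c * edge_legendre p t"
    "bedge K u v \<Longrightarrow> \<exists>c. \<forall>t. Q K (linepath u v t) = c * edge_legendre p t"
  using assms unfolding cr_pieces_def by simp_all

lemma crouzeix_raviart0_iff:
  assumes p: "p \<ge> 1"
  shows "v \<in> crouzeix_raviart0 \<Omega> T p \<longleftrightarrow> (\<exists>Q. cr_pieces p Q \<and> v = PW Q)"
proof -
  have "PW Q \<in> crouzeix_raviart0 \<Omega> T p \<longleftrightarrow> cr_pieces p Q" if Q: "\<forall>K\<in>T. poly2_le p (Q K)" for Q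
  proof -
    have pc: "piece (PW Q) K = Q K" if "K \<in> T" for K using piece_PW that Q by blast
    have orth1: "(\<forall>q. poly2_le (p - 1) q \<longrightarrow> edge_integral (closed_segment a b) (\<lambda>x. jump (PW Q) K K' x * q x) = 0)
       \<longleftrightarrow> (\<exists>c. \<forall>t. Q K (linepath a b t) - Q K' (linepath a b t) = c * edge_legendre p t)"
      if "K \<in> T" "K' \<in> T" "a \<noteq> b" for K K' a b
      using edge_orthogonal_iff[OF that(3) poly2_le_diff[of p "Q K" "Q K'"] p] that Q pc
      by (simp add: jump_def)
    have orth2: "(\<forall>q. poly2_le (p - 1) q \<longrightarrow> edge_integral (closed_segment a b) (\<lambda>x. piece (PW Q) K x * q x) = 0)
       \<longleftrightarrow> (\<exists>c. \<forall>t. Q K (linepath a b t) = c * edge_legendre p t)"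
      if "K \<in> T" "a \<noteq> b" for K a b
      using edge_orthogonal_iff[OF that(2) _ p, of "Q K"] that Q pc by simp
    have PQ: "PW Q \<in> piecewise_poly \<Omega> T p" using Q piecewise_poly_iff by blast
    show ?thesis
    proof
      assume cr: "PW Q \<in> crouzeix_raviart0 \<Omega> T p"
      show "cr_pieces p Q" unfolding cr_pieces_def
      proof (intro conjI allI impI Q)
        fix K K' a b assume sh: "shared K K' a b"
        then have K: "K \<in> T" "K' \<in> T" "a \<noteq> b" "a \<in> verts K" "b \<in> verts K" "K \<noteq> K'"
            "K \<in> triangles_at T (closed_segment a b)" "K' \<in> triangles_at T (closed_segment a b)"
          using triangles_at_edge[of K a b] by (auto simp: shared_def)
        have "\<not> bedge K a b" using sh unfolding bedge_def shared_def by auto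
        then have "closed_segment a b \<in> interior_edges \<Omega> T" using interior_edge_iff(1) K by simp
        then show "\<exists>c. \<forall>t. Q K (linepath a b t) - Q K' (linepath a b t) = c * edge_legendre p t"
          using cr K orth1[OF K(1-3)] unfolding crouzeix_raviart0_def by simp
      next
        fix K a b assume b: "bedge K a b"
        then have K: "K \<in> T" "a \<noteq> b" "a \<in> verts K" "b \<in> verts K" "K \<in> triangles_at T (closed_segment a b)"
          using triangles_at_edge[of K a b] by (auto simp: bedge_def)
        then have "closed_segment a b \<in> boundary_edges \<Omega> T" using interior_edge_iff(2) b by simp
        then show "\<exists>c. \<forall>t. Q K (linepath a b t) = c * edge_legendre p t"
          using cr K orth2[OF K(1,2)] unfolding crouzeix_raviart0_def by simp
      qed
    next
      assume cr: "cr_pieces p Q"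
      show "PW Q \<in> crouzeix_raviart0 \<Omega> T p" unfolding crouzeix_raviart0_def mem_Collect_eq
      proof (intro conjI PQ ballI)
        fix E K K' assume E: "E \<in> interior_edges \<Omega> T" "K \<in> triangles_at T E" "K' \<in> triangles_at T E"
        then have "E \<in> edges T" by (simp add: interior_edges_def)
        then obtain K0 a b where K0: "K0 \<in> T" "a \<noteq> b" "a \<in> verts K0" "b \<in> verts K0" "E = closed_segment a b"
          by (rule edgesE)
        have "{K, K'} \<subseteq> {K'\<in>T. {a, b} \<subseteq> verts K'}"
          using E(2,3) triangles_at_edge[OF K0(1-4)] by (simp add: K0(5))
        then have "K \<in> T" "K' \<in> T" "K \<noteq> K' \<longrightarrow> shared K K' a b" using K0 by (auto simp: shared_def)
        then show "K \<noteq> K' \<longrightarrow> (\<forall>q. poly2_le (p - 1) q \<longrightarrow> edge_integral E (\<lambda>x. jump (PW Q) K K' x * q x) = 0)"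
          using orth1[of K K' a b] K0(2) cr_piecesD(2)[OF cr] unfolding K0(5) by simp
      next
        fix E K assume E: "E \<in> boundary_edges \<Omega> T" "K \<in> triangles_at T E"
        then have "E \<in> edges T" by (simp add: boundary_edges_def)
        then obtain K0 a b where K0: "K0 \<in> T" "a \<noteq> b" "a \<in> verts K0" "b \<in> verts K0" "E = closed_segment a b"
          by (rule edgesE)
        have K: "K \<in> T" "{a, b} \<subseteq> verts K"
          using E(2) triangles_at_edge[OF K0(1-4)] by (simp_all add: K0(5))
        then have "bedge K a b" using interior_edge_iff(2)[of K a b] K0(2,5) E(1) by simp
        then show "\<forall>q. poly2_le (p - 1) q \<longrightarrow> edge_integral E (\<lambda>x. piece (PW Q) K x * q x) = 0"
          using orth2[of K a b] K(1) K0(2) cr_piecesD(3)[OF cr] unfolding K0(5) by simp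
      qed
    qed
  qed
  note * = this
  show ?thesis
  proof
    assume v: "v \<in> crouzeix_raviart0 \<Omega> T p"
    then have "v \<in> piecewise_poly \<Omega> T p" by (simp add: crouzeix_raviart0_def)
    then obtain Q where "\<forall>K\<in>T. poly2_le p (Q K)" "v = PW Q"
      unfolding piecewise_poly_iff by (elim exE conjE)
    then show "\<exists>Q. cr_pieces p Q \<and> v = PW Q" using * v by blast
  next
    assume "\<exists>Q. cr_pieces p Q \<and> v = PW Q"
    then obtain Q where "cr_pieces p Q" "v = PW Q" by (elim exE conjE)
    then show "v \<in> crouzeix_raviart0 \<Omega> T p" using *[of Q] cr_piecesD(1) by blast
  qed
qed

lemma cr_pieces_zero: "cr_pieces p (\<lambda>K x. 0)"
  unfolding cr_pieces_def by (auto intro: poly2_le_const)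

lemma cr_pieces_add:
  assumes "cr_pieces p Q" "cr_pieces p R" shows "cr_pieces p (\<lambda>K x. Q K x + R K x)"
  unfolding cr_pieces_def
proof (intro conjI allI impI ballI)
  show "poly2_le p (\<lambda>x. Q K x + R K x)" if "K \<in> T" for K
    using assms that by (intro poly2_le_add) (simp_all add: cr_piecesD)
  fix K K' u v assume s: "shared K K' u v"
  obtain c where c: "\<forall>t. Q K (linepath u v t) - Q K' (linepath u v t) = c * edge_legendre p t"
    using cr_piecesD(2)[OF assms(1) s] by (elim exE)
  obtain d where d: "\<forall>t. R K (linepath u v t) - R K' (linepath u v t) = d * edge_legendre p t"
    using cr_piecesD(2)[OF assms(2) s] by (elim exE)
  have "Q K (linepath u v t) + R K (linepath u v t) - (Q K' (linepath u v t) + R K' (linepath u v t))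
      = (c + d) * edge_legendre p t" for t
    using c[rule_format, of t] d[rule_format, of t] by (simp add: algebra_simps)
  then show "\<exists>c. \<forall>t. Q K (linepath u v t) + R K (linepath u v t) - (Q K' (linepath u v t) + R K' (linepath u v t))
      = c * edge_legendre p t" by (intro exI allI)
next
  fix K u v assume s: "bedge K u v"
  obtain c where c: "\<forall>t. Q K (linepath u v t) = c * edge_legendre p t"
    using cr_piecesD(3)[OF assms(1) s] by (elim exE)
  obtain d where d: "\<forall>t. R K (linepath u v t) = d * edge_legendre p t"
    using cr_piecesD(3)[OF assms(2) s] by (elim exE)
  have "Q K (linepath u v t) + R K (linepath u v t) = (c + d) * edge_legendre p t" for t
    using c[rule_format, of t] d[rule_format, of t] by (simp add: algebra_simps)
  then show "\<exists>c. \<forall>t. Q K (linepath u v t) + R K (linepath u v t) = c * edge_legendre p t"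
    by (intro exI allI)
qed

lemma cr_pieces_scale:
  assumes "cr_pieces p Q" shows "cr_pieces p (\<lambda>K x. r * Q K x)"
  unfolding cr_pieces_def
proof (intro conjI allI impI ballI)
  show "poly2_le p (\<lambda>x. r * Q K x)" if "K \<in> T" for K
    using assms that by (intro poly2_le_cmult) (simp add: cr_piecesD)
  fix K K' u v assume s: "shared K K' u v"
  obtain c where c: "\<forall>t. Q K (linepath u v t) - Q K' (linepath u v t) = c * edge_legendre p t"
    using cr_piecesD(2)[OF assms(1) s] by (elim exE)
  have "r * Q K (linepath u v t) - r * Q K' (linepath u v t) = (r * c) * edge_legendre p t" for t
    using c[rule_format, of t] by (simp flip: right_diff_distrib)
  then show "\<exists>c. \<forall>t. r * Q K (linepath u v t) - r * Q K' (linepath u v t) = c * edge_legendre p t"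
    by (intro exI allI)
next
  fix K u v assume s: "bedge K u v"
  obtain c where c: "\<forall>t. Q K (linepath u v t) = c * edge_legendre p t"
    using cr_piecesD(3)[OF assms(1) s] by (elim exE)
  have "r * Q K (linepath u v t) = (r * c) * edge_legendre p t" for t
    using c[rule_format, of t] by simp
  then show "\<exists>c. \<forall>t. r * Q K (linepath u v t) = c * edge_legendre p t" by (intro exI allI)
qed

lemma cr_pieces_sum:
  "(\<And>i. i \<in> I \<Longrightarrow> cr_pieces p (Q i)) \<Longrightarrow> cr_pieces p (\<lambda>K x. \<Sum>i\<in>I. \<alpha> i * Q i K x)"
proof (induction I rule: infinite_finite_induct)
  case (insert i I)
  have "cr_pieces p (\<lambda>K x. \<alpha> i * Q i K x)" using insert.prems by (intro cr_pieces_scale) simp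
  moreover have "cr_pieces p (\<lambda>K x. \<Sum>i\<in>I. \<alpha> i * Q i K x)" using insert by simp
  ultimately show ?case using insert.hyps cr_pieces_add by simp
qed (simp_all add: cr_pieces_zero)

lemma subspace_crouzeix_raviart0:
  assumes "p \<ge> 1" shows "subspace (crouzeix_raviart0 \<Omega> T p)"
  unfolding subspace_def crouzeix_raviart0_iff[OF assms]
proof (intro conjI ballI allI, goal_cases)
  case 1
  show ?case unfolding mem_Collect_eq crouzeix_raviart0_iff[OF assms]
    using cr_pieces_zero PW_zero by (intro exI[of _ "\<lambda>K x. 0"]) simp
next
  case (2 v w)
  then obtain Q R where "cr_pieces p Q" "v = PW Q" "cr_pieces p R" "w = PW R"
    unfolding crouzeix_raviart0_iff[OF assms] by (elim exE conjE)
  then show ?case unfolding crouzeix_raviart0_iff[OF assms]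
    using cr_pieces_add PW_add by (intro exI[of _ "\<lambda>K x. Q K x + R K x"]) simp
next
  case (3 r v)
  then obtain Q where "cr_pieces p Q" "v = PW Q"
    unfolding crouzeix_raviart0_iff[OF assms] by (elim exE conjE)
  then show ?case unfolding crouzeix_raviart0_iff[OF assms]
    using cr_pieces_scale PW_scale by (intro exI[of _ "\<lambda>K x. r * Q K x"]) simp
qed

section \<open>Conforming piecewise polynomials\<close>

text \<open>
  Only the edges are mentioned; that the pieces fit together at the vertices is proved in
  \<open>conforming_vertex\<close>.
\<close>

definition conforming :: "nat \<Rightarrow> ((real^2) set \<Rightarrow> real^2 \<Rightarrow> real) \<Rightarrow> bool" where
  "conforming p W \<longleftrightarrow> (\<forall>K\<in>T. poly2_le p (W K))
    \<and> (\<forall>K K' u v. shared K K' u v \<longrightarrow> (\<forall>t. W K (linepath u v t) = W K' (linepath u v t)))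
    \<and> (\<forall>K u v. bedge K u v \<longrightarrow> (\<forall>t. W K (linepath u v t) = 0))"

lemma conformingD:
  assumes "conforming p W"
  shows "K \<in> T \<Longrightarrow> poly2_le p (W K)"
    "shared K K' u v \<Longrightarrow> W K (linepath u v t) = W K' (linepath u v t)"
    "bedge K u v \<Longrightarrow> W K (linepath u v t) = 0"
  using assms unfolding conforming_def by simp_all

lemma conforming_imp_cr: "conforming p W \<Longrightarrow> cr_pieces p W"
  unfolding cr_pieces_def by (auto simp: conformingD intro!: exI[of _ 0])

text \<open>A multiple of the Legendre polynomial that vanishes at an endpoint of the edge is zero.\<close>

lemma cr_imp_conforming:
  assumes cr: "cr_pieces p W"
    and s: "\<And>K K' u v. shared K K' u v \<Longrightarrow> W K v = W K' v"
    and b: "\<And>K u v. bedge K u v \<Longrightarrow> W K v = 0"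
  shows "conforming p W"
  unfolding conforming_def
proof (intro conjI allI impI ballI)
  show "K \<in> T \<Longrightarrow> poly2_le p (W K)" for K using cr_piecesD(1)[OF cr] .
  fix K K' u v t assume sh: "shared K K' u v"
  obtain c where c: "\<forall>t. W K (linepath u v t) - W K' (linepath u v t) = c * edge_legendre p t"
    using cr_piecesD(2)[OF cr sh] by (elim exE)
  have "c = 0" using c[rule_format, of 1] s[OF sh] by (simp add: linepath_def)
  then show "W K (linepath u v t) = W K' (linepath u v t)" using c[rule_format, of t] by simp
next
  fix K u v t assume sh: "bedge K u v"
  obtain c where c: "\<forall>t. W K (linepath u v t) = c * edge_legendre p t"
    using cr_piecesD(3)[OF cr sh] by (elim exE)
  have "c = 0" using c[rule_format, of 1] b[OF sh] by (simp add: linepath_def)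
  then show "W K (linepath u v t) = 0" using c[rule_format, of t] by simp
qed

text \<open>
  The triangles on which \<open>W\<close> has a given nonzero value at \<open>z\<close> have no boundary edge at \<open>z\<close>, and with
  each of them its neighbours across the edges at \<open>z\<close> have the same value, so \<open>full_fan\<close> applies.
\<close>

lemma conforming_vertex_nonzero:
  assumes W: "conforming p W" and K: "K \<in> T" "z \<in> verts K" "W K z \<noteq> 0"
  shows "z \<in> \<Omega>" "K' \<in> T \<Longrightarrow> z \<in> verts K' \<Longrightarrow> W K' z = W K z"
proof -
  define S where "S = {K'\<in>T. z \<in> verts K' \<and> W K' z = W K z}"
  have S: "S \<subseteq> {K\<in>T. z \<in> verts K}" "S \<noteq> {}" using K by (auto simp: S_def)
  have step: "\<exists>K''\<in>S. shared K' K'' z u" if K': "K' \<in> S" "u \<in> verts K'" "u \<noteq> z" for K' u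
  proof -
    have "K' \<in> T" "z \<noteq> u" "z \<in> verts K'" using K' by (auto simp: S_def)
    then show ?thesis
    proof (rule edge_cases[OF _ _ _ K'(2)])
      assume "bedge K' z u"
      then have "W K' (linepath z u 0) = 0" by (rule conformingD(3)[OF W])
      then show ?thesis using K' K(3) by (simp add: S_def linepath_def)
    next
      fix K'' assume sh: "shared K' K'' z u"
      then have "W K' (linepath z u 0) = W K'' (linepath z u 0)" by (rule conformingD(2)[OF W])
      then have "K'' \<in> S" using K' sh by (auto simp: S_def linepath_def shared_def)
      then show ?thesis using sh by blast
    qed
  qed
  show "z \<in> \<Omega>" by (rule full_fan(1)[OF S step])
  have "S = {K\<in>T. z \<in> verts K}" by (rule full_fan(2)[OF S step])
  then show "W K' z = W K z" if "K' \<in> T" "z \<in> verts K'" using that unfolding S_def by blast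
qed

lemma conforming_vertex:
  assumes W: "conforming p W" and K: "K \<in> T" "K' \<in> T" "z \<in> verts K" "z \<in> verts K'"
  shows "W K z = W K' z"
  using conforming_vertex_nonzero[OF W K(1,3)] conforming_vertex_nonzero[OF W K(2,4)] K by metis

lemma inter_point:
  assumes K: "K \<in> T" "K' \<in> T" "K \<noteq> K'" and x: "x \<in> K" "x \<in> K'"
  obtains "x \<in> verts K" "x \<in> verts K'" | u v where "shared K K' u v" "x \<in> closed_segment u v"
proof -
  obtain w where w: "w \<in> verts K" "w \<notin> K'" using triangle_intersection(2)[OF K] by blast
  let ?I = "verts K \<inter> verts K'"
  have xI: "x \<in> convex hull ?I" using triangle_intersection(1)[OF K] x by blast
  have "card ?I \<le> card (verts K - {w})"
    using w verts_subset triangle_facts(4)[OF K(1)] by (intro card_mono) auto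
  then have "card ?I \<le> 2" using w triangle_facts(4,5)[OF K(1)] by simp
  moreover have "card ?I \<noteq> 0" using xI triangle_facts(4)[OF K(1)] by auto
  ultimately have "card ?I = 1 \<or> card ?I = 2" by linarith
  then show ?thesis
  proof
    assume "card ?I = 1"
    then obtain z where z: "?I = {z}" by (rule card_1_singletonE)
    then have "x = z" using xI by simp
    then show ?thesis using z that(1) by blast
  next
    assume "card ?I = 2"
    then obtain u v where uv: "?I = {u, v}" "u \<noteq> v" unfolding card_2_iff by (elim exE conjE)
    then have "shared K K' u v" using K by (auto simp: shared_def)
    moreover have "x \<in> closed_segment u v" using xI unfolding uv segment_convex_hull .
    ultimately show ?thesis by (rule that(2))
  qed
qed

lemma linepath_of_segment: "x \<in> closed_segment u v \<Longrightarrow> \<exists>t. x = linepath u v t" for u v x :: "real^2"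
  by (auto simp: in_segment linepath_def)

lemma conforming_consistent:
  assumes W: "conforming p W" and K: "K \<in> T" "K' \<in> T" and x: "x \<in> K" "x \<in> K'"
  shows "W K x = W K' x"
proof (cases "K = K'")
  case False
  show ?thesis
  proof (rule inter_point[OF K False x])
    assume "x \<in> verts K" "x \<in> verts K'"
    then show ?thesis by (rule conforming_vertex[OF W K])
  next
    fix u v assume s: "shared K K' u v" "x \<in> closed_segment u v"
    obtain t where "x = linepath u v t" using linepath_of_segment[OF s(2)] by (elim exE)
    then show ?thesis using conformingD(2)[OF W s(1)] by simp
  qed
qed simp

lemma tri_zero_edge:
  assumes t: "tri a b c K" and x: "x \<in> K" "bary_coord a b c x = 0"
  shows "x \<in> closed_segment b c"
proof -
  have "0 \<le> bary_coord b c a x" "0 \<le> bary_coord c a b x" using x(1) tri_mem_iff[OF t] by simp_all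
  moreover have "bary_coord b c a x + bary_coord c a b x = 1" using bary_coord_sum[OF tri_nz(1)[OF t], of x] x(2) by simp
  moreover have "x = bary_coord b c a x *\<^sub>R b + bary_coord c a b x *\<^sub>R c" using bary_coord_recover[OF tri_nz(1)[OF t], of x] x(2) by simp
  ultimately show ?thesis unfolding segment_convex_hull convex_hull_2 by blast
qed

lemma not_Omega_cases:
  assumes K: "K \<in> T" and x: "x \<in> K" "x \<notin> \<Omega>"
  obtains "x \<in> verts K" | u v where "bedge K u v" "x \<in> closed_segment u v"
proof -
  obtain a b c where t: "tri a b c K" using triE[OF K] .
  have "x \<notin> interior K" using x interior_subset_Omega[OF K] by blast
  then have "bary_coord a b c x = 0 \<or> bary_coord b c a x = 0 \<or> bary_coord c a b x = 0"
    using tri_interiorI[OF t] x(1) tri_mem_iff[OF t] by force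
  then have "x \<in> closed_segment b c \<or> x \<in> closed_segment c a \<or> x \<in> closed_segment a b"
    using tri_zero_edge[OF t x(1)] tri_zero_edge[OF tri_rot[OF t] x(1)]
      tri_zero_edge[OF tri_rot[OF tri_rot[OF t]] x(1)] by blast
  then have "\<exists>u\<in>verts K. \<exists>v\<in>verts K. u \<noteq> v \<and> x \<in> closed_segment u v"
    unfolding tri_verts[OF t] using tri_distinct[OF t] by auto
  then obtain u v where uv: "u \<in> verts K" "v \<in> verts K" "u \<noteq> v" "x \<in> closed_segment u v" by blast
  show ?thesis
  proof (rule edge_cases[OF K uv(3,1,2)])
    assume "bedge K u v" then show ?thesis using uv(4) that(2) by blast
  next
    fix K' assume "shared K K' u v"
    then have "open_segment u v \<subseteq> \<Omega>" using shared_subset_Omega unfolding shared_def by blast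
    then have "x = u \<or> x = v" using uv(4) x(2) by (auto simp: open_segment_def)
    then show ?thesis using uv(1,2) that(1) by blast
  qed
qed

lemma conforming_boundary:
  assumes W: "conforming p W" and K: "K \<in> T" and x: "x \<in> K" "x \<notin> \<Omega>"
  shows "W K x = 0"
proof (rule not_Omega_cases[OF K x])
  assume "x \<in> verts K"
  then show ?thesis using conforming_vertex_nonzero(1)[OF W K] x(2) by blast
next
  fix u v assume s: "bedge K u v" "x \<in> closed_segment u v"
  obtain t where "x = linepath u v t" using linepath_of_segment[OF s(2)] by (elim exE)
  then show ?thesis using conformingD(3)[OF W s(1)] by simp
qed

end

section \<open>Lagrange basis functions\<close>

context triangulation
begin

lemma bary_at:
  assumes "K \<in> T" "A \<in> verts K" "B \<in> verts K"
  shows "bary K A B = (if A = B then 1 else 0)"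
proof -
  obtain u v where t: "tri A u v K" using assms(1,2) by (rule tri_atE)
  then show ?thesis using assms(3) bary_coord_at[OF t] tri_distinct[OF t] by (auto simp: bary_eq[OF t] tri_verts[OF t])
qed

lemma poly2_le_bary: "K \<in> T \<Longrightarrow> A \<in> verts K \<Longrightarrow> poly2_le 1 (bary K A)"
  by (erule (1) tri_atE) (simp only: bary_eq, rule poly2_le_bary_coord)

lemma bary_linepath:
  assumes "K \<in> T" "A \<in> verts K"
  shows "bary K A (linepath x y t) = (1 - t) * bary K A x + t * bary K A y"
  using assms by (rule tri_atE) (simp add: bary_eq bary_coord_linepath)

lemma sum_verts:
  assumes "tri a b c K" shows "(\<Sum>A\<in>verts K. f A) = f a + f b + f c"
  using tri_distinct[OF assms] unfolding tri_verts[OF assms] by (simp add: ac_simps)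

lemma bary_tri:
  assumes "tri a b c K"
  shows "bary K a = bary_coord a b c" "bary K b = bary_coord b c a" "bary K c = bary_coord c a b"
  using bary_eq assms tri_rot[OF assms] tri_rot[OF tri_rot[OF assms]] by auto

lemma bary_sum: "K \<in> T \<Longrightarrow> (\<Sum>A\<in>verts K. bary K A x) = 1"
  by (erule triE) (simp add: sum_verts bary_tri bary_coord_sum tri_nz)

lemma bary_recover: "K \<in> T \<Longrightarrow> (\<Sum>A\<in>verts K. bary K A x *\<^sub>R A) = x"
  by (erule triE) (simp add: sum_verts bary_tri bary_coord_recover tri_nz)

lemma bary_nonneg_iff: "K \<in> T \<Longrightarrow> x \<in> K \<longleftrightarrow> (\<forall>A\<in>verts K. 0 \<le> bary K A x)"
  by (erule triE) (simp add: tri_verts bary_tri tri_mem_iff)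

text \<open>
  The nodes in barycentric coordinates. This description is symmetric in the vertices, so it does not
  depend on the affine map chosen in \<open>ref_map\<close>.
\<close>

definition nodeset :: "nat \<Rightarrow> (real^2) set \<Rightarrow> (real^2) set" where
  "nodeset p K = {x. \<forall>A\<in>verts K. \<exists>i::nat. real p * bary K A x = real i}"

text \<open>
  The chosen map sends the vertices of the reference triangle to points whose convex hull is \<open>K\<close>; the
  three vertices of \<open>K\<close> must be among them.
\<close>

lemma ref_map_props:
  assumes K: "K \<in> T"
  obtains a b c where "verts K = {a, b, c}" "a \<noteq> b" "b \<noteq> c" "c \<noteq> a"
    "\<forall>x. ref_map K x = (1 - x$1 - x$2) *\<^sub>R a + x$1 *\<^sub>R b + x$2 *\<^sub>R c"
proof -
  have comb: "A *v x = x$1 *\<^sub>R (A *v vector [1, 0]) + x$2 *\<^sub>R (A *v vector [0, 1])" for A :: "real^2^2" and x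
    by (simp add: vec2_eq_iff matrix_vector_mult_def sum_2 algebra_simps)
  have img: "h ` ref_triangle = convex hull {h (vector [0, 0]), h (vector [1, 0]), h (vector [0, 1])}"
    if h: "\<forall>x. h x = A *v x + b" for h :: "real^2 \<Rightarrow> real^2" and A :: "real^2^2" and b
  proof -
    have "h = (\<lambda>y. b + y) \<circ> (*v) A" using h by (auto simp: add.commute)
    then have "h ` ref_triangle = (\<lambda>y. b + y) ` ((*v) A ` ref_triangle)" by (simp add: image_comp)
    also have "\<dots> = convex hull ((\<lambda>y. b + y) ` ((*v) A ` {vector [0, 0], vector [1, 0], vector [0, 1]}))"
      unfolding ref_triangle_def
      by (simp only: convex_hull_translation convex_hull_linear_image matrix_vector_mul_linear)
    finally show ?thesis using h by (simp add: add.commute)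
  qed
  have ex: "\<exists>h. (\<exists>(A :: real^2^2) b. \<forall>x. h x = A *v x + b) \<and> bij_betw h ref_triangle K"
  proof -
    obtain a b c where t: "tri a b c K" using triE[OF K] .
    define A :: "real^2^2" where "A = vector [vector [(b - a)$1, (c - a)$1], vector [(b - a)$2, (c - a)$2]]"
    have A: "A *v x = x$1 *\<^sub>R (b - a) + x$2 *\<^sub>R (c - a)" for x
      by (simp add: A_def vec2_eq_iff matrix_vector_mult_def sum_2 algebra_simps)
    define h where "h = (\<lambda>x. A *v x + a)"
    have hx: "\<forall>x. h x = A *v x + a" by (simp add: h_def)
    have "h ` ref_triangle = K" unfolding img[OF hx] using t by (simp add: h_def A tri_def)
    moreover have "inj h"
    proof (rule injI)
      fix x y assume "h x = h y"
      then have h: "(1 - x$1 - x$2) *\<^sub>R a + x$1 *\<^sub>R b + x$2 *\<^sub>R c = (1 - y$1 - y$2) *\<^sub>R a + y$1 *\<^sub>R b + y$2 *\<^sub>R c"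
        by (simp add: h_def A algebra_simps)
      have "x$1 = y$1"
        using bary_coord_combination[OF tri_nz(2)[OF t], of "x$1" "x$2" "1 - x$1 - x$2"]
          bary_coord_combination[OF tri_nz(2)[OF t], of "y$1" "y$2" "1 - y$1 - y$2"] h by (simp add: ac_simps)
      moreover have "x$2 = y$2"
        using bary_coord_combination[OF tri_nz(3)[OF t], of "x$2" "1 - x$1 - x$2" "x$1"]
          bary_coord_combination[OF tri_nz(3)[OF t], of "y$2" "1 - y$1 - y$2" "y$1"] h by (simp add: ac_simps)
      ultimately show "x = y" by (simp add: vec2_eq_iff)
    qed
    ultimately show ?thesis using hx unfolding bij_betw_def by (metis inj_on_subset subset_UNIV)
  qed
  have "(\<exists>(A :: real^2^2) b. \<forall>x. ref_map K x = A *v x + b) \<and> bij_betw (ref_map K) ref_triangle K"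
    unfolding ref_map_def by (rule someI_ex[OF ex])
  then obtain A :: "real^2^2" and d where h: "\<forall>x. ref_map K x = A *v x + d" and
    bij: "bij_betw (ref_map K) ref_triangle K" by (elim exE conjE)
  define a b c where abc: "a = ref_map K (vector [0, 0])" "b = ref_map K (vector [1, 0])" "c = ref_map K (vector [0, 1])"
  have "K = convex hull {a, b, c}" unfolding abc img[OF h, symmetric] using bij by (simp add: bij_betw_def)
  then have "verts K \<subseteq> {a, b, c}" unfolding verts_def using extreme_point_of_convex_hull by blast
  moreover have "card (verts K) = 3" by (rule triangle_facts(5)[OF K])
  moreover have "card {a, b, c} \<le> 3" by (simp add: card_insert_if)
  ultimately have v: "verts K = {a, b, c}" by (intro card_seteq) auto
  then have "card {a, b, c} = 3" using triangle_facts(5)[OF K] by simp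
  then have ne: "a \<noteq> b" "b \<noteq> c" "c \<noteq> a" by (auto simp: card_insert_if split: if_splits)
  have "vector [0, 0] = (0 :: real^2)" by (simp add: vec2_eq_iff)
  then have "a = d" using h by (simp add: abc)
  then have Ab: "A *v vector [1, 0] = b - a" "A *v vector [0, 1] = c - a" using h by (simp_all add: abc)
  have Ax: "A *v x = x$1 *\<^sub>R (b - a) + x$2 *\<^sub>R (c - a)" for x
    unfolding comb[of A x] Ab ..
  have "ref_map K x = (1 - x$1 - x$2) *\<^sub>R a + x$1 *\<^sub>R b + x$2 *\<^sub>R c" for x
    unfolding h[rule_format] Ax \<open>a = d\<close>[symmetric] by (simp add: algebra_simps)
  then have "\<forall>x. ref_map K x = (1 - x$1 - x$2) *\<^sub>R a + x$1 *\<^sub>R b + x$2 *\<^sub>R c" by blast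
  with v ne show ?thesis by (rule that)
qed

lemma bary_comb3:
  assumes K: "K \<in> T" "verts K = {a, b, c}" "a \<noteq> b" "b \<noteq> c" "c \<noteq> a" and s: "r + s + t = 1"
  shows "bary K a (r *\<^sub>R a + s *\<^sub>R b + t *\<^sub>R c) = r" "bary K b (r *\<^sub>R a + s *\<^sub>R b + t *\<^sub>R c) = s"
    "bary K c (r *\<^sub>R a + s *\<^sub>R b + t *\<^sub>R c) = t"
proof -
  have *: "bary K A (r *\<^sub>R a + s *\<^sub>R b + t *\<^sub>R c) = r * bary K A a + s * bary K A b + t * bary K A c"
    if A: "A \<in> verts K" for A
  proof -
    obtain u v where t: "tri A u v K" using K(1) A by (rule tri_atE)
    obtain \<alpha> \<beta> where ab: "\<forall>x. bary_coord A u v x = \<alpha> \<bullet> x + \<beta>" using bary_coord_affine[OF t] by (elim exE)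
    have "\<beta> = (r + s + t) * \<beta>" using assms(6) by simp
    then show ?thesis unfolding bary_eq[OF t] ab[rule_format] by (simp add: inner_add_right algebra_simps)
  qed
  show "bary K a (r *\<^sub>R a + s *\<^sub>R b + t *\<^sub>R c) = r" "bary K b (r *\<^sub>R a + s *\<^sub>R b + t *\<^sub>R c) = s"
    "bary K c (r *\<^sub>R a + s *\<^sub>R b + t *\<^sub>R c) = t"
    using *[of a] *[of b] *[of c] K by (simp_all add: bary_at)
qed

lemma nodes_eq:
  assumes p: "p \<ge> 1" shows "nodes T p = (\<Union>K\<in>T. nodeset p K)"
proof -
  have "ref_map K ` ref_nodes p = nodeset p K" if K: "K \<in> T" for K
  proof -
    obtain a b c where v: "verts K = {a, b, c}" "a \<noteq> b" "b \<noteq> c" "c \<noteq> a" and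
      h': "\<forall>x. ref_map K x = (1 - x$1 - x$2) *\<^sub>R a + x$1 *\<^sub>R b + x$2 *\<^sub>R c"
      using ref_map_props[OF K] .
    note h = h'[rule_format]
    note bc3 = bary_comb3[OF K v]
    show ?thesis
    proof (intro set_eqI iffI)
      fix x assume "x \<in> ref_map K ` ref_nodes p"
      then obtain i j where ij: "i + j \<le> p" "x = ref_map K (vector [real i / real p, real j / real p])"
        unfolding ref_nodes_def by blast
      have x: "x = (1 - real i / real p - real j / real p) *\<^sub>R a + (real i / real p) *\<^sub>R b + (real j / real p) *\<^sub>R c"
        unfolding ij(2) h by simp
      have "real p * bary K b x = real i" "real p * bary K c x = real j" "real p * bary K a x = real (p - i - j)"
        unfolding x using p ij(1) by (simp_all add: bc3 right_diff_distrib of_nat_diff)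
      then show "x \<in> nodeset p K" unfolding nodeset_def v by blast
    next
      fix x assume "x \<in> nodeset p K"
      then obtain i j k where ijk: "real p * bary K b x = real i" "real p * bary K c x = real j" "real p * bary K a x = real k"
        unfolding nodeset_def v by blast
      have s: "bary K a x + bary K b x + bary K c x = 1"
        using bary_sum[OF K, of x] v by (simp add: ac_simps)
      have r: "bary K a x *\<^sub>R a + bary K b x *\<^sub>R b + bary K c x *\<^sub>R c = x"
        using bary_recover[OF K, of x] v by (simp add: ac_simps)
      have "real p * (bary K a x + bary K b x + bary K c x) = real (k + i + j)"
        by (simp add: distrib_left ijk)
      then have "i + j \<le> p" unfolding s by simp
      moreover have bij: "bary K b x = real i / real p" "bary K c x = real j / real p" using ijk p by (simp_all add: field_simps)
      moreover have "bary K a x = 1 - bary K b x - bary K c x" using s by simp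
      then have "x = (1 - bary K b x - bary K c x) *\<^sub>R a + bary K b x *\<^sub>R b + bary K c x *\<^sub>R c" using r by simp
      then have "x = ref_map K (vector [bary K b x, bary K c x])" unfolding h by simp
      ultimately show "x \<in> ref_map K ` ref_nodes p" unfolding ref_nodes_def by auto
    qed
  qed
  then show ?thesis unfolding nodes_def by simp
qed

lemma nodeset_subset: 
  assumes p: "p \<ge> 1" and K: "K \<in> T" shows "nodeset p K \<subseteq> K"
proof
  fix x assume x: "x \<in> nodeset p K"
  have "0 \<le> bary K A x" if A: "A \<in> verts K" for A
  proof -
    obtain i where "real p * bary K A x = real i" using x A unfolding nodeset_def by blast
    then have "bary K A x = real i / real p" using p by (simp add: field_simps)
    then show ?thesis by simp
  qed
  then show "x \<in> K" using bary_nonneg_iff[OF K] by blast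
qed

lemma verts_nodeset: "K \<in> T \<Longrightarrow> verts K \<subseteq> nodeset p K"
proof
  fix B assume K: "K \<in> T" "B \<in> verts K"
  have "real p * bary K A B = real (if A = B then p else 0)" if "A \<in> verts K" for A
    using bary_at[OF K(1) that K(2)] by simp
  then show "B \<in> nodeset p K" unfolding nodeset_def by blast
qed

lemma edge_nodeset:
  assumes K: "K \<in> T" "u \<noteq> v" "u \<in> verts K" "v \<in> verts K" and i: "i \<le> p" "p \<ge> 1"
  shows "linepath u v (real i / real p) \<in> nodeset p K"
proof -
  have "real p * bary K A (linepath u v (real i / real p))
     = real (if A = u then p - i else if A = v then i else 0)" if A: "A \<in> verts K" for A
    unfolding bary_linepath[OF K(1) A] bary_at[OF K(1) A K(3)] bary_at[OF K(1) A K(4)]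
    using i K(2) by (auto simp: right_diff_distrib of_nat_diff)
  then show ?thesis unfolding nodeset_def by blast
qed

text \<open>
  A point shared by two triangles is a common vertex, or it lies on a common edge, where its
  coordinates with respect to both triangles are given by its position on the edge.
\<close>

lemma nodeset_consistent:
  assumes p: "p \<ge> 1" and K: "K \<in> T" "K' \<in> T" and z: "z \<in> nodeset p K" "z \<in> K'"
  shows "z \<in> nodeset p K'"
proof (cases "K = K'")
  case False
  have zK: "z \<in> K" using nodeset_subset[OF p K(1)] z(1) by blast
  show ?thesis
  proof (rule inter_point[OF K False zK z(2)])
    assume "z \<in> verts K'" then show ?thesis using verts_nodeset[OF K(2)] by blast
  next
    fix u v assume s: "shared K K' u v" "z \<in> closed_segment u v"
    then have uv: "u \<noteq> v" "u \<in> verts K" "v \<in> verts K" "u \<in> verts K'" "v \<in> verts K'" by (auto simp: shared_def)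
    obtain t where t: "0 \<le> t" "t \<le> 1" "z = linepath u v t"
      using s(2) by (auto simp: in_segment linepath_def)
    have "bary K v z = t" unfolding t(3) bary_linepath[OF K(1) uv(3)] using uv bary_at[OF K(1)] by simp
    then obtain i where i: "real p * t = real i" using z(1) uv unfolding nodeset_def by blast
    have "real i \<le> real p" using mult_left_mono[OF t(2), of "real p"] i by simp
    moreover have "t = real i / real p" using i p by (simp add: field_simps)
    ultimately show ?thesis using edge_nodeset[OF K(2) uv(1,4,5) _ p, of i] t(3) by simp
  qed
qed (use z in simp)

text \<open>The affine map \<open>h\<close> sends the integer lattice triangle of size \<open>p\<close> to the nodes.\<close>

lemma unisolvent:
  assumes K: "K \<in> T" and p: "p \<ge> 1" and q: "poly2_le p q" "\<And>x. x \<in> nodeset p K \<Longrightarrow> q x = 0"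
  shows "q x = 0"
proof -
  obtain a b c where t: "tri a b c K" using triE[OF K] .
  note d = tri_distinct[OF t]
  define h where "h = (\<lambda>x::real^2. (1 - x$1 / real p - x$2 / real p) *\<^sub>R a + (x$1 / real p) *\<^sub>R b + (x$2 / real p) *\<^sub>R c)"
  have "poly2_le 1 (\<lambda>x. h x $ i)" for i
  proof -
    have eq: "(\<lambda>x. h x $ i) = (\<lambda>x. ((b - a)$i / real p) * x$1 + ((c - a)$i / real p) * x$2 + a$i)"
      unfolding h_def by (intro ext) (simp add: field_simps diff_divide_distrib)
    show ?thesis unfolding eq by (rule poly2_le_affine) simp
  qed
  then have "poly2_le p (\<lambda>x. q (h x))" by (intro poly2_le_compose[OF q(1)])
  moreover have "q (h (vector [real i, real j])) = 0" if ij: "i + j \<le> p" for i j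
  proof (rule q(2))
    note b3 = bary_comb3[OF K tri_verts[OF t] d, of "1 - real i / real p - real j / real p" "real i / real p" "real j / real p"]
    let ?x = "h (vector [real i, real j])"
    have "real p * bary K a ?x = real (p - i - j)" "real p * bary K b ?x = real i" "real p * bary K c ?x = real j"
      unfolding h_def using p ij by (simp_all add: b3 right_diff_distrib of_nat_diff)
    then show "?x \<in> nodeset p K" unfolding nodeset_def tri_verts[OF t] by blast
  qed
  ultimately have z: "q (h y) = 0" for y by (rule poly2_le_unisolvent)
  have "h (vector [real p * bary_coord b c a x, real p * bary_coord c a b x]) = (1 - bary_coord b c a x - bary_coord c a b x) *\<^sub>R a + bary_coord b c a x *\<^sub>R b + bary_coord c a b x *\<^sub>R c"
    unfolding h_def using p by simp
  also have "1 - bary_coord b c a x - bary_coord c a b x = bary_coord a b c x" using bary_coord_sum[OF tri_nz(1)[OF t], of x] by simp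
  finally have "h (vector [real p * bary_coord b c a x, real p * bary_coord c a b x]) = x" using bary_coord_recover[OF tri_nz(1)[OF t], of x] by simp
  then show ?thesis using z by metis
qed

text \<open>
  For each vertex the factors vanish on the lattice lines whose index is smaller than that of \<open>z\<close>.
  The indices of a node add up to \<open>p\<close>, so every other node has a smaller index than \<open>z\<close> at some vertex.
  The value zero for all other \<open>z\<close> makes this the piece on \<open>K\<close> of the basis function of an arbitrary
  node of the triangulation.
\<close>

definition local_lagrange :: "nat \<Rightarrow> (real^2) set \<Rightarrow> real^2 \<Rightarrow> real^2 \<Rightarrow> real" where
  "local_lagrange p K z x = (if z \<in> nodeset p K
     then (\<Prod>A\<in>verts K. \<Prod>m<nat \<lfloor>real p * bary K A z\<rfloor>.
       (real p * bary K A x - real m) / (real p * bary K A z - real m)) else 0)"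

lemma node_index:
  assumes "z \<in> nodeset p K" "A \<in> verts K"
  shows "real p * bary K A z = real (nat \<lfloor>real p * bary K A z\<rfloor>)"
proof -
  obtain i where "real p * bary K A z = real i" using assms unfolding nodeset_def by blast
  then show ?thesis by simp
qed

lemma sum_node_index:
  assumes "K \<in> T" "z \<in> nodeset p K"
  shows "(\<Sum>A\<in>verts K. nat \<lfloor>real p * bary K A z\<rfloor>) = p"
proof -
  have "real (\<Sum>A\<in>verts K. nat \<lfloor>real p * bary K A z\<rfloor>) = (\<Sum>A\<in>verts K. real p * bary K A z)"
    unfolding of_nat_sum using node_index[OF assms(2)] by (intro sum.cong) auto
  also have "\<dots> = real p" using bary_sum[OF assms(1), of z] by (simp flip: sum_distrib_left)
  finally show ?thesis by (simp only: of_nat_eq_iff)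
qed

lemma poly2_le_local_lagrange:
  assumes K: "K \<in> T" shows "poly2_le p (local_lagrange p K z)"
proof (cases "z \<in> nodeset p K")
  case True
  let ?i = "\<lambda>A. nat \<lfloor>real p * bary K A z\<rfloor>"
  have "poly2_le (\<Sum>A\<in>verts K. \<Sum>m<?i A. 1) (\<lambda>x. \<Prod>A\<in>verts K. \<Prod>m<?i A.
       (1 / (real p * bary K A z - real m)) * (real p * bary K A x - real m))"
  proof (intro poly2_le_prod triangle_facts(4)[OF K] finite_lessThan poly2_le_cmult poly2_le_diff poly2_le_const)
    show "poly2_le 1 (bary K A)" if "A \<in> verts K" for A using poly2_le_bary[OF K that] .
  qed
  then show ?thesis using True sum_node_index[OF K True] by (simp add: local_lagrange_def[abs_def])
next
  case False
  then show ?thesis by (simp add: local_lagrange_def[abs_def] poly2_le_const)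
qed

lemma local_lagrange_at_node:
  assumes K: "K \<in> T" and x: "x \<in> nodeset p K" and p: "p \<ge> 1"
  shows "local_lagrange p K z x = (if x = z then 1 else 0)"
proof (cases "z \<in> nodeset p K")
  case True
  let ?i = "\<lambda>z A. nat \<lfloor>real p * bary K A z\<rfloor>"
  note ix = node_index[OF x] and iz = node_index[OF True]
  have l: "local_lagrange p K z x = (\<Prod>A\<in>verts K. \<Prod>m<?i z A. (real (?i x A) - real m) / (real (?i z A) - real m))"
    unfolding local_lagrange_def if_P[OF True] using ix iz by (intro prod.cong refl) simp
  show ?thesis
  proof (cases "\<forall>A\<in>verts K. ?i z A \<le> ?i x A")
    case le: True
    have eq: "?i z A = ?i x A" if A: "A \<in> verts K" for A
    proof (rule ccontr)
      assume "?i z A \<noteq> ?i x A"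
      then have "?i z A < ?i x A" using bspec[OF le A] by linarith
      then have "(\<Sum>A\<in>verts K. ?i z A) < (\<Sum>A\<in>verts K. ?i x A)"
        using le A by (intro sum_strict_mono_ex1 triangle_facts(4)[OF K]) auto
      then show False using sum_node_index[OF K x] sum_node_index[OF K True] by simp
    qed
    have "bary K A x = bary K A z" if "A \<in> verts K" for A
    proof -
      have "real p * bary K A x = real p * bary K A z" using ix[OF that] iz[OF that] eq[OF that] by metis
      then show ?thesis using p by simp
    qed
    then have "(\<Sum>A\<in>verts K. bary K A x *\<^sub>R A) = (\<Sum>A\<in>verts K. bary K A z *\<^sub>R A)" by (intro sum.cong) auto
    then have "x = z" using bary_recover[OF K] by simp
    moreover have "local_lagrange p K z x = 1" unfolding l
    proof (intro prod.neutral ballI)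
      fix A m assume "A \<in> verts K" "m \<in> {..<?i z A}"
      then show "(real (?i x A) - real m) / (real (?i z A) - real m) = 1" using eq by simp
    qed
    ultimately show ?thesis by simp
  next
    case False
    then obtain A where A: "A \<in> verts K" "?i x A < ?i z A" by (auto simp: not_le)
    have "(\<Prod>m<?i z A. (real (?i x A) - real m) / (real (?i z A) - real m)) = 0"
      using A(2) by (intro prod_zero) auto
    then have "local_lagrange p K z x = 0" unfolding l using A(1) triangle_facts(4)[OF K] by (intro prod_zero) auto
    moreover have "x \<noteq> z" using A(2) by auto
    ultimately show ?thesis by simp
  qed
next
  case False
  then show ?thesis using x by (auto simp: local_lagrange_def)
qed

text \<open>The trace has degree at most \<open>p\<close>, and there are \<open>p + 1\<close> nodes on an edge.\<close>

lemma zero_on_edge_of_zero_at_nodes: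
  assumes K: "K \<in> T" "u \<noteq> v" "u \<in> verts K" "v \<in> verts K" and p: "p \<ge> 1"
    and q: "poly2_le p q" "\<And>x. x \<in> nodeset p K \<Longrightarrow> x \<in> closed_segment u v \<Longrightarrow> q x = 0"
  shows "q (linepath u v t) = 0"
proof -
  obtain r where r: "degree r \<le> p" "\<And>t. q (linepath u v t) = poly r t"
    using poly2_le_on_linepath[OF q(1), of u v] by blast
  have "r = 0"
  proof (rule poly_eq_0_of_many_roots[OF r(1)])
    fix i assume i: "i \<le> p"
    have "linepath u v (real i / real p) \<in> closed_segment u v"
      using i p by (intro linepath_in_path) simp
    then show "poly r (real i / real p) = 0"
      using q(2)[OF edge_nodeset[OF K i p]] unfolding r(2) by simp
  qed (use p in simp)
  then show ?thesis using r(2) by simp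
qed

lemma local_lagrange_shared:
  assumes p: "p \<ge> 1" and s: "shared K K' u v"
  shows "local_lagrange p K z (linepath u v t) = local_lagrange p K' z (linepath u v t)"
proof -
  have K: "K \<in> T" "K' \<in> T" "u \<noteq> v" "u \<in> verts K" "v \<in> verts K" "u \<in> verts K'" "v \<in> verts K'"
    using s by (auto simp: shared_def)
  have "local_lagrange p K z (linepath u v t) - local_lagrange p K' z (linepath u v t) = 0"
  proof (rule zero_on_edge_of_zero_at_nodes[OF K(1,3,4,5) p poly2_le_diff[OF poly2_le_local_lagrange[OF K(1)] poly2_le_local_lagrange[OF K(2)]]])
    fix x assume x: "x \<in> nodeset p K" "x \<in> closed_segment u v"
    then have "x \<in> nodeset p K'"
      using nodeset_consistent[OF p K(1,2)] edge_subset_triangle[OF K(2,6,7)] by blast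
    then show "local_lagrange p K z x - local_lagrange p K' z x = 0" using x local_lagrange_at_node K p by simp
  qed
  then show ?thesis by simp
qed

lemma local_lagrange_consistent:
  assumes p: "p \<ge> 1" and K: "K \<in> T" "K' \<in> T" and x: "x \<in> K" "x \<in> K'"
  shows "local_lagrange p K z x = local_lagrange p K' z x"
proof (cases "K = K'")
  case False
  show ?thesis
  proof (rule inter_point[OF K False x])
    assume "x \<in> verts K" "x \<in> verts K'"
    then show ?thesis using verts_nodeset K local_lagrange_at_node[OF _ _ p] by (metis subsetD)
  next
    fix u v assume s: "shared K K' u v" "x \<in> closed_segment u v"
    obtain t where "x = linepath u v t" using linepath_of_segment[OF s(2)] by (elim exE)
    then show ?thesis using local_lagrange_shared[OF p s(1)] by simp
  qed
qed simp

lemma S_space_unique: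
  assumes p: "p \<ge> 1" and b: "b \<in> S_space T p" "\<forall>z'\<in>nodes T p. b z' = (if z' = z then 1 else 0)"
    and K: "K \<in> T" "x \<in> K"
  shows "b x = local_lagrange p K z x"
proof -
  obtain q where q: "poly2_le p q" "\<forall>x\<in>K. b x = q x" using b(1) K(1) unfolding S_space_def by blast
  have "q x - local_lagrange p K z x = 0"
  proof (rule unisolvent[OF K(1) p poly2_le_diff[OF q(1) poly2_le_local_lagrange[OF K(1)]]])
    fix y assume y: "y \<in> nodeset p K"
    then have "y \<in> K" "y \<in> nodes T p" using nodeset_subset[OF p K(1)] nodes_eq[OF p] K(1) by auto
    then have "q y = (if y = z then 1 else 0)"
      using q(2)[rule_format, of y] b(2)[rule_format, of y] by simp
    then show "q y - local_lagrange p K z y = 0" using local_lagrange_at_node[OF K(1) y p] by simp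
  qed
  then show ?thesis using q(2) K(2) by simp
qed

text \<open>
  The local polynomials agree where triangles meet, so they define a continuous function. It is the
  only one with the prescribed values because a piece is determined by its values at the nodes.
\<close>

lemma lagrange_eq:
  assumes p: "p \<ge> 1"
  shows "K \<in> T \<Longrightarrow> x \<in> K \<Longrightarrow> lagrange T p z x = local_lagrange p K z x"
    and "x \<notin> \<Union>T \<Longrightarrow> lagrange T p z x = 0"
proof -
  define g where "g = (\<lambda>x. if x \<in> \<Union>T then local_lagrange p (SOME K. K \<in> T \<and> x \<in> K) z x else 0)"
  have gK: "g x = local_lagrange p K z x" if "K \<in> T" "x \<in> K" for K x
  proof -
    have "\<exists>K. K \<in> T \<and> x \<in> K" using that by blast
    from someI_ex[OF this] have K': "(SOME K. K \<in> T \<and> x \<in> K) \<in> T" "x \<in> (SOME K. K \<in> T \<and> x \<in> K)"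
      by simp_all
    have "g x = local_lagrange p (SOME K. K \<in> T \<and> x \<in> K) z x" using that by (auto simp: g_def)
    also have "\<dots> = local_lagrange p K z x" by (rule local_lagrange_consistent[OF p K'(1) that(1) K'(2) that(2)])
    finally show ?thesis .
  qed
  have "continuous_on (\<Union>K\<in>T. id K) g"
  proof (rule continuous_on_closed_Union)
    show "continuous_on (id K) g" if "K \<in> T" for K
      using poly2_le_continuous[OF poly2_le_local_lagrange[OF that], of K p z] gK[OF that]
      by (simp cong: continuous_on_cong)
  qed (use closed_T in auto)
  moreover have "\<forall>K\<in>T. \<exists>q. poly2_le p q \<and> (\<forall>x\<in>K. g x = q x)"
    using gK poly2_le_local_lagrange by blast
  ultimately have S: "g \<in> S_space T p" unfolding S_space_def by (simp add: g_def)
  have d: "\<forall>z'\<in>nodes T p. g z' = (if z' = z then 1 else 0)"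
  proof
    fix z' assume "z' \<in> nodes T p"
    then obtain K where K: "K \<in> T" "z' \<in> nodeset p K" unfolding nodes_eq[OF p] by blast
    then show "g z' = (if z' = z then 1 else 0)"
      using gK[OF K(1)] local_lagrange_at_node[OF K p] nodeset_subset[OF p K(1)] by auto
  qed
  have "lagrange T p z = g" unfolding lagrange_def
  proof (rule the_equality)
    show "g \<in> S_space T p \<and> (\<forall>z'\<in>nodes T p. g z' = (if z' = z then 1 else 0))" using S d by blast
    fix b assume b: "b \<in> S_space T p \<and> (\<forall>z'\<in>nodes T p. b z' = (if z' = z then 1 else 0))"
    show "b = g"
    proof
      fix x show "b x = g x"
      proof (cases "x \<in> \<Union>T")
        case True
        then obtain K where "K \<in> T" "x \<in> K" by blast
        then show ?thesis using S_space_unique[OF p conjunct1[OF b] conjunct2[OF b]] gK by simp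
      next
        case False
        then have "b x = 0" using b by (simp add: S_space_def)
        then show ?thesis using False by (simp add: g_def)
      qed
    qed
  qed
  then show "K \<in> T \<Longrightarrow> x \<in> K \<Longrightarrow> lagrange T p z x = local_lagrange p K z x"
    and "x \<notin> \<Union>T \<Longrightarrow> lagrange T p z x = 0" using gK by (auto simp: g_def)
qed

lemma ae_class_lagrange: "p \<ge> 1 \<Longrightarrow> ae_class (lagrange T p z) = PW (\<lambda>K. local_lagrange p K z)"
  using lagrange_eq interior_subset by (intro ae_class_eq_PW) blast+

lemma conforming_local_lagrange:
  assumes p: "p \<ge> 1" and z: "z \<in> \<Omega>"
  shows "conforming p (\<lambda>K. local_lagrange p K z)"
  unfolding conforming_def
proof (intro conjI allI impI ballI)
  show "poly2_le p (local_lagrange p K z)" if "K \<in> T" for K using poly2_le_local_lagrange[OF that] .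
  show "local_lagrange p K z (linepath u v t) = local_lagrange p K' z (linepath u v t)" if "shared K K' u v" for K K' u v t
    using local_lagrange_shared[OF p that] .
  fix K u v t assume b: "bedge K u v"
  then have K: "K \<in> T" "u \<noteq> v" "u \<in> verts K" "v \<in> verts K" by (auto simp: bedge_def)
  show "local_lagrange p K z (linepath u v t) = 0"
  proof (rule zero_on_edge_of_zero_at_nodes[OF K p poly2_le_local_lagrange[OF K(1)]])
    fix x assume "x \<in> nodeset p K" "x \<in> closed_segment u v"
    then show "local_lagrange p K z x = 0" using local_lagrange_at_node[OF K(1) _ p] bedge_not_Omega[OF b] z by auto
  qed
qed

lemma finite_nodes: assumes p: "p \<ge> 1" shows "finite (nodes T p)"
proof -
  have "finite (ref_nodes p)"
  proof -
    have "ref_nodes p \<subseteq> (\<lambda>(i, j). vector [real i / real p, real j / real p]) ` {(i,j). i + j \<le> p}"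
      unfolding ref_nodes_def by auto
    then show ?thesis by (rule finite_subset) simp
  qed
  then show ?thesis unfolding nodes_def by simp
qed

lemma local_lagrange_sum_at_node:
  assumes p: "p \<ge> 1" and N: "N \<subseteq> nodes T p" and K: "K \<in> T" and y: "y \<in> nodeset p K"
  shows "(\<Sum>z\<in>N. \<alpha> z * local_lagrange p K z y) = (if y \<in> N then \<alpha> y else 0)"
proof -
  have "finite N" using N finite_nodes[OF p] by (rule finite_subset)
  have "(\<Sum>z\<in>N. \<alpha> z * local_lagrange p K z y) = (\<Sum>z\<in>N. if y = z then \<alpha> z else 0)"
    using local_lagrange_at_node[OF K y p] by (intro sum.cong) auto
  then show ?thesis using \<open>finite N\<close> by simp
qed

text \<open>
  Both sides have the same values at the nodes of every triangle; outside of \<open>\<Omega>\<close> these values are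
  zero by \<open>conforming_boundary\<close>.
\<close>

lemma conforming_expansion:
  assumes p: "p \<ge> 1" and W: "conforming p W"
    and N: "N \<subseteq> nodes T p \<inter> \<Omega>" "\<And>K z. K \<in> T \<Longrightarrow> z \<in> nodeset p K \<Longrightarrow> z \<in> \<Omega> \<Longrightarrow> z \<notin> N \<Longrightarrow> W K z = 0"
  obtains \<alpha> where "\<And>K x. K \<in> T \<Longrightarrow> W K x = (\<Sum>z\<in>N. \<alpha> z * local_lagrange p K z x)"
proof -
  define \<alpha> where "\<alpha> = (\<lambda>z. W (SOME K. K \<in> T \<and> z \<in> K) z)"
  have a: "\<alpha> z = W K z" if "K \<in> T" "z \<in> K" for K z
  proof -
    have "\<exists>K. K \<in> T \<and> z \<in> K" using that by blast
    from someI_ex[OF this] have K': "(SOME K. K \<in> T \<and> z \<in> K) \<in> T" "z \<in> (SOME K. K \<in> T \<and> z \<in> K)"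
      by simp_all
    show ?thesis unfolding \<alpha>_def by (rule conforming_consistent[OF W K'(1) that(1) K'(2) that(2)])
  qed
  have "W K x = (\<Sum>z\<in>N. \<alpha> z * local_lagrange p K z x)" if K: "K \<in> T" for K x
  proof -
    have "W K x - (\<Sum>z\<in>N. \<alpha> z * local_lagrange p K z x) = 0"
    proof (rule unisolvent[OF K p])
      show "poly2_le p (\<lambda>x. W K x - (\<Sum>z\<in>N. \<alpha> z * local_lagrange p K z x))"
        using conformingD(1)[OF W K] poly2_le_local_lagrange[OF K]
        by (intro poly2_le_diff poly2_le_sum poly2_le_cmult)
      fix y assume y: "y \<in> nodeset p K"
      then have yK: "y \<in> K" using nodeset_subset[OF p K] by blast
      have "(\<Sum>z\<in>N. \<alpha> z * local_lagrange p K z y) = (if y \<in> N then \<alpha> y else 0)"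
        using N(1) by (intro local_lagrange_sum_at_node[OF p _ K y]) blast
      also have "\<dots> = W K y"
        using a[OF K yK] N(2)[OF K y] conforming_boundary[OF W K yK] by auto
      finally show "W K y - (\<Sum>z\<in>N. \<alpha> z * local_lagrange p K z y) = 0" by simp
    qed
    then show ?thesis by simp
  qed
  then show ?thesis by (rule that)
qed

end

section \<open>Directed edges\<close>

text \<open>Every edge is directed counterclockwise, with the triangle on its left.\<close>

definition dedges :: "(real^2) set \<Rightarrow> ((real^2) \<times> (real^2)) set" where
  "dedges K = {(u, v). \<exists>w. tri u v w K}"

lemma tri_orient: "tri u v w K \<Longrightarrow> \<not> tri v u w' K"
proof
  assume t: "tri u v w K" and t': "tri v u w' K"
  have "{u, v, w} = {v, u, w'}" using tri_verts[OF t] tri_verts[OF t'] by simp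
  then have "w = w'" using tri_distinct[OF t] tri_distinct[OF t'] by auto
  moreover have "det2 (u - v) (w - v) = - det2 (v - u) (w - u)" by (simp add: det2_def algebra_simps)
  ultimately show False using t t' by (simp add: tri_def)
qed

lemma dedges_tri:
  assumes t: "tri a b c K" shows "dedges K = {(a, b), (b, c), (c, a)}"
proof
  show "{(a, b), (b, c), (c, a)} \<subseteq> dedges K"
    unfolding dedges_def using t tri_rot[OF t] tri_rot[OF tri_rot[OF t]] by blast
  show "dedges K \<subseteq> {(a, b), (b, c), (c, a)}"
  proof
    fix e assume "e \<in> dedges K"
    then obtain u v w where e: "e = (u, v)" and t': "tri u v w K" unfolding dedges_def by blast
    have uv: "u \<in> {a, b, c}" "v \<in> {a, b, c}" "u \<noteq> v"
      using tri_verts[OF t] tri_verts[OF t'] tri_distinct[OF t'] by auto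
    have no: "\<not> tri b a w K" "\<not> tri c b w K" "\<not> tri a c w K"
      using tri_orient t tri_rot[OF t] tri_rot[OF tri_rot[OF t]] by blast+
    show "e \<in> {(a, b), (b, c), (c, a)}"
      using uv t' no by (auto simp: e)
  qed
qed

lemma sum_dedges:
  assumes t: "tri a b c K"
  shows "(\<Sum>(u,v)\<in>dedges K. f u v) = f a b + f b c + f c a"
  using tri_distinct[OF t] unfolding dedges_tri[OF t] by (simp add: ac_simps)

context triangulation
begin

lemma finite_dedges: "K \<in> T \<Longrightarrow> finite (dedges K)"
  by (erule triE) (simp add: dedges_tri)

lemma dedges_verts:
  assumes "(u, v) \<in> dedges K" shows "u \<noteq> v" "u \<in> verts K" "v \<in> verts K"
proof -
  obtain w where t: "tri u v w K" using assms by (auto simp: dedges_def)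
  show "u \<noteq> v" "u \<in> verts K" "v \<in> verts K" using tri_verts[OF t] tri_distinct[OF t] by auto
qed

lemma dedge_unique:
  assumes "K \<in> T" "K' \<in> T" "(u, v) \<in> dedges K" "(u, v) \<in> dedges K'" shows "K = K'"
proof (rule ccontr)
  assume ne: "K \<noteq> K'"
  obtain w where t: "tri u v w K" using assms(3) by (auto simp: dedges_def)
  obtain w' where t': "tri u v w' K'" using assms(4) by (auto simp: dedges_def)
  have "{u, v} \<subseteq> verts K'" using tri_verts[OF t'] by simp
  then obtain w'' where "tri v u w'' K'" using shared_opposite[OF t assms(1,2) ne] by blast
  then show False using tri_orient t' by blast
qed

lemma dedge_opposite:
  assumes "(u, v) \<in> dedges K" "shared K K' u v" shows "(v, u) \<in> dedges K'"
proof -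
  obtain w where t: "tri u v w K" using assms(1) by (auto simp: dedges_def)
  obtain w' where "tri v u w' K'" using shared_opposite[OF t] assms(2) unfolding shared_def by blast
  then show ?thesis by (auto simp: dedges_def)
qed

lemma dedge_exists:
  assumes "K \<in> T" "u \<noteq> v" "u \<in> verts K" "v \<in> verts K"
  shows "(u, v) \<in> dedges K \<or> (v, u) \<in> dedges K"
proof -
  obtain a b c where "tri a b c K" using triE[OF assms(1)] .
  then show ?thesis using tri_ordered[of a b c K u v] assms by (auto simp: dedges_def)
qed

text \<open>
  Exchanging the two sides of every shared edge is an involution of the directed edges that
  changes the sign of the sum.
\<close>

lemma sum_dedges_cancel:
  fixes h :: "(real^2) set \<Rightarrow> real^2 \<Rightarrow> real^2 \<Rightarrow> complex"
  assumes b: "\<And>K u v. bedge K u v \<Longrightarrow> h K u v = 0"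
    and s: "\<And>K K' u v. shared K K' u v \<Longrightarrow> h K' v u = - h K u v"
  shows "(\<Sum>K\<in>T. \<Sum>(u,v)\<in>dedges K. h K u v) = 0"
proof -
  define F where "F = Sigma T dedges"
  \<comment> \<open>The triangle on the other side of a shared edge.\<close>
  define nb where "nb = (\<lambda>K u v. SOME K'. shared K K' u v)"
  define \<sigma> where "\<sigma> = (\<lambda>(K, u, v). if bedge K u v then (K, u, v) else (nb K u v, v, u))"
  have nb: "shared K (nb K u v) u v" if "K \<in> T" "(u, v) \<in> dedges K" "\<not> bedge K u v" for K u v
  proof -
    have "\<exists>K'. shared K K' u v"
      using dedges_verts[OF that(2)] that(1,3) by (meson edge_cases)
    then show ?thesis unfolding nb_def by (rule someI_ex)
  qed
  have inv: "\<sigma> x \<in> F \<and> \<sigma> (\<sigma> x) = x \<and> (case \<sigma> x of (K, u, v) \<Rightarrow> h K u v) = - (case x of (K, u, v) \<Rightarrow> h K u v)"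
    if x: "x \<in> F" for x
  proof -
    obtain K u v where x': "x = (K, u, v)" "K \<in> T" "(u, v) \<in> dedges K" using x unfolding F_def by auto
    show ?thesis
    proof (cases "bedge K u v")
      case True
      then show ?thesis using x x' b by (simp add: \<sigma>_def)
    next
      case False
      let ?L = "nb K u v"
      have sh: "shared K ?L u v" by (rule nb[OF x'(2,3) False])
      then have L: "?L \<in> T" by (simp add: shared_def)
      have vu: "(v, u) \<in> dedges ?L" by (rule dedge_opposite[OF x'(3) sh])
      have nb': "\<not> bedge ?L v u" using sh unfolding bedge_def shared_def by auto
      have sh': "shared ?L (nb ?L v u) v u" by (rule nb[OF L vu nb'])
      have "(u, v) \<in> dedges (nb ?L v u)" by (rule dedge_opposite[OF vu sh'])
      moreover have "nb ?L v u \<in> T" using sh' by (simp add: shared_def)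
      ultimately have "K = nb ?L v u" by (intro dedge_unique[OF x'(2) _ x'(3)])
      then have "nb ?L v u = K" by (rule sym)
      then show ?thesis using x' False nb' L vu s[OF sh] by (simp add: \<sigma>_def F_def)
    qed
  qed
  let ?h = "\<lambda>x. case x of (K, u, v) \<Rightarrow> h K u v"
  have "(\<Sum>K\<in>T. \<Sum>(u,v)\<in>dedges K. h K u v) = sum ?h F"
    unfolding F_def using finite_dedges by (subst sum.Sigma) auto
  also have "sum ?h F = (\<Sum>x\<in>F. ?h (\<sigma> x))"
    by (rule sum.reindex_bij_witness[of F \<sigma> \<sigma>]) (use inv in auto)
  also have "\<dots> = - sum ?h F"
    unfolding sum_negf[symmetric] by (rule sum.cong) (use inv in auto)
  finally have "sum ?h F = - sum ?h F"
    using \<open>(\<Sum>K\<in>T. \<Sum>(u,v)\<in>dedges K. h K u v) = sum ?h F\<close> by simp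
  then have "sum ?h F = 0" by (metis add.inverse_inverse eq_neg_iff_add_eq_0 mult_2 mult_eq_0_iff zero_neq_numeral)
  then show ?thesis using \<open>(\<Sum>K\<in>T. \<Sum>(u,v)\<in>dedges K. h K u v) = sum ?h F\<close> by simp
qed

end

section \<open>The angle under which an edge is seen\<close>

definition cx :: "real^2 \<Rightarrow> complex" where
  "cx x = Complex (x$1) (x$2)"

lemma cx_simps: "cx (x + y) = cx x + cx y" "cx (x - y) = cx x - cx y" "cx (r *\<^sub>R x) = of_real r * cx x"
  "cx 0 = 0"
  by (simp_all add: cx_def complex_eq_iff)

lemma cx_eq_iff: "cx x = cx y \<longleftrightarrow> x = y"
  by (simp add: cx_def vec2_eq_iff)

lemma cx_perp: "cx (perp u) = \<i> * cx u"
  by (simp add: cx_def perp_def complex_eq_iff)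

lemma linear_cx: "linear cx"
  by (rule linearI) (simp_all add: cx_def complex_eq_iff)

lemma continuous_on_cx: "continuous_on S f \<Longrightarrow> continuous_on S (\<lambda>x. cx (f x))"
  using continuous_on_compose2[OF linear_continuous_on[of cx UNIV] _ subset_UNIV]
    linear_cx linear_conv_bounded_linear by blast

text \<open>
  The imaginary part is the angle under which the edge from \<open>u\<close> to \<open>v\<close> is seen from \<open>z\<close>. The quotient is
  a nonpositive real number only on the segment itself, so the branch cut of \<open>Ln\<close> is met only there.
\<close>

definition edge_angle :: "real^2 \<Rightarrow> real^2 \<Rightarrow> complex \<Rightarrow> complex" where
  "edge_angle u v z = Ln ((cx v - z) / (cx u - z))"

lemma quotient_nonpos:
  assumes x: "x \<notin> closed_segment u v"
  shows "(cx v - cx x) / (cx u - cx x) \<notin> \<real>\<^sub>\<le>\<^sub>0"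
proof
  assume "(cx v - cx x) / (cx u - cx x) \<in> \<real>\<^sub>\<le>\<^sub>0"
  then obtain r where r: "(cx v - cx x) / (cx u - cx x) = of_real r" "r \<le> 0" by (rule nonpos_Reals_cases)
  have "x \<noteq> u" using x by auto
  then have "cx u - cx x \<noteq> 0" by (simp add: cx_eq_iff)
  then have "cx v - cx x = of_real r * (cx u - cx x)" using r(1) by (simp add: divide_eq_eq)
  then have "cx (v - x) = cx (r *\<^sub>R (u - x))" by (simp add: cx_simps)
  then have "v - x = r *\<^sub>R (u - x)" by (simp only: cx_eq_iff)
  then have "(1 - r) *\<^sub>R x = v - r *\<^sub>R u" by (simp add: algebra_simps)
  then have "(1 / (1 - r)) *\<^sub>R ((1 - r) *\<^sub>R x) = (1 / (1 - r)) *\<^sub>R (v - r *\<^sub>R u)" by simp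
  then have "x = (1 / (1 - r)) *\<^sub>R (v - r *\<^sub>R u)" using r(2) by simp
  also have "\<dots> = (1 - 1 / (1 - r)) *\<^sub>R u + (1 / (1 - r)) *\<^sub>R v"
  proof -
    have "1 - 1 / (1 - r) = - r / (1 - r)" using r(2) by (simp add: field_simps)
    then show ?thesis by (simp add: scaleR_diff_right)
  qed
  finally have "x \<in> closed_segment u v"
    using r(2) unfolding in_segment by (intro exI[of _ "1 / (1 - r)"]) simp
  then show False using x by simp
qed

lemma edge_angle_derivative:
  assumes x: "x \<notin> closed_segment u v"
  shows "(edge_angle u v has_field_derivative (1 / (cx x - cx v) - 1 / (cx x - cx u))) (at (cx x))"
proof -
  have ne: "cx u - cx x \<noteq> 0" "cx v - cx x \<noteq> 0" using x by (auto simp: cx_eq_iff)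
  let ?w = "\<lambda>z. (cx v - z) / (cx u - z)"
  have 1: "(?w has_field_derivative (cx v - cx u) / ((cx u - cx x) * (cx u - cx x))) (at (cx x))"
    using ne by (auto intro!: derivative_eq_intros simp: field_simps)
  have "((\<lambda>z. Ln (?w z)) has_field_derivative inverse (?w (cx x)) * ((cx v - cx u) / ((cx u - cx x) * (cx u - cx x)))) (at (cx x))"
    by (rule DERIV_chain2[OF has_field_derivative_Ln[OF quotient_nonpos[OF x]] 1])
  moreover have "inverse (?w (cx x)) * ((cx v - cx u) / ((cx u - cx x) * (cx u - cx x)))
     = 1 / (cx x - cx v) - 1 / (cx x - cx u)"
  proof -
    have "inverse (b / a) * ((b - a) / (a * a)) = 1 / (- b) - 1 / (- a)" if "a \<noteq> 0" "b \<noteq> 0" for a b :: complex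
      using that by (simp add: field_simps)
    from this[OF ne] show ?thesis by simp
  qed
  ultimately show ?thesis by (simp add: edge_angle_def[abs_def])
qed

text \<open>The difference takes its values in the discrete set of periods of \<open>exp\<close>.\<close>

lemma continuous_log_unique:
  fixes f g :: "'a::topological_space \<Rightarrow> complex"
  assumes S: "connected S" and c: "continuous_on S f" "continuous_on S g"
    and e: "\<And>x. x \<in> S \<Longrightarrow> exp (f x) = exp (g x)" and x0: "x0 \<in> S" "f x0 = g x0" and x: "x \<in> S"
  shows "f x = g x"
proof -
  have "(\<lambda>x. f x - g x) constant_on S"
  proof (rule continuous_discrete_range_constant[OF S])
    show "continuous_on S (\<lambda>x. f x - g x)" by (intro continuous_intros c)
    fix x assume x: "x \<in> S"
    have "2 * pi \<le> norm ((f y - g y) - (f x - g x))" if y: "y \<in> S" "f y - g y \<noteq> f x - g x" for y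
    proof -
      have "exp (f y - g y) = exp (f x - g x)" using e x y by (simp add: exp_diff)
      then have "\<not> \<bar>Im (f y - g y) - Im (f x - g x)\<bar> < 2 * pi" using y(2) exp_complex_eqI by blast
      moreover have "\<bar>Im ((f y - g y) - (f x - g x))\<bar> \<le> norm ((f y - g y) - (f x - g x))" by (rule abs_Im_le_cmod)
      ultimately show ?thesis by simp
    qed
    then show "\<exists>e>0. \<forall>y. y \<in> S \<and> f y - g y \<noteq> f x - g x \<longrightarrow> e \<le> norm ((f y - g y) - (f x - g x))"
      by (intro exI[of _ "2 * pi"]) simp
  qed
  then obtain k where k: "\<forall>x\<in>S. f x - g x = k" unfolding constant_on_def by (elim exE)
  have "k = 0" using bspec[OF k x0(1)] x0(2) by simp
  then show ?thesis using bspec[OF k x] by simp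
qed

text \<open>
  As functions of the endpoint \<open>v\<close> both sides are continuous logarithms of the same quotient that
  vanish for \<open>v = u\<close>.
\<close>

lemma edge_angle_eq_log_difference:
  assumes L: "continuous_on (closed_segment u v) L" "\<And>y. y \<in> closed_segment u v \<Longrightarrow> exp (L y) = c * (cx y - cx x)"
    and x: "x \<notin> closed_segment u v"
  shows "edge_angle u v (cx x) = L v - L u"
proof -
  have u: "u \<in> closed_segment u v" and v: "v \<in> closed_segment u v" by auto
  have sub: "x \<notin> closed_segment u y" if "y \<in> closed_segment u v" for y
    using x subset_closed_segment that u by blast
  have "(\<lambda>y. edge_angle u y (cx x)) v = (\<lambda>y. L y - L u) v"
  proof (rule continuous_log_unique[OF _ _ _ _ u _ v])
    show "connected (closed_segment u v)" by (rule connected_segment)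
    show "continuous_on (closed_segment u v) (\<lambda>y. edge_angle u y (cx x))"
      unfolding edge_angle_def
    proof (rule continuous_on_Ln')
      have "cx u - cx x \<noteq> 0" using x u by (auto simp: cx_eq_iff)
      then show "continuous_on (closed_segment u v) (\<lambda>y. (cx y - cx x) / (cx u - cx x))"
        by (intro continuous_intros continuous_on_cx) auto
      show "(cx y - cx x) / (cx u - cx x) \<notin> \<real>\<^sub>\<le>\<^sub>0" if "y \<in> closed_segment u v" for y
        by (rule quotient_nonpos[OF sub[OF that]])
    qed
    show "continuous_on (closed_segment u v) (\<lambda>y. L y - L u)" by (intro continuous_intros L(1))
    show "exp (edge_angle u y (cx x)) = exp (L y - L u)" if y: "y \<in> closed_segment u v" for y
    proof -
      have ne: "cx y - cx x \<noteq> 0" "cx u - cx x \<noteq> 0" using x y u by (auto simp: cx_eq_iff)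
      then have "exp (edge_angle u y (cx x)) = (cx y - cx x) / (cx u - cx x)" by (simp add: edge_angle_def exp_Ln)
      moreover have "c \<noteq> 0" using L(2)[OF u] by auto
      ultimately show ?thesis using ne by (simp add: exp_diff L(2)[OF y] L(2)[OF u])
    qed
    have "cx u - cx x \<noteq> 0" using x u by (auto simp: cx_eq_iff)
    then show "edge_angle u u (cx x) = L u - L u" by (simp add: edge_angle_def)
  qed
  then show ?thesis by simp
qed

text \<open>
  Just left of the edge the quotient under the logarithm approaches \<open>-1\<close> from the upper half plane,
  just right of it from the lower one.
\<close>

lemma edge_angle_jump:
  assumes ne: "u \<noteq> v"
  defines "m \<equiv> midpoint u v"
  shows "((\<lambda>e. edge_angle u v (cx (m + e *\<^sub>R perp (v - u))) - edge_angle u v (cx (m - e *\<^sub>R perp (v - u))))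
     \<longlongrightarrow> 2 * of_real pi * \<i>) (at_right 0)"
proof -
  \<comment> \<open>\<open>- s e\<close> is the quotient at distance proportional to \<open>e\<close> from the midpoint; \<open>s\<close> tends to \<open>1\<close>,
      where the logarithm is continuous, and the sign of its imaginary part selects the branch.\<close>
  define s where "s = (\<lambda>e::real. (1 - 2 * \<i> * of_real e) / (1 + 2 * \<i> * of_real e))"
  define H where "H = (cx v - cx u) / 2"
  have H: "H \<noteq> 0" using ne by (simp add: H_def cx_eq_iff)
  have m: "cx m = cx u + H" "cx m = cx v - H"
    by (simp_all add: m_def H_def midpoint_def cx_simps field_simps)
  have n: "cx (perp (v - u)) = 2 * \<i> * H" by (simp add: cx_perp H_def cx_simps)
  have nz: "1 + 2 * \<i> * of_real e \<noteq> 0" "1 - 2 * \<i> * of_real e \<noteq> 0" for e :: real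
    by (simp_all add: complex_eq_iff)
  have quot: "(cx v - cx (m + e *\<^sub>R perp (v - u))) / (cx u - cx (m + e *\<^sub>R perp (v - u))) = - s e" for e
  proof -
    have "cx v - cx (m + e *\<^sub>R perp (v - u)) = H * (1 - 2 * \<i> * of_real e)"
      using m(2) by (simp add: cx_simps n algebra_simps)
    moreover have "cx u - cx (m + e *\<^sub>R perp (v - u)) = - (H * (1 + 2 * \<i> * of_real e))"
      using m(1) by (simp add: cx_simps n algebra_simps)
    ultimately show ?thesis using H by (simp add: s_def)
  qed
  have s_eq: "s e = of_real (1 / (1 + 4 * e\<^sup>2)) * (1 - 2 * \<i> * of_real e)\<^sup>2" for e
  proof -
    have "(1 + 2 * \<i> * of_real e) * (1 - 2 * \<i> * of_real e) = of_real (1 + 4 * e\<^sup>2)"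
      by (simp add: complex_eq_iff power2_eq_square algebra_simps)
    then have "s e = (1 - 2 * \<i> * of_real e)\<^sup>2 / of_real (1 + 4 * e\<^sup>2)"
      unfolding s_def using nz[of e] by (metis (no_types) mult.commute nonzero_mult_divide_mult_cancel_right power2_eq_square)
    then show ?thesis by simp
  qed
  have Im: "Im (s e) = - 4 * e / (1 + 4 * e\<^sup>2)" for e
    unfolding s_eq by (simp add: power2_eq_square)
  have s0: "s e \<noteq> 0" for e using nz by (simp add: s_def)
  have pos: "edge_angle u v (cx (m + e *\<^sub>R perp (v - u))) = Ln (s e) + \<i> * of_real pi" if "e > 0" for e
  proof -
    have "Im (s e) < 0" unfolding Im using that by (simp add: divide_neg_pos add_pos_nonneg)
    then show ?thesis unfolding edge_angle_def quot using Ln_minus[OF s0[of e]] by simp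
  qed
  have neg: "edge_angle u v (cx (m - e *\<^sub>R perp (v - u))) = Ln (s (- e)) - \<i> * of_real pi" if "e > 0" for e
  proof -
    have "Im (s (- e)) > 0" unfolding Im using that by (simp add: divide_pos_pos add_pos_nonneg)
    moreover have eq: "m - e *\<^sub>R perp (v - u) = m + (- e) *\<^sub>R perp (v - u)" by simp
    ultimately show ?thesis unfolding edge_angle_def eq quot using Ln_minus[OF s0[of "- e"]] by simp
  qed
  have lim: "((\<lambda>e. s (f e)) \<longlongrightarrow> 1) (at_right 0)" if "(f \<longlongrightarrow> 0) (at_right 0)" for f :: "real \<Rightarrow> real"
  proof -
    have "((\<lambda>e. s (f e)) \<longlongrightarrow> (1 - 2 * \<i> * of_real 0) / (1 + 2 * \<i> * of_real 0)) (at_right 0)"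
      unfolding s_def by (intro tendsto_intros that) simp
    then show ?thesis by simp
  qed
  have "((\<lambda>e. (Ln (s e) + \<i> * of_real pi) - (Ln (s (- e)) - \<i> * of_real pi))
     \<longlongrightarrow> (Ln 1 + \<i> * of_real pi) - (Ln 1 - \<i> * of_real pi)) (at_right 0)"
    by (intro tendsto_intros lim tendsto_Ln) (auto intro!: tendsto_eq_intros)
  then have l: "((\<lambda>e. (Ln (s e) + \<i> * of_real pi) - (Ln (s (- e)) - \<i> * of_real pi)) \<longlongrightarrow> 2 * of_real pi * \<i>) (at_right 0)"
    by (simp add: algebra_simps)
  have "\<forall>\<^sub>F e in at_right 0. (Ln (s e) + \<i> * of_real pi) - (Ln (s (- e)) - \<i> * of_real pi)
     = edge_angle u v (cx (m + e *\<^sub>R perp (v - u))) - edge_angle u v (cx (m - e *\<^sub>R perp (v - u)))"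
    using eventually_at_right_less[of 0] by eventually_elim (simp add: pos neg)
  then show ?thesis using l by (simp add: tendsto_cong)
qed

lemma edge_angle_no_jump:
  assumes m: "m \<notin> closed_segment u v"
  shows "((\<lambda>e. edge_angle u v (cx (m + e *\<^sub>R n)) - edge_angle u v (cx (m - e *\<^sub>R n))) \<longlongrightarrow> 0) (at_right 0)"
proof -
  have c: "isCont (edge_angle u v) (cx m)" using edge_angle_derivative[OF m] DERIV_isCont by blast
  have "((\<lambda>e. cx (m + e *\<^sub>R n)) \<longlongrightarrow> cx m) (at_right 0)" "((\<lambda>e. cx (m - e *\<^sub>R n)) \<longlongrightarrow> cx m) (at_right 0)"
    unfolding cx_simps by (auto intro!: tendsto_eq_intros)
  from isCont_tendsto_compose[OF c this(1)] isCont_tendsto_compose[OF c this(2)]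
  show ?thesis by (auto intro: tendsto_eq_intros)
qed


section \<open>Exactness of closed cochains on a simply connected domain\<close>

context triangulation
begin

lemma edge_interior_disjoint:
  assumes K: "K \<in> T" "u \<in> verts K" "v \<in> verts K" "u \<noteq> v" and L: "L \<in> T"
  shows "closed_segment u v \<inter> interior L = {}"
proof (cases "K = L")
  case False
  have "closed_segment u v \<subseteq> K" using edge_subset_triangle[OF K(1-3)] by blast
  then show ?thesis using triangle_intersection(3)[OF L K(1)] False by blast
next
  case True
  obtain a b c where t: "tri a b c K" using triE[OF K(1)] .
  have "closed_segment u v \<in> {closed_segment a b, closed_segment b c, closed_segment c a}"
    using K tri_distinct[OF t] unfolding tri_verts[OF t] by (auto simp: closed_segment_commute)
  then have E: "closed_segment u v edge_of K" using tri_edge_iff[OF t] by blast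
  obtain a' b' where ab: "closed_segment u v = closed_segment a' b'" "verts K \<inter> closed_segment u v = {a', b'}"
    using tri_edge_verts[OF t E] by metis
  have "closed_segment u v \<noteq> K"
  proof
    assume "closed_segment u v = K"
    then have "verts K = {a', b'}" using ab(2) verts_subset by blast
    then show False using triangle_facts(5)[OF K(1)] card_insert_le_m1[of 2 "{b'}" a'] by simp
  qed
  then show ?thesis
    using E face_of_disjoint_interior unfolding edge_of_def True by blast
qed

lemma other_edge_midpoint:
  assumes K: "K \<in> T" "(a, b) \<in> dedges K" and L: "L \<in> T" "(u, v) \<in> dedges L"
    and m: "midpoint a b \<in> closed_segment u v"
  shows "(u, v) = (a, b) \<or> (u, v) = (b, a)"
proof -
  note Kv = dedges_verts[OF K(2)] and Lv = dedges_verts[OF L(2)]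
  have mo: "midpoint a b \<in> open_segment a b" using Kv(1) by simp
  have mL: "midpoint a b \<in> L" using edge_subset_triangle[OF L(1) Lv(2,3) m] .
  have ab: "a \<in> verts L" "b \<in> verts L" using edge_of_incident_triangle[OF mo Kv(1) _ K(1) L(1) mL] Kv by auto
  obtain t where t: "midpoint a b = linepath u v t" using linepath_of_segment[OF m] by (elim exE)
  have mab: "midpoint a b = linepath a b (1/2)" by (simp add: midpoint_def linepath_def scaleR_add_right)
  have in_uv: "w = u \<or> w = v" if w: "w = a \<or> w = b" for w
  proof (rule ccontr)
    assume n: "\<not> (w = u \<or> w = v)"
    have wL: "w \<in> verts L" using w ab by blast
    have "bary L w (midpoint a b) = 0" unfolding t bary_linepath[OF L(1) wL]
      using n bary_at[OF L(1) wL] Lv by auto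
    moreover have "bary L w (midpoint a b) = 1 / 2" unfolding mab bary_linepath[OF L(1) wL]
      using w Kv(1) bary_at[OF L(1) wL ab(1)] bary_at[OF L(1) wL ab(2)] by auto
    ultimately show False by simp
  qed
  show ?thesis using in_uv[of a] in_uv[of b] Kv(1) by auto
qed

context
  fixes q :: "(real^2) set \<Rightarrow> real^2 \<Rightarrow> real"
  assumes q_shared: "\<And>K K' u v. shared K K' u v \<Longrightarrow> q K u - q K' u = q K v - q K' v"
    and q_bdry: "\<And>K u v. bedge K u v \<Longrightarrow> q K u = q K v"
begin

text \<open>
  The jump of \<open>q\<close> across a shared edge is the same at both endpoints, so it equals the jump of the means.
  The mean has the advantage over the value at one endpoint that it does not depend on the
  direction of the edge.
\<close>

definition edge_weight :: "(real^2) set \<Rightarrow> real^2 \<Rightarrow> real^2 \<Rightarrow> complex" where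
  "edge_weight K u v = of_real ((q K u + q K v) / 2)"

text \<open>
  This expresses that the weighted edges form a cycle. Summation by parts on each triangle leaves
  \<open>q K v * g K v - q K u * g K u\<close>, which telescopes around the triangle, and a remainder that changes
  sign with the direction of the edge. Allowing \<open>g\<close> to depend on the triangle, and not only on the
  vertex, keeps apart the parts of \<open>\<Omega>\<close> that touch in a vertex on the frontier.
\<close>

lemma edge_weight_cancel:
  assumes g: "\<And>K K' u v. shared K K' u v \<Longrightarrow> g K u = g K' u"
  shows "(\<Sum>K\<in>T. \<Sum>(u,v)\<in>dedges K. edge_weight K u v * (g K v - g K u)) = 0"
proof -
  let ?r = "\<lambda>K u v. of_real ((q K u - q K v) / 2) * (g K u + g K v)"
  let ?t = "\<lambda>K u. of_real (q K u) * g K u"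
  have "(\<Sum>(u,v)\<in>dedges K. ?t K v - ?t K u) = 0" if "K \<in> T" for K
    using that by (rule triE) (simp add: sum_dedges)
  moreover have "edge_weight K u v * (g K v - g K u) = (?t K v - ?t K u) + ?r K u v" for K u v
    by (simp add: edge_weight_def field_simps)
  ultimately have "(\<Sum>K\<in>T. \<Sum>(u,v)\<in>dedges K. edge_weight K u v * (g K v - g K u))
     = (\<Sum>K\<in>T. \<Sum>(u,v)\<in>dedges K. ?r K u v)"
    by (simp add: case_prod_unfold sum.distrib)
  also have "\<dots> = 0"
  proof (rule sum_dedges_cancel)
    show "?r K u v = 0" if "bedge K u v" for K u v using q_bdry[OF that] by simp
    show "?r K' v u = - ?r K u v" if s: "shared K K' u v" for K K' u v
    proof -
      have "q K' v - q K' u = - (q K u - q K v)" using q_shared[OF s] by simp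
      then have e: "(q K' v - q K' u) / 2 = - ((q K u - q K v) / 2)" by (simp only: minus_divide_left)
      have g': "g K' u = g K u" "g K' v = g K v" using g[OF s] g[OF shared_sym(2)[OF s]] by simp_all
      show ?thesis unfolding e g' by (simp only: of_real_minus mult_minus_left add.commute)
    qed
  qed
  finally show ?thesis .
qed

text \<open>
  The two triangles at a shared edge run through it in opposite directions, so each edge contributes
  its angle times the jump: up to the factor \<open>2 * pi * \<i>\<close> this is the winding number around \<open>z\<close> of the
  weighted cycle of all edges.
\<close>

definition total_angle :: "complex \<Rightarrow> complex" where
  "total_angle z = (\<Sum>K\<in>T. \<Sum>(u,v)\<in>dedges K. edge_weight K u v * edge_angle u v z)"

text \<open>
  The derivative vanishes: it is the sum in \<open>edge_weight_cancel\<close> for the function \<open>1 / (x - u)\<close> of the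
  vertices.
\<close>

lemma total_angle_constant:
  assumes L: "L \<in> T" and x: "x \<in> interior L" "y \<in> interior L"
  shows "total_angle (cx x) = total_angle (cx y)"
proof -
  have "(total_angle has_field_derivative 0) (at (cx x))" if x: "x \<in> interior L" for x
  proof -
    have n: "x \<notin> closed_segment u v" if "K \<in> T" "(u, v) \<in> dedges K" for K u v
      using edge_interior_disjoint[OF that(1) _ _ _ L, of u v] dedges_verts[OF that(2)] x by blast
    have "(total_angle has_field_derivative
       (\<Sum>K\<in>T. \<Sum>e\<in>dedges K. edge_weight K (fst e) (snd e) * (1 / (cx x - cx (snd e)) - 1 / (cx x - cx (fst e))))) (at (cx x))"
      unfolding total_angle_def[abs_def] case_prod_unfold
      by (intro DERIV_sum DERIV_cmult edge_angle_derivative n) auto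
    moreover have "(\<Sum>K\<in>T. \<Sum>e\<in>dedges K. edge_weight K (fst e) (snd e) * (1 / (cx x - cx (snd e)) - 1 / (cx x - cx (fst e)))) = 0"
      using edge_weight_cancel[of "\<lambda>K u. 1 / (cx x - cx u)"] by (simp add: case_prod_unfold)
    ultimately show ?thesis by simp
  qed
  then have "\<exists>c. \<forall>z\<in>cx ` interior L. total_angle z = c"
    using triangle_facts(2)[OF L]
    by (intro has_field_derivative_zero_constant convex_linear_image[OF linear_cx] convex_interior)
       (auto intro: has_field_derivative_at_within)
  then show ?thesis using x by auto
qed

text \<open>
  A continuous logarithm of \<open>y - x\<close> on \<open>\<Omega>\<close> extends continuously to each closed triangle, and the
  extensions agree on shared edges, where they are determined by the points in \<open>\<Omega>\<close>. The angles are
  differences of these extensions, so \<open>edge_weight_cancel\<close> applies.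
\<close>

lemma total_angle_outside:
  assumes sc: "simply_connected \<Omega>" and x: "x \<notin> \<Union>T"
  shows "total_angle (cx x) = 0"
proof -
  have ne: "cx y - cx x \<noteq> 0" if "y \<in> \<Omega>" for y using that x Omega_subset by (auto simp: cx_eq_iff)
  have "continuous_on \<Omega> (\<lambda>y. cx y - cx x)" by (intro continuous_intros continuous_on_cx)
  then obtain l where l: "continuous_on \<Omega> l" "\<And>y. y \<in> \<Omega> \<Longrightarrow> cx y - cx x = exp (l y)"
    using continuous_logarithm_on_simply_connected[OF _ sc open_imp_locally_path_connected[OF open_Omega]] ne
    by blast
  define g where "g = (\<lambda>K::(real^2) set. SOME y. y \<in> interior K)"
  have g: "g K \<in> interior K" if "K \<in> T" for K
    using triangle_facts(3)[OF that] unfolding g_def by (simp add: some_in_eq)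
  \<comment> \<open>The logarithm of \<open>y - x\<close> on the closed triangle \<open>K\<close> that agrees with \<open>l\<close> at \<open>g K\<close>.\<close>
  define M where "M = (\<lambda>K y. l (g K) + edge_angle (g K) y (cx x))"
  have seg: "x \<notin> closed_segment (g K) y" if K: "K \<in> T" "y \<in> K" for K y
  proof -
    have "closed_segment (g K) y \<subseteq> K"
      using g[OF K(1)] interior_subset K triangle_facts(2)[OF K(1)] by (intro closed_segment_subset) auto
    then show ?thesis using x K(1) by blast
  qed
  have gx: "cx (g K) - cx x \<noteq> 0" if "K \<in> T" for K
    using ne g[OF that] interior_subset_Omega[OF that] by blast
  have Mc: "continuous_on K (M K)" if K: "K \<in> T" for K
    unfolding M_def edge_angle_def
    using quotient_nonpos[OF seg[OF K]] gx[OF K]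
    by (intro continuous_intros continuous_on_cx continuous_on_Ln') auto
  have Me: "exp (M K y) = cx y - cx x" if K: "K \<in> T" "y \<in> K" for K y
  proof -
    have "cx y - cx x \<noteq> 0" using K x by (auto simp: cx_eq_iff)
    moreover have "exp (l (g K)) = cx (g K) - cx x"
      using l(2)[of "g K"] g[OF K(1)] interior_subset_Omega[OF K(1)] by auto
    ultimately show ?thesis using gx[OF K(1)] by (simp add: M_def edge_angle_def exp_add exp_Ln)
  qed
  have Ml: "M K y = l y" if K: "K \<in> T" "y \<in> K" "y \<in> \<Omega>" for K y
  proof -
    have "open_segment (g K) y \<subseteq> interior K"
      using in_interior_closure_convex_segment[OF triangle_facts(2)[OF K(1)] g[OF K(1)]] K(2) closure_subset by blast
    then have sub: "closed_segment (g K) y \<subseteq> K \<inter> \<Omega>"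
      unfolding closed_segment_eq_open using g[OF K(1)] K interior_subset interior_subset_Omega[OF K(1)] by blast
    have 1: "continuous_on (closed_segment (g K) y) (M K)" using Mc[OF K(1)] sub continuous_on_subset by blast
    have 2: "continuous_on (closed_segment (g K) y) l" using l(1) sub continuous_on_subset by blast
    have 3: "exp (M K z) = exp (l z)" if "z \<in> closed_segment (g K) y" for z
    proof -
      have "z \<in> K" "z \<in> \<Omega>" using that sub by blast+
      then show ?thesis using Me[OF K(1), of z] l(2)[of z] by simp
    qed
    have 4: "M K (g K) = l (g K)" using gx[OF K(1)] by (simp add: M_def edge_angle_def)
    show ?thesis
      by (rule continuous_log_unique[OF connected_segment 1 2 3 _ 4]) auto
  qed
  have Ms: "M K u = M K' u" if s: "shared K K' u v" for K K' u v
  proof -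
    have K: "K \<in> T" "K' \<in> T" "K \<noteq> K'" "u \<noteq> v" "{u, v} \<subseteq> verts K" "{u, v} \<subseteq> verts K'"
      using s by (simp_all add: shared_def)
    have sub: "closed_segment u v \<subseteq> K" "closed_segment u v \<subseteq> K'"
      using edge_subset_triangle K by (meson insert_subset subsetI)+
    have "M K u - M K' u = 0"
    proof (rule continuous_constant_on_closure[of "open_segment u v" "\<lambda>y. M K y - M K' y"])
      show "continuous_on (closure (open_segment u v)) (\<lambda>y. M K y - M K' y)"
        using K(4) Mc[OF K(1)] Mc[OF K(2)] sub continuous_on_subset
        by (auto intro!: continuous_intros)
      show "M K y - M K' y = 0" if "y \<in> open_segment u v" for y
      proof -
        have "y \<in> \<Omega>" using shared_subset_Omega[OF K] that by blast
        moreover have "y \<in> K" "y \<in> K'" using sub that segment_open_subset_closed by blast+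
        ultimately show ?thesis using Ml K by simp
      qed
      show "u \<in> closure (open_segment u v)" using K(4) by simp
    qed
    then show ?thesis by simp
  qed
  have "edge_angle u v (cx x) = M K v - M K u" if K: "K \<in> T" "(u, v) \<in> dedges K" for K u v
  proof -
    have sub: "closed_segment u v \<subseteq> K"
      using edge_subset_triangle[OF K(1)] dedges_verts[OF K(2)] by blast
    show ?thesis
      by (rule edge_angle_eq_log_difference[where c = 1])
         (use sub Mc[OF K(1)] Me[OF K(1)] x K(1) continuous_on_subset in auto)
  qed
  then have "total_angle (cx x) = (\<Sum>K\<in>T. \<Sum>(u,v)\<in>dedges K. edge_weight K u v * (M K v - M K u))"
    unfolding total_angle_def by (intro sum.cong refl) auto
  then show ?thesis using edge_weight_cancel[of M, OF Ms] by simp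
qed

text \<open>
  All angles are continuous at the midpoint except that of the edge itself, which occurs with a
  positive sign for \<open>K\<close> and with a negative sign for the triangle on the other side, if there is one.
\<close>

lemma total_angle_jump:
  assumes K: "K \<in> T" "(a, b) \<in> dedges K"
  defines "m \<equiv> midpoint a b" and "n \<equiv> perp (b - a)"
  shows "((\<lambda>e. total_angle (cx (m + e *\<^sub>R n)) - total_angle (cx (m - e *\<^sub>R n))) \<longlongrightarrow>
     2 * of_real pi * \<i> * (edge_weight K a b - (\<Sum>K'\<in>T. if (b, a) \<in> dedges K' then edge_weight K' a b else 0))) (at_right 0)"
proof -
  have ne: "a \<noteq> b" using dedges_verts[OF K(2)] by simp
  define J :: "real^2 \<Rightarrow> real^2 \<Rightarrow> complex" where "J = (\<lambda>u v. 2 * of_real pi * \<i> *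
     ((if (u, v) = (a, b) then 1 else 0) - (if (u, v) = (b, a) then 1 else 0)))"
  have J: "((\<lambda>e. edge_angle u v (cx (m + e *\<^sub>R n)) - edge_angle u v (cx (m - e *\<^sub>R n))) \<longlongrightarrow> J u v) (at_right 0)"
    if L: "L \<in> T" "(u, v) \<in> dedges L" for L u v
  proof -
    consider "(u, v) = (a, b)" | "(u, v) = (b, a)" | "m \<notin> closed_segment u v" "(u, v) \<noteq> (a, b)" "(u, v) \<noteq> (b, a)"
      using other_edge_midpoint[OF K L] unfolding m_def by blast
    then show ?thesis
    proof cases
      case 1
      then show ?thesis using edge_angle_jump[OF ne] ne unfolding m_def n_def J_def by simp
    next
      case 2
      have eq: "m - e *\<^sub>R n = midpoint b a + e *\<^sub>R perp (a - b)" "m + e *\<^sub>R n = midpoint b a - e *\<^sub>R perp (a - b)" for e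
        by (simp_all add: m_def n_def perp_def vec2_eq_iff midpoint_def algebra_simps)
      have "((\<lambda>e. - (edge_angle u v (cx (m - e *\<^sub>R n)) - edge_angle u v (cx (m + e *\<^sub>R n)))) \<longlongrightarrow> - (2 * of_real pi * \<i>)) (at_right 0)"
        unfolding eq using 2 edge_angle_jump[of b a] ne by (intro tendsto_minus) simp
      then show ?thesis using 2 ne by (simp add: J_def)
    next
      case 3
      have "J u v = 0" unfolding J_def if_not_P[OF 3(2)] if_not_P[OF 3(3)] by simp
      then show ?thesis using edge_angle_no_jump[OF 3(1), of n] by (simp only:)
    qed
  qed
  have eq: "total_angle (cx (m + e *\<^sub>R n)) - total_angle (cx (m - e *\<^sub>R n))
     = (\<Sum>L\<in>T. \<Sum>x\<in>dedges L. edge_weight L (fst x) (snd x) *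
         (edge_angle (fst x) (snd x) (cx (m + e *\<^sub>R n)) - edge_angle (fst x) (snd x) (cx (m - e *\<^sub>R n))))" for e
    unfolding total_angle_def case_prod_unfold by (simp add: sum_subtractf right_diff_distrib)
  have lim: "((\<lambda>e. total_angle (cx (m + e *\<^sub>R n)) - total_angle (cx (m - e *\<^sub>R n))) \<longlongrightarrow>
     (\<Sum>L\<in>T. \<Sum>x\<in>dedges L. edge_weight L (fst x) (snd x) * J (fst x) (snd x))) (at_right 0)"
    unfolding eq by (intro tendsto_sum tendsto_mult tendsto_const J) auto
  have inner: "(\<Sum>x\<in>dedges L. edge_weight L (fst x) (snd x) * J (fst x) (snd x))
     = 2 * of_real pi * \<i> * ((if L = K then edge_weight K a b else 0) - (if (b, a) \<in> dedges L then edge_weight L a b else 0))"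
    if L: "L \<in> T" for L
  proof -
    have "(\<Sum>x\<in>dedges L. edge_weight L (fst x) (snd x) * J (fst x) (snd x))
      = (\<Sum>x\<in>dedges L. 2 * of_real pi * \<i> * ((if x = (a, b) then edge_weight L a b else 0) - (if x = (b, a) then edge_weight L a b else 0)))"
    proof (intro sum.cong refl)
      fix x assume "x \<in> dedges L"
      have wt_sym: "edge_weight L b a = edge_weight L a b" by (simp add: edge_weight_def add.commute)
      consider "x = (a, b)" | "x = (b, a)" | "x \<noteq> (a, b)" "x \<noteq> (b, a)" by blast
      then show "edge_weight L (fst x) (snd x) * J (fst x) (snd x)
        = 2 * of_real pi * \<i> * ((if x = (a, b) then edge_weight L a b else 0) - (if x = (b, a) then edge_weight L a b else 0))"
      proof cases
        case 1
        then show ?thesis using ne by (simp add: J_def)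
      next
        case 2
        then show ?thesis using ne by (simp add: J_def wt_sym)
      next
        case 3
        then show ?thesis unfolding J_def prod.collapse by simp
      qed
    qed
    also have "\<dots> = 2 * of_real pi * \<i> * ((if (a, b) \<in> dedges L then edge_weight L a b else 0) - (if (b, a) \<in> dedges L then edge_weight L a b else 0))"
      using finite_dedges[OF L] by (simp add: sum_subtractf flip: sum_distrib_left)
    also have "(a, b) \<in> dedges L \<longleftrightarrow> L = K" using dedge_unique[OF L K(1)] K(2) by blast
    finally show ?thesis by auto
  qed
  have "(\<Sum>L\<in>T. \<Sum>x\<in>dedges L. edge_weight L (fst x) (snd x) * J (fst x) (snd x))
     = 2 * of_real pi * \<i> * (edge_weight K a b - (\<Sum>K'\<in>T. if (b, a) \<in> dedges K' then edge_weight K' a b else 0))"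
    using inner K(1) by (simp add: sum_subtractf flip: sum_distrib_left)
  then show ?thesis using lim by simp
qed

text \<open>
  The winding number of the weighted cycle around the points of \<open>interior K\<close> is the value \<open>d K\<close>. The
  restriction to simply connected domains enters through \<open>total_angle_outside\<close> when the edge crossed
  is a boundary edge.
\<close>

lemma simply_connected_exact:
  assumes sc: "simply_connected \<Omega>"
  obtains d where "\<And>K K' u v. shared K K' u v \<Longrightarrow> d K - d K' = q K u - q K' u"
    "\<And>K u v. bedge K u v \<Longrightarrow> d K = q K u"
proof -
  define g where "g = (\<lambda>K::(real^2) set. SOME y. y \<in> interior K)"
  have g: "g K \<in> interior K" if "K \<in> T" for K
    using triangle_facts(3)[OF that] unfolding g_def by (simp add: some_in_eq)
  define D where "D = (\<lambda>K. total_angle (cx (g K)))"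
  have DK: "total_angle (cx x) = D K" if "K \<in> T" "x \<in> interior K" for K x
    unfolding D_def using total_angle_constant[OF that(1,2) g[OF that(1)]] .
  define d where "d = (\<lambda>K. Im (D K) / (2 * pi))"
  have pos: "0 < e \<Longrightarrow> a \<noteq> b \<Longrightarrow> det2 (b - a) (midpoint a b + e *\<^sub>R perp (b - a) - midpoint a b) > 0" for a b e
    by (simp add: det2_perp)
  have left: "\<forall>\<^sub>F e in at_right 0. total_angle (cx (midpoint a b + e *\<^sub>R perp (b - a))) = D K"
    if K: "K \<in> T" "(a, b) \<in> dedges K" for K a b
  proof -
    obtain w where t: "tri a b w K" using K(2) by (auto simp: dedges_def)
    have ne: "a \<noteq> b" using dedges_verts[OF K(2)] by simp
    then have m: "midpoint a b \<in> open_segment a b" by simp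
    show ?thesis
      using eventually_ray[OF tri_half_plane[OF t m], of "perp (b - a)"] eventually_at_right_less[of 0]
      by eventually_elim (use DK[OF K(1)] pos ne in blast)
  qed
  have right_eq: "midpoint a b - e *\<^sub>R perp (b - a) = midpoint b a + e *\<^sub>R perp (a - b)" for a b e
    by (simp add: perp_def vec2_eq_iff midpoint_def algebra_simps)
  have jump: "D K - D' = 2 * of_real pi * \<i> * (edge_weight K a b - (\<Sum>K'\<in>T. if (b, a) \<in> dedges K' then edge_weight K' a b else 0))"
    if K: "K \<in> T" "(a, b) \<in> dedges K"
      and D': "\<forall>\<^sub>F e in at_right 0. total_angle (cx (midpoint a b - e *\<^sub>R perp (b - a))) = D'" for K a b D'
  proof -
    have "\<forall>\<^sub>F e in at_right 0. total_angle (cx (midpoint a b + e *\<^sub>R perp (b - a)))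
       - total_angle (cx (midpoint a b - e *\<^sub>R perp (b - a))) = D K - D'"
      using left[OF K] D' by eventually_elim simp
    from tendsto_cong[OF this] total_angle_jump[OF K]
    have "((\<lambda>e::real. D K - D') \<longlongrightarrow> 2 * of_real pi * \<i> * (edge_weight K a b - (\<Sum>K'\<in>T. if (b, a) \<in> dedges K' then edge_weight K' a b else 0))) (at_right 0)"
      by simp
    then show ?thesis by (simp add: tendsto_const_iff)
  qed
  have d_shared: "d K - d K' = q K u - q K' u"
    if s: "shared K K' u v" and uv: "(u, v) \<in> dedges K" for K K' u v
  proof -
    have K: "K \<in> T" "K' \<in> T" using s by (simp_all add: shared_def)
    have vu: "(v, u) \<in> dedges K'" by (rule dedge_opposite[OF uv s])
    have "(v, u) \<in> dedges L \<longleftrightarrow> L = K'" if "L \<in> T" for L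
      using dedge_unique[OF that K(2) _ vu] vu by blast
    then have "(\<Sum>L\<in>T. if (v, u) \<in> dedges L then edge_weight L u v else 0) = (\<Sum>L\<in>T. if L = K' then edge_weight L u v else 0)"
      by (intro sum.cong) auto
    then have sum: "(\<Sum>L\<in>T. if (v, u) \<in> dedges L then edge_weight L u v else 0) = edge_weight K' u v"
      using K(2) by simp
    have "D K - D K' = 2 * of_real pi * \<i> * (edge_weight K u v - edge_weight K' u v)"
      using jump[OF K(1) uv, of "D K'"] left[OF K(2) vu] unfolding right_eq sum by simp
    also have "edge_weight K u v - edge_weight K' u v = of_real (q K u - q K' u)"
      using q_shared[OF s] by (simp add: edge_weight_def complex_eq_iff field_simps)
    finally have "Im (D K - D K') = 2 * pi * (q K u - q K' u)" by simp
    then show ?thesis by (simp add: d_def flip: diff_divide_distrib)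
  qed
  have d_bdry: "d K = q K u" if b: "bedge K u v" and uv: "(u, v) \<in> dedges K" for K u v
  proof -
    have K: "K \<in> T" "u \<noteq> v" using b by (simp_all add: bedge_def)
    obtain w where t: "tri u v w K" using uv by (auto simp: dedges_def)
    have m: "midpoint u v \<in> open_segment u v" using K(2) by simp
    have "(v, u) \<notin> dedges L" if "L \<in> T" for L
    proof
      assume L: "(v, u) \<in> dedges L"
      then have "L = K" using b that dedges_verts[OF L] by (auto simp: bedge_def)
      then show False using L tri_orient[OF t] by (auto simp: dedges_def)
    qed
    then have sum: "(\<Sum>L\<in>T. if (v, u) \<in> dedges L then edge_weight L u v else 0) = 0" by (intro sum.neutral) auto
    have "\<forall>\<^sub>F e in at_right 0. total_angle (cx (midpoint u v - e *\<^sub>R perp (v - u))) = 0"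
      using eventually_ray[OF bedge_outside[OF b t m], of "- perp (v - u)"] eventually_at_right_less[of 0]
    proof eventually_elim
      case (elim e)
      have "det2 (v - u) (- (e *\<^sub>R perp (v - u))) < 0"
        using elim(2) K(2) det2_perp[of "v - u" e] by (simp add: det2_minus)
      then have "midpoint u v - e *\<^sub>R perp (v - u) \<notin> \<Union>T" using elim(1) by simp
      then show ?case by (rule total_angle_outside[OF sc])
    qed
    from jump[OF K(1) uv this] have "D K = 2 * of_real pi * \<i> * edge_weight K u v" unfolding sum by simp
    also have "edge_weight K u v = of_real (q K u)" using q_bdry[OF b] by (simp add: edge_weight_def)
    finally have "Im (D K) = 2 * pi * q K u" by simp
    then show ?thesis by (simp add: d_def)
  qed
  show ?thesis
  proof (rule that)
    fix K K' u v assume s: "shared K K' u v"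
    then have "(u, v) \<in> dedges K \<or> (v, u) \<in> dedges K" by (intro dedge_exists) (auto simp: shared_def)
    then show "d K - d K' = q K u - q K' u"
    proof
      assume "(v, u) \<in> dedges K"
      from d_shared[OF shared_sym(2)[OF s] this] show ?thesis using q_shared[OF s] by simp
    qed (rule d_shared[OF s])
  next
    fix K u v assume b: "bedge K u v"
    then have "(u, v) \<in> dedges K \<or> (v, u) \<in> dedges K" by (intro dedge_exists) (auto simp: bedge_def)
    then show "d K = q K u"
    proof
      assume "(v, u) \<in> dedges K"
      from d_bdry[OF bedge_sym[OF b] this] show ?thesis using q_bdry[OF b] by simp
    qed (rule d_bdry[OF b])
  qed
qed

end

end

section \<open>A criterion for bases of the Crouzeix-Raviart space\<close>

lemma basis_of_family:
  fixes h :: "'i \<Rightarrow> ae_fun"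
  assumes A: "finite A" and V: "subspace V" "\<And>a. a \<in> A \<Longrightarrow> h a \<in> V"
    and gen: "\<And>v. v \<in> V \<Longrightarrow> \<exists>c. v = (\<Sum>a\<in>A. c a *\<^sub>R h a)"
    and ind: "\<And>c. (\<Sum>a\<in>A. c a *\<^sub>R h a) = 0 \<Longrightarrow> \<forall>a\<in>A. c a = 0"
  shows "basis_of V (h ` A)"
  unfolding basis_of_def
proof
  have inj: "inj_on h A"
  proof (rule inj_onI, rule ccontr)
    fix a b assume ab: "a \<in> A" "b \<in> A" "h a = h b" "a \<noteq> b"
    let ?c = "\<lambda>x. (if x = a then 1 else 0) - (if x = b then 1 else 0) :: real"
    have "(\<Sum>x\<in>A. ?c x *\<^sub>R h x) = (\<Sum>x\<in>A. (if x = a then h x else 0) - (if x = b then h x else 0))"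
      by (intro sum.cong refl) (simp add: scaleR_diff_left)
    also have "\<dots> = 0" using A ab by (simp add: sum_subtractf)
    finally have "(\<Sum>x\<in>A. ?c x *\<^sub>R h x) = 0" .
    from bspec[OF ind[OF this] ab(1)] show False using ab(4) by simp
  qed
  show "independent (h ` A)"
  proof (rule independent_if_scalars_zero)
    show "finite (h ` A)" using A by simp
    fix f x assume f: "(\<Sum>x\<in>h ` A. f x *\<^sub>R x) = 0" and x: "x \<in> h ` A"
    have "(\<Sum>a\<in>A. f (h a) *\<^sub>R h a) = 0" using f inj by (simp add: sum.reindex)
    then have "\<forall>a\<in>A. f (h a) = 0" by (rule ind)
    then show "f x = 0" using x by blast
  qed
  show "span (h ` A) = V"
  proof
    show "span (h ` A) \<subseteq> V" using V by (intro span_minimal) auto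
    show "V \<subseteq> span (h ` A)"
    proof
      fix v assume "v \<in> V"
      then obtain c where "v = (\<Sum>a\<in>A. c a *\<^sub>R h a)" using gen by blast
      then show "v \<in> span (h ` A)" by (auto intro: span_sum span_scale span_base)
    qed
  qed
qed

context triangulation
begin

text \<open>
  If every element of the space becomes conforming by subtracting bubbles, its Lagrange expansion
  completes the representation. If the coefficients of the bubbles in a vanishing combination are
  zero, those of the Lagrange functions are its values at the nodes.
\<close>

lemma basis_criterion:
  fixes B :: "'j \<Rightarrow> (real^2) set \<Rightarrow> real^2 \<Rightarrow> real" and b :: "'j \<Rightarrow> real^2 \<Rightarrow> real"
  assumes p: "p \<ge> 1" and J: "finite J" and N: "N \<subseteq> nodes T p \<inter> \<Omega>"
    and cr: "\<And>j. j \<in> J \<Longrightarrow> cr_pieces p (B j)" and b: "\<And>j. j \<in> J \<Longrightarrow> ae_class (b j) = PW (B j)"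
    and gen: "\<And>Q. cr_pieces p Q \<Longrightarrow> \<exists>\<beta>. conforming p (\<lambda>K x. Q K x - (\<Sum>j\<in>J. \<beta> j * B j K x))
      \<and> (\<forall>K\<in>T. \<forall>z\<in>nodeset p K. z \<in> \<Omega> \<longrightarrow> z \<notin> N \<longrightarrow> Q K z - (\<Sum>j\<in>J. \<beta> j * B j K z) = 0)"
    and ind: "\<And>\<alpha> \<beta>. (\<And>K x. K \<in> T \<Longrightarrow> (\<Sum>z\<in>N. \<alpha> z * local_lagrange p K z x) + (\<Sum>j\<in>J. \<beta> j * B j K x) = 0)
      \<Longrightarrow> \<forall>j\<in>J. \<beta> j = 0"
  shows "basis_of (crouzeix_raviart0 \<Omega> T p)
    ({ae_class (lagrange T p z) | z. z \<in> N} \<union> {ae_class (b j) | j. j \<in> J})"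
proof -
  define h where "h = case_sum (\<lambda>z. ae_class (lagrange T p z)) (\<lambda>j. ae_class (b j))"
  have fN: "finite N" using N finite_nodes[OF p] finite_subset by blast
  have combo: "(\<Sum>a\<in>N <+> J. c a *\<^sub>R h a) = PW (\<lambda>K x. (\<Sum>z\<in>N. c (Inl z) * local_lagrange p K z x) + (\<Sum>j\<in>J. c (Inr j) * B j K x))" for c
  proof -
    have "(\<Sum>a\<in>N <+> J. c a *\<^sub>R h a) = (\<Sum>z\<in>N. c (Inl z) *\<^sub>R ae_class (lagrange T p z)) + (\<Sum>j\<in>J. c (Inr j) *\<^sub>R ae_class (b j))"
      using fN J by (simp add: sum.Plus h_def)
    also have "(\<Sum>j\<in>J. c (Inr j) *\<^sub>R ae_class (b j)) = (\<Sum>j\<in>J. c (Inr j) *\<^sub>R PW (B j))"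
      using b by (intro sum.cong) auto
    finally show ?thesis by (simp add: PW_add PW_sum ae_class_lagrange[OF p])
  qed
  have "basis_of (crouzeix_raviart0 \<Omega> T p) (h ` (N <+> J))"
  proof (rule basis_of_family)
    show "finite (N <+> J)" using fN J by simp
    show "subspace (crouzeix_raviart0 \<Omega> T p)" by (rule subspace_crouzeix_raviart0[OF p])
    fix a assume "a \<in> N <+> J"
    then show "h a \<in> crouzeix_raviart0 \<Omega> T p"
    proof
      fix z assume z: "a = Inl z" "z \<in> N"
      then have "cr_pieces p (\<lambda>K. local_lagrange p K z)" using N by (intro conforming_imp_cr conforming_local_lagrange[OF p]) blast
      then show ?thesis unfolding crouzeix_raviart0_iff[OF p] using z ae_class_lagrange[OF p] by (auto simp: h_def)
    next
      fix j assume j: "a = Inr j" "j \<in> J"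
      then show ?thesis unfolding crouzeix_raviart0_iff[OF p] using cr[OF j(2)] b[OF j(2)] by (auto simp: h_def)
    qed
  next
    fix v assume "v \<in> crouzeix_raviart0 \<Omega> T p"
    then obtain Q where Q: "cr_pieces p Q" "v = PW Q" unfolding crouzeix_raviart0_iff[OF p] by (elim exE conjE)
    let ?W = "\<lambda>\<beta> K x. Q K x - (\<Sum>j\<in>J. \<beta> j * B j K x)"
    obtain \<beta> where W: "conforming p (?W \<beta>)"
      "\<forall>K\<in>T. \<forall>z\<in>nodeset p K. z \<in> \<Omega> \<longrightarrow> z \<notin> N \<longrightarrow> ?W \<beta> K z = 0"
      using gen[OF Q(1)] by (elim exE conjE)
    have "\<exists>\<alpha>. \<forall>K\<in>T. \<forall>x. ?W \<beta> K x = (\<Sum>z\<in>N. \<alpha> z * local_lagrange p K z x)"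
      by (rule conforming_expansion[OF p W(1) N]) (use W(2) in blast)+
    then obtain \<alpha> where \<alpha>: "\<forall>K\<in>T. \<forall>x. ?W \<beta> K x = (\<Sum>z\<in>N. \<alpha> z * local_lagrange p K z x)" by (elim exE)
    have "v = PW (\<lambda>K x. (\<Sum>z\<in>N. \<alpha> z * local_lagrange p K z x) + (\<Sum>j\<in>J. \<beta> j * B j K x))"
      unfolding Q(2)
    proof (rule PW_cong)
      fix K assume K: "K \<in> T"
      show "Q K = (\<lambda>x. (\<Sum>z\<in>N. \<alpha> z * local_lagrange p K z x) + (\<Sum>j\<in>J. \<beta> j * B j K x))"
      proof
        fix x
        show "Q K x = (\<Sum>z\<in>N. \<alpha> z * local_lagrange p K z x) + (\<Sum>j\<in>J. \<beta> j * B j K x)"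
          unfolding \<alpha>[rule_format, OF K, symmetric] by simp
      qed
    qed
    then have "v = (\<Sum>a\<in>N <+> J. (case_sum \<alpha> \<beta>) a *\<^sub>R h a)" unfolding combo by simp
    then show "\<exists>c. v = (\<Sum>a\<in>N <+> J. c a *\<^sub>R h a)" by (intro exI[of _ "case_sum \<alpha> \<beta>"])
  next
    fix c assume "(\<Sum>a\<in>N <+> J. c a *\<^sub>R h a) = 0"
    note 0 = this[unfolded combo]
    have zero: "(\<Sum>z\<in>N. c (Inl z) * local_lagrange p K z x) + (\<Sum>j\<in>J. c (Inr j) * B j K x) = 0" if K: "K \<in> T" for K x
    proof (rule PW_eq_0[OF 0 K])
      show "poly2_le p (\<lambda>x. (\<Sum>z\<in>N. c (Inl z) * local_lagrange p K z x) + (\<Sum>j\<in>J. c (Inr j) * B j K x))"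
        using cr_piecesD(1)[OF cr K] poly2_le_local_lagrange[OF K]
        by (intro poly2_le_add poly2_le_sum poly2_le_cmult)
    qed
    have \<beta>: "\<forall>j\<in>J. c (Inr j) = 0" by (rule ind[OF zero])
    have \<alpha>: "c (Inl y) = 0" if y: "y \<in> N" for y
    proof -
      obtain K where K: "K \<in> T" "y \<in> nodeset p K" using y N nodes_eq[OF p] by blast
      have "(\<Sum>z\<in>N. c (Inl z) * local_lagrange p K z y) = c (Inl y)"
        using local_lagrange_sum_at_node[OF p _ K, of N "\<lambda>z. c (Inl z)"] N y by simp
      moreover have "(\<Sum>j\<in>J. c (Inr j) * B j K y) = 0" using \<beta> by (intro sum.neutral) simp
      ultimately show ?thesis using zero[OF K(1), of y] by simp
    qed
    show "\<forall>a\<in>N <+> J. c a = 0" using \<alpha> \<beta> by auto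
  qed
  moreover have "h ` (N <+> J) = {ae_class (lagrange T p z) | z. z \<in> N} \<union> {ae_class (b j) | j. j \<in> J}"
    by (simp add: h_def Plus_def image_Un image_image setcompr_eq_image)
  ultimately show ?thesis by simp
qed

lemma third_vertex:
  assumes "K \<in> T" "u \<in> verts K" "v \<in> verts K" "u \<noteq> v"
  obtains w where "verts K = {u, v, w}" "w \<noteq> u" "w \<noteq> v"
proof -
  obtain a b c where "tri a b c K" using triE[OF assms(1)] .
  then have "(\<exists>w. tri u v w K) \<or> (\<exists>w. tri v u w K)" using tri_ordered assms by blast
  then show ?thesis
  proof
    assume "\<exists>w. tri u v w K"
    then obtain w where t: "tri u v w K" by (elim exE)
    show ?thesis by (rule that[of w]) (use tri_verts[OF t] tri_distinct[OF t] in auto)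
  next
    assume "\<exists>w. tri v u w K"
    then obtain w where t: "tri v u w K" by (elim exE)
    show ?thesis by (rule that[of w]) (use tri_verts[OF t] tri_distinct[OF t] in auto)
  qed
qed

lemma vertex_node: "K \<in> T \<Longrightarrow> y \<in> verts K \<Longrightarrow> y \<in> nodeset p K"
  using verts_nodeset by blast

section \<open>Even degree\<close>

definition triangle_bubble_poly :: "nat \<Rightarrow> (real^2) set \<Rightarrow> real^2 \<Rightarrow> real" where
  "triangle_bubble_poly p K x = 1/2 * (-1 + (\<Sum>A\<in>verts K. poly (legendre p) (1 - 2 * bary K A x)))"

definition triangle_bubble_pieces :: "nat \<Rightarrow> (real^2) set \<Rightarrow> (real^2) set \<Rightarrow> real^2 \<Rightarrow> real" where
  "triangle_bubble_pieces p K0 K x = (if K = K0 then triangle_bubble_poly p K0 x else 0)"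

lemma poly2_le_legendre_bary:
  assumes "K \<in> T" "A \<in> verts K"
  shows "poly2_le p (\<lambda>x. poly (legendre p) (1 - 2 * bary K A x))"
  using poly2_le_bary[OF assms] degree_legendre[of p]
  by (intro poly2_le_poly poly2_le_diff poly2_le_const poly2_le_cmult) simp_all

lemma poly2_le_triangle_bubble: "K \<in> T \<Longrightarrow> poly2_le p (triangle_bubble_poly p K)"
  unfolding triangle_bubble_poly_def[abs_def]
  by (intro poly2_le_cmult poly2_le_add poly2_le_const poly2_le_sum poly2_le_legendre_bary)

text \<open>
  On the edge the coordinates are \<open>1 - t\<close>, \<open>t\<close> and \<open>0\<close>. The first two contribute the same because the
  Legendre polynomial is even, and the third contributes \<open>1\<close>.
\<close>

lemma triangle_bubble_trace:
  assumes p: "even p" and K: "K \<in> T" "u \<noteq> v" "u \<in> verts K" "v \<in> verts K"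
  shows "triangle_bubble_poly p K (linepath u v t) = edge_legendre p t"
proof -
  obtain w where w: "verts K = {u, v, w}" "w \<noteq> u" "w \<noteq> v" using third_vertex[OF K(1,3,4,2)] .
  have b: "bary K u (linepath u v t) = 1 - t" "bary K v (linepath u v t) = t" "bary K w (linepath u v t) = 0"
    using K w by (simp_all add: bary_linepath bary_at)
  have "(\<Sum>A\<in>verts K. poly (legendre p) (1 - 2 * bary K A (linepath u v t)))
     = poly (legendre p) (1 - 2 * (1 - t)) + poly (legendre p) (1 - 2 * t) + poly (legendre p) (1 - 2 * 0)"
    unfolding w(1) using w(2,3) K(2) by (simp add: b)
  then show ?thesis unfolding triangle_bubble_poly_def legendre_edge using p by (simp add: edge_legendre_reflect)
qed

lemma triangle_bubble_at_vertex:
  assumes p: "even p" and K: "K \<in> T" "y \<in> verts K" shows "triangle_bubble_poly p K y = 1"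
proof -
  obtain a b where t: "tri y a b K" using K by (rule tri_atE)
  have "triangle_bubble_poly p K (linepath y a 0) = 1"
    using triangle_bubble_trace[OF p K(1) tri_distinct(1)[OF t]] tri_verts[OF t] p by simp
  then show ?thesis by (simp add: linepath_def)
qed

lemma cr_pieces_triangle_bubble:
  assumes p: "even p" and K0: "K0 \<in> T" shows "cr_pieces p (triangle_bubble_pieces p K0)"
  unfolding cr_pieces_def
proof (intro conjI allI impI ballI)
  show "poly2_le p (triangle_bubble_pieces p K0 K)" if "K \<in> T" for K
    using poly2_le_triangle_bubble[OF K0] by (cases "K = K0") (simp_all add: triangle_bubble_pieces_def[abs_def] poly2_le_const)
  have trace: "triangle_bubble_pieces p K0 K (linepath u v t) = (if K = K0 then 1 else 0) * edge_legendre p t"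
    if "K \<in> T" "u \<noteq> v" "u \<in> verts K" "v \<in> verts K" for K u v t
    using triangle_bubble_trace[OF p that, of t] by (cases "K = K0") (auto simp: triangle_bubble_pieces_def)
  fix K u v
  {
    fix K' assume s: "shared K K' u v"
    have "triangle_bubble_pieces p K0 K (linepath u v t) - triangle_bubble_pieces p K0 K' (linepath u v t)
      = ((if K = K0 then 1 else 0) - (if K' = K0 then 1 else 0)) * edge_legendre p t" for t
      using s trace[of K u v t] trace[of K' u v t] unfolding shared_def left_diff_distrib by simp
    then show "\<exists>c. \<forall>t. triangle_bubble_pieces p K0 K (linepath u v t) - triangle_bubble_pieces p K0 K' (linepath u v t) = c * edge_legendre p t"
      by (intro exI allI)
  }
  assume "bedge K u v"
  then show "\<exists>c. \<forall>t. triangle_bubble_pieces p K0 K (linepath u v t) = c * edge_legendre p t"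
    using trace[of K u v] unfolding bedge_def
    by (intro exI[of _ "if K = K0 then 1 else 0"] allI) simp
qed

lemma ae_class_triangle_bubble:
  assumes K0: "K0 \<in> T" shows "ae_class (triangle_bubble p K0) = PW (triangle_bubble_pieces p K0)"
proof (rule ae_class_eq_PW)
  have eq: "triangle_bubble p K0 x = (if x \<in> K0 then triangle_bubble_poly p K0 x else 0)" for x
    by (simp add: triangle_bubble_def triangle_bubble_poly_def verts_def)
  show "triangle_bubble p K0 x = 0" if "x \<notin> \<Union>T" for x using that K0 by (auto simp: eq)
  fix K x assume K: "K \<in> T" "x \<in> interior K"
  show "triangle_bubble p K0 x = triangle_bubble_pieces p K0 K x"
  proof (cases "K = K0")
    case True
    then show ?thesis using K(2) interior_subset by (auto simp: eq triangle_bubble_pieces_def)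
  next
    case False
    then have "x \<notin> K0" using triangle_intersection(3)[OF K(1) K0] K(2) by blast
    then show ?thesis using False by (simp add: eq triangle_bubble_pieces_def)
  qed
qed

lemma triangle_bubble_sum: "K \<in> T \<Longrightarrow> (\<Sum>K0\<in>T. \<beta> K0 * triangle_bubble_pieces p K0 K x) = \<beta> K * triangle_bubble_poly p K x"
proof -
  assume K: "K \<in> T"
  have "(\<Sum>K0\<in>T. \<beta> K0 * triangle_bubble_pieces p K0 K x) = (\<Sum>K0\<in>T. if K0 = K then \<beta> K0 * triangle_bubble_poly p K0 x else 0)"
    by (intro sum.cong) (auto simp: triangle_bubble_pieces_def)
  then show ?thesis using K by simp
qed

text \<open>
  If some coefficients were nonzero, consider the rightmost vertex of the triangles carrying
  them. It is interior, so some triangle with a nonzero coefficient extends further right.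
\<close>

lemma bubble_coefficients_zero:
  assumes eq: "\<And>K y. K \<in> T \<Longrightarrow> y \<in> verts K \<Longrightarrow> \<beta> K = (if y \<in> \<Omega> then \<alpha> y else 0)"
  shows "\<forall>K\<in>T. \<beta> K = (0::real)"
proof (rule ccontr)
  define S where "S = {K\<in>T. \<beta> K \<noteq> 0}"
  define V where "V = \<Union>(verts ` S)"
  assume "\<not> (\<forall>K\<in>T. \<beta> K = 0)"
  then obtain K0 where K0: "K0 \<in> S" by (auto simp: S_def)
  have fV: "finite V" unfolding V_def S_def using triangle_facts(4) by auto
  have "verts K0 \<noteq> {}" using K0 triangle_facts(5)[of K0] by (auto simp: S_def)
  then have "V \<noteq> {}" using K0 by (auto simp: V_def)
  then have "Max ((\<lambda>y. y$1) ` V) \<in> (\<lambda>y. y$1) ` V" using fV by (intro Max_in) auto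
  then obtain z where z: "z \<in> V" "z$1 = Max ((\<lambda>y. y$1) ` V)" by auto
  have zmax: "y$1 \<le> z$1" if "y \<in> V" for y using that fV unfolding z(2) by (intro Max_ge) auto
  obtain K where K: "K \<in> T" "\<beta> K \<noteq> 0" "z \<in> verts K" using z(1) unfolding V_def S_def by blast
  have z\<Omega>: "z \<in> \<Omega>" "\<alpha> z \<noteq> 0" using eq[OF K(1,3)] K(2) by (auto split: if_splits)
  have "\<forall>\<^sub>F y in nhds z. y \<in> \<Omega>" using open_Omega z\<Omega>(1) by (rule eventually_nhds_in_open)
  then obtain e where e: "e > 0"
    "z + e *\<^sub>R vector [1, 0] \<in> \<Omega> \<and> (\<forall>K\<in>T. z + e *\<^sub>R vector [1, 0] \<in> K \<longrightarrow> z \<in> K)"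
    by (rule ray_exists[OF eventually_conj[OF _ eventually_incident]])
  let ?y = "z + e *\<^sub>R vector [1, 0] :: real^2"
  obtain K' where K': "K' \<in> T" "?y \<in> K'" using e(2) Omega_subset by blast
  then have "z \<in> verts K'" using e(2) vertex_of_incident_triangle[OF K(3,1) K'(1)] by blast
  then have "\<beta> K' \<noteq> 0" using eq[OF K'(1)] z\<Omega> by simp
  then have V': "verts K' \<subseteq> V" using K'(1) by (auto simp: V_def S_def)
  have "?y$1 = (\<Sum>A\<in>verts K'. bary K' A ?y *\<^sub>R A)$1" using bary_recover[OF K'(1), of ?y] by simp
  also have "\<dots> = (\<Sum>A\<in>verts K'. bary K' A ?y * A$1)" by (simp add: sum_component)
  also have "\<dots> \<le> (\<Sum>A\<in>verts K'. bary K' A ?y * z$1)"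
    using bary_nonneg_iff[OF K'(1)] K'(2) V' zmax by (intro sum_mono mult_left_mono) auto
  also have "\<dots> = z$1" using bary_sum[OF K'(1), of ?y] by (simp flip: sum_distrib_right)
  finally show False using e(1) by simp
qed

text \<open>
  At the vertices of a triangle its bubble is \<open>1\<close>, and the values of the pieces at the vertices satisfy
  the hypotheses of \<open>simply_connected_exact\<close> because an even Legendre polynomial is \<open>1\<close> at both
  endpoints. Subtracting the bubbles with the coefficients obtained makes the jumps vanish at the
  endpoints of the edges, hence everywhere.
\<close>

lemma even_basis:
  assumes p: "p \<ge> 1" "even p" and sc: "simply_connected \<Omega>"
  shows "basis_of (crouzeix_raviart0 \<Omega> T p)
    ({ae_class (lagrange T p z) | z. z \<in> nodes T p \<inter> \<Omega>} \<union> {ae_class (triangle_bubble p K) | K. K \<in> T})"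
proof (rule basis_criterion[OF p(1) finite_T order_refl cr_pieces_triangle_bubble[OF p(2)] ae_class_triangle_bubble])
  fix Q assume Q: "cr_pieces p Q"
  have end1: "linepath u v 0 = u" "linepath u v 1 = v" for u v :: "real^2" by (simp_all add: linepath_def)
  have qs: "Q K u - Q K' u = Q K v - Q K' v" if s: "shared K K' u v" for K K' u v
  proof -
    obtain c where c: "\<forall>t. Q K (linepath u v t) - Q K' (linepath u v t) = c * edge_legendre p t"
      using cr_piecesD(2)[OF Q s] by (elim exE)
    show ?thesis using c[rule_format, of 0] c[rule_format, of 1] p(2) by (simp add: end1)
  qed
  have qb: "Q K u = Q K v" if b: "bedge K u v" for K u v
  proof -
    obtain c where c: "\<forall>t. Q K (linepath u v t) = c * edge_legendre p t"
      using cr_piecesD(3)[OF Q b] by (elim exE)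
    show ?thesis using c[rule_format, of 0] c[rule_format, of 1] p(2) by (simp add: end1)
  qed
  have "\<exists>d. (\<forall>K K' u v. shared K K' u v \<longrightarrow> d K - d K' = Q K u - Q K' u) \<and> (\<forall>K u v. bedge K u v \<longrightarrow> d K = Q K u)"
  proof (rule simply_connected_exact[where q = Q])
    show "Q K u - Q K' u = Q K v - Q K' v" if "shared K K' u v" for K K' u v by (rule qs[OF that])
    show "Q K u = Q K v" if "bedge K u v" for K u v by (rule qb[OF that])
    show "simply_connected \<Omega>" by (rule sc)
  qed blast
  then obtain d where d: "\<forall>K K' u v. shared K K' u v \<longrightarrow> d K - d K' = Q K u - Q K' u"
      "\<forall>K u v. bedge K u v \<longrightarrow> d K = Q K u" by (elim exE conjE)
  let ?W = "\<lambda>K x. Q K x - (\<Sum>K0\<in>T. d K0 * triangle_bubble_pieces p K0 K x)"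
  have "cr_pieces p (\<lambda>K x. Q K x + (-1) * (\<Sum>K0\<in>T. d K0 * triangle_bubble_pieces p K0 K x))"
    using cr_pieces_triangle_bubble[OF p(2)] by (intro cr_pieces_add cr_pieces_scale cr_pieces_sum Q)
  then have crW: "cr_pieces p ?W" by simp
  have Wv: "?W K y = Q K y - d K" if "K \<in> T" "y \<in> verts K" for K y
    using triangle_bubble_sum[OF that(1)] triangle_bubble_at_vertex[OF p(2) that] by simp
  have "conforming p ?W"
  proof (rule cr_imp_conforming[OF crW])
    show "?W K v = ?W K' v" if s: "shared K K' u v" for K K' u v
    proof -
      have K: "K \<in> T" "K' \<in> T" "v \<in> verts K" "v \<in> verts K'" using s by (simp_all add: shared_def)
      have "d K - d K' = Q K u - Q K' u" using d(1) s by blast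
      then show ?thesis unfolding Wv[OF K(1,3)] Wv[OF K(2,4)] using qs[OF s] by simp
    qed
    show "?W K v = 0" if b: "bedge K u v" for K u v
    proof -
      have K: "K \<in> T" "v \<in> verts K" using b by (simp_all add: bedge_def)
      have "d K = Q K u" using d(2) b by blast
      then show ?thesis unfolding Wv[OF K] using qb[OF b] by simp
    qed
  qed
  moreover have "\<forall>K\<in>T. \<forall>z\<in>nodeset p K. z \<in> \<Omega> \<longrightarrow> z \<notin> nodes T p \<inter> \<Omega> \<longrightarrow> ?W K z = 0"
    using nodes_eq[OF p(1)] by blast
  ultimately show "\<exists>\<beta>. conforming p (\<lambda>K x. Q K x - (\<Sum>j\<in>T. \<beta> j * triangle_bubble_pieces p j K x)) \<and>
      (\<forall>K\<in>T. \<forall>z\<in>nodeset p K. z \<in> \<Omega> \<longrightarrow> z \<notin> nodes T p \<inter> \<Omega> \<longrightarrow> Q K z - (\<Sum>j\<in>T. \<beta> j * triangle_bubble_pieces p j K z) = 0)"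
    by (intro exI[of _ d] conjI)
next
  fix \<alpha> \<beta>
  assume 0: "\<And>K x. K \<in> T \<Longrightarrow> (\<Sum>z\<in>nodes T p \<inter> \<Omega>. \<alpha> z * local_lagrange p K z x) + (\<Sum>j\<in>T. \<beta> j * triangle_bubble_pieces p j K x) = 0"
  have "\<beta> K = (if y \<in> \<Omega> then - \<alpha> y else 0)" if K: "K \<in> T" "y \<in> verts K" for K y
  proof -
    have y: "y \<in> nodeset p K" by (rule vertex_node[OF K])
    then have "y \<in> nodes T p" using nodes_eq[OF p(1)] K(1) by blast
    then have "(\<Sum>z\<in>nodes T p \<inter> \<Omega>. \<alpha> z * local_lagrange p K z y) = (if y \<in> \<Omega> then \<alpha> y else 0)"
      using local_lagrange_sum_at_node[OF p(1) _ K(1) y, of "nodes T p \<inter> \<Omega>" \<alpha>] by simp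
    moreover have "(\<Sum>j\<in>T. \<beta> j * triangle_bubble_pieces p j K y) = \<beta> K"
      using triangle_bubble_sum[OF K(1)] triangle_bubble_at_vertex[OF p(2) K] by simp
    ultimately show ?thesis using 0[OF K(1), of y] by (simp split: if_splits)
  qed
  then show "\<forall>j\<in>T. \<beta> j = 0" by (rule bubble_coefficients_zero)
qed

section \<open>Odd degree\<close>

definition edge_bubble_pieces :: "nat \<Rightarrow> (real^2) set \<Rightarrow> (real^2) set \<Rightarrow> real^2 \<Rightarrow> real" where
  "edge_bubble_pieces p E K x = (if E \<subseteq> K then poly (legendre p) (1 - 2 * bary K (opposite_vertex K E) x) else 0)"

lemma opposite_vertex_eq:
  assumes K: "K \<in> T" and v: "verts K = {u, v, w}" "u \<noteq> v" "w \<noteq> u" "w \<noteq> v"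
  shows "opposite_vertex K (closed_segment u v) = w"
proof -
  have w: "w \<notin> closed_segment u v"
  proof
    assume "w \<in> closed_segment u v"
    then obtain t where t: "w = linepath u v t" using linepath_of_segment by blast
    have "bary K w w = 0" by (subst (2) t) (use K v in \<open>simp add: bary_linepath bary_at\<close>)
    then show False using K v by (simp add: bary_at)
  qed
  show ?thesis unfolding opposite_vertex_def
  proof (rule the_equality)
    show "w extreme_point_of K \<and> w \<notin> closed_segment u v" using w v(1) by (auto simp: verts_def)
    fix A assume A: "A extreme_point_of K \<and> A \<notin> closed_segment u v"
    then have "A \<in> {u, v, w}" using v(1) by (auto simp: verts_def)
    then show "A = w" using A by auto
  qed
qed

lemma edge_in_triangle:
  assumes E: "E \<in> edges T" "K \<in> T" "E \<subseteq> K"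
  obtains u v w where "E = closed_segment u v" "verts K = {u, v, w}" "u \<noteq> v" "w \<noteq> u" "w \<noteq> v" "opposite_vertex K E = w"
proof -
  obtain K0 u v where K0: "K0 \<in> T" "u \<noteq> v" "u \<in> verts K0" "v \<in> verts K0" "E = closed_segment u v"
    using E(1) by (rule edgesE)
  have "K \<in> triangles_at T (closed_segment u v)" using E K0(5) by (simp add: triangles_at_def)
  then have uv: "u \<in> verts K" "v \<in> verts K" using triangles_at_edge[OF K0(1-4)] by auto
  obtain w where w: "verts K = {u, v, w}" "w \<noteq> u" "w \<noteq> v" using third_vertex[OF E(2) uv K0(2)] .
  show ?thesis
    by (rule that[OF K0(5) w(1) K0(2) w(2,3)]) (use opposite_vertex_eq[OF E(2) w(1) K0(2) w(2,3)] K0(5) in simp)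
qed

text \<open>The barycentric coordinate of the opposite vertex vanishes on the edge.\<close>

lemma edge_bubble_trace_own_edge:
  assumes K: "K \<in> T" "a \<noteq> b" "a \<in> verts K" "b \<in> verts K"
  shows "edge_bubble_pieces p (closed_segment a b) K (linepath a b t) = 1"
proof -
  obtain w where w: "verts K = {a, b, w}" "w \<noteq> a" "w \<noteq> b" using third_vertex[OF K(1,3,4,2)] .
  have "closed_segment a b \<subseteq> K" using edge_subset_triangle[OF K(1,3,4)] by blast
  then show ?thesis
    using opposite_vertex_eq[OF K(1) w(1) K(2) w(2,3)] K w
    by (simp add: edge_bubble_pieces_def bary_linepath bary_at legendre_at_1)
qed

text \<open>
  The vertex opposite to \<open>E\<close> is an endpoint of any other edge of the triangle, so its barycentric
  coordinate is \<open>t\<close> or \<open>1 - t\<close> there.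
\<close>

lemma edge_bubble_trace_other_edge:
  assumes K: "K \<in> T" "a \<noteq> b" "a \<in> verts K" "b \<in> verts K" and E: "E \<in> edges T" "E \<noteq> closed_segment a b"
  shows "\<exists>c. \<forall>t. edge_bubble_pieces p E K (linepath a b t) = c * edge_legendre p t"
proof (cases "E \<subseteq> K")
  case False
  then show ?thesis by (intro exI[of _ 0]) (simp add: edge_bubble_pieces_def)
next
  case True
  obtain u v w where w: "E = closed_segment u v" "verts K = {u, v, w}" "u \<noteq> v" "w \<noteq> u" "w \<noteq> v" "opposite_vertex K E = w"
    using edge_in_triangle[OF E(1) K(1) True] .
  have wK: "w \<in> verts K" using w(2) by simp
  have "w = a \<or> w = b"
  proof (rule ccontr)
    assume "\<not> (w = a \<or> w = b)"
    then have "{a, b} = {u, v}" using K(2-4) w(2) by auto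
    then show False using E(2) w(1) by (auto simp: doubleton_eq_iff closed_segment_commute)
  qed
  then show ?thesis
  proof
    assume wa: "w = a"
    have "edge_bubble_pieces p E K (linepath a b t) = ((-1)^p * (-1)^p) * edge_legendre p t" for t
    proof -
      have "bary K w (linepath a b t) = 1 - t" unfolding bary_linepath[OF K(1) wK]
        using K by (simp add: bary_at wa)
      then show ?thesis
        unfolding edge_bubble_pieces_def if_P[OF True] w(6) by (simp only: legendre_edge edge_legendre_reflect mult.assoc)
    qed
    then show ?thesis by (intro exI allI)
  next
    assume wb: "w = b"
    have "edge_bubble_pieces p E K (linepath a b t) = (-1)^p * edge_legendre p t" for t
    proof -
      have "bary K w (linepath a b t) = t" unfolding bary_linepath[OF K(1) wK]
        using K by (simp add: bary_at wb)
      then show ?thesis using True by (simp add: edge_bubble_pieces_def w(6) legendre_edge)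
    qed
    then show ?thesis by (intro exI allI)
  qed
qed

lemma cr_pieces_edge_bubble:
  assumes E: "E \<in> interior_edges \<Omega> T" shows "cr_pieces p (edge_bubble_pieces p E)"
  unfolding cr_pieces_def
proof (intro conjI allI impI ballI)
  have Ee: "E \<in> edges T" using E by (simp add: interior_edges_def)
  show "poly2_le p (edge_bubble_pieces p E K)" if K: "K \<in> T" for K
  proof (cases "E \<subseteq> K")
    case True
    obtain u v w where w: "verts K = {u, v, w}" "opposite_vertex K E = w"
      using edge_in_triangle[OF Ee K True] by metis
    then have "opposite_vertex K E \<in> verts K" by simp
    from poly2_le_legendre_bary[OF K this, of p] show ?thesis using True by (simp add: edge_bubble_pieces_def[abs_def])
  next
    case False
    then show ?thesis by (simp add: edge_bubble_pieces_def[abs_def] poly2_le_const)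
  qed
  fix K u v
  {
    fix K' assume s: "shared K K' u v"
    then have K: "K \<in> T" "K' \<in> T" "u \<noteq> v" "u \<in> verts K" "v \<in> verts K" "u \<in> verts K'" "v \<in> verts K'"
      by (simp_all add: shared_def)
    show "\<exists>c. \<forall>t. edge_bubble_pieces p E K (linepath u v t) - edge_bubble_pieces p E K' (linepath u v t) = c * edge_legendre p t"
    proof (cases "E = closed_segment u v")
      case True
      then show ?thesis using K edge_bubble_trace_own_edge by (intro exI[of _ 0]) simp
    next
      case False
      obtain c where c: "\<forall>t. edge_bubble_pieces p E K (linepath u v t) = c * edge_legendre p t"
        using edge_bubble_trace_other_edge[OF K(1,3,4,5) Ee False, of p] by (elim exE)
      obtain d where d: "\<forall>t. edge_bubble_pieces p E K' (linepath u v t) = d * edge_legendre p t"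
        using edge_bubble_trace_other_edge[OF K(2,3,6,7) Ee False, of p] by (elim exE)
      show ?thesis using c d by (intro exI[of _ "c - d"]) (simp add: left_diff_distrib)
    qed
  }
  assume b: "bedge K u v"
  then have K: "K \<in> T" "u \<noteq> v" "u \<in> verts K" "v \<in> verts K" by (simp_all add: bedge_def)
  have "E \<noteq> closed_segment u v" using interior_edge_iff(1)[OF K] E b by blast
  then show "\<exists>c. \<forall>t. edge_bubble_pieces p E K (linepath u v t) = c * edge_legendre p t"
    by (rule edge_bubble_trace_other_edge[OF K Ee])
qed

lemma ae_class_edge_bubble: "ae_class (edge_bubble T p E) = PW (edge_bubble_pieces p E)"
proof (rule ae_class_eq_PW)
  show "edge_bubble T p E x = 0" if "x \<notin> \<Union>T" for x
    using that by (auto simp: edge_bubble_def triangles_at_def)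
  fix K x assume K: "K \<in> T" "x \<in> interior K"
  have uniq: "K' = K" if "K' \<in> T" "x \<in> K'" for K' using triangle_intersection(3)[OF K(1) that(1)] K(2) that(2) by blast
  have xK: "x \<in> K" using K(2) interior_subset by blast
  show "edge_bubble T p E x = edge_bubble_pieces p E K x"
  proof (cases "E \<subseteq> K")
    case True
    then have "x \<in> \<Union>(triangles_at T E)" using K(1) xK by (auto simp: triangles_at_def)
    moreover have "(SOME K. K \<in> triangles_at T E \<and> x \<in> K) = K"
    proof (rule some_equality)
      show "K \<in> triangles_at T E \<and> x \<in> K" using K(1) xK True by (simp add: triangles_at_def)
      show "L = K" if "L \<in> triangles_at T E \<and> x \<in> L" for L
        using that uniq[of L] by (simp add: triangles_at_def)
    qed
    ultimately show ?thesis using True by (simp add: edge_bubble_def edge_bubble_pieces_def)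
  next
    case False
    then have "x \<notin> \<Union>(triangles_at T E)" using uniq by (auto simp: triangles_at_def)
    then show ?thesis using False by (simp add: edge_bubble_def edge_bubble_pieces_def)
  qed
qed

lemma finite_edges: "finite (edges T)"
proof -
  have "finite {E. E edge_of K}" if "K \<in> T" for K
  proof -
    from \<open>K \<in> T\<close> obtain a b c where t: "tri a b c K" by (rule triE)
    show ?thesis unfolding tri_edge_iff[OF t] by simp
  qed
  moreover have "edges T = (\<Union>K\<in>T. {E. E edge_of K})" by (auto simp: edges_def)
  ultimately show ?thesis by simp
qed

lemma edge_bubble_sum_on_triangle:
  fixes \<beta> :: "(real^2) set \<Rightarrow> real"
  assumes K: "K \<in> T" "verts K = {a, b, c}" "a \<noteq> b" "b \<noteq> c" "c \<noteq> a"
    and J: "J \<subseteq> edges T"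
  defines "\<beta>' \<equiv> \<lambda>E. if E \<in> J then \<beta> E else 0"
  shows "(\<Sum>E\<in>J. \<beta> E * edge_bubble_pieces p E K x)
    = \<beta>' (closed_segment b c) * poly (legendre p) (1 - 2 * bary K a x)
    + \<beta>' (closed_segment c a) * poly (legendre p) (1 - 2 * bary K b x)
    + \<beta>' (closed_segment a b) * poly (legendre p) (1 - 2 * bary K c x)"
proof -
  let ?X = "{closed_segment b c, closed_segment c a, closed_segment a b}"
  have fJ: "finite J" using J finite_edges finite_subset by blast
  have out: "edge_bubble_pieces p E K x = 0" if "E \<in> J" "E \<notin> ?X" for E
  proof -
    have "\<not> E \<subseteq> K"
    proof
      assume "E \<subseteq> K"
      moreover have "E \<in> edges T" using that J by blast
      ultimately obtain u v w where w: "E = closed_segment u v" "verts K = {u, v, w}" "u \<noteq> v"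
        using edge_in_triangle[OF _ K(1)] by metis
      then have "u \<in> {a, b, c}" "v \<in> {a, b, c}" using K(2) by auto
      then show False using w(1,3) that(2) by (auto simp: closed_segment_commute)
    qed
    then show ?thesis by (simp add: edge_bubble_pieces_def)
  qed
  have "(\<Sum>E\<in>J. \<beta> E * edge_bubble_pieces p E K x) = (\<Sum>E\<in>?X \<inter> J. \<beta> E * edge_bubble_pieces p E K x)"
    using fJ out by (intro sum.mono_neutral_right) auto
  also have "\<dots> = (\<Sum>E\<in>?X. if E \<in> J then \<beta> E * edge_bubble_pieces p E K x else 0)"
    by (rule sum.inter_restrict) simp
  also have "\<dots> = (\<Sum>E\<in>?X. \<beta>' E * edge_bubble_pieces p E K x)"
    by (intro sum.cong) (auto simp: \<beta>'_def)
  also have "\<dots> = \<beta>' (closed_segment b c) * edge_bubble_pieces p (closed_segment b c) K x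
     + \<beta>' (closed_segment c a) * edge_bubble_pieces p (closed_segment c a) K x
     + \<beta>' (closed_segment a b) * edge_bubble_pieces p (closed_segment a b) K x"
    using K(3-5) by (simp add: doubleton_eq_iff)
  also have "edge_bubble_pieces p (closed_segment b c) K x = poly (legendre p) (1 - 2 * bary K a x)"
  proof -
    have "closed_segment b c \<subseteq> K" using edge_subset_triangle[OF K(1), of b c] K(2) by blast
    then show ?thesis using opposite_vertex_eq[OF K(1), of b c a] K by (simp add: edge_bubble_pieces_def insert_commute)
  qed
  also have "edge_bubble_pieces p (closed_segment c a) K x = poly (legendre p) (1 - 2 * bary K b x)"
  proof -
    have "closed_segment c a \<subseteq> K" using edge_subset_triangle[OF K(1), of c a] K(2) by blast
    then show ?thesis using opposite_vertex_eq[OF K(1), of c a b] K by (simp add: edge_bubble_pieces_def insert_commute)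
  qed
  also have "edge_bubble_pieces p (closed_segment a b) K x = poly (legendre p) (1 - 2 * bary K c x)"
  proof -
    have "closed_segment a b \<subseteq> K" using edge_subset_triangle[OF K(1), of a b] K(2) by blast
    then show ?thesis using opposite_vertex_eq[OF K(1), of a b c] K by (simp add: edge_bubble_pieces_def)
  qed
  finally show ?thesis .
qed

lemma edge_bubble_sum_at_vertex:
  fixes \<beta> :: "(real^2) set \<Rightarrow> real"
  assumes K: "K \<in> T" "verts K = {a, b, c}" "a \<noteq> b" "b \<noteq> c" "c \<noteq> a"
    and J: "J \<subseteq> edges T" and p: "odd p"
  defines "\<beta>' \<equiv> \<lambda>E. if E \<in> J then \<beta> E else 0"
  shows "(\<Sum>E\<in>J. \<beta> E * edge_bubble_pieces p E K a)
    = - \<beta>' (closed_segment b c) + \<beta>' (closed_segment c a) + \<beta>' (closed_segment a b)"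
proof -
  have "poly (legendre p) (-1) = -1" using legendre_minus[of p 1] p by (simp add: legendre_at_1)
  then show ?thesis using edge_bubble_sum_on_triangle[OF K J, of \<beta> p a] K
    unfolding \<beta>'_def by (simp add: bary_at legendre_at_1)
qed

lemma interior_vertices_eq: "interior_vertices \<Omega> T = (\<Union>K\<in>T. verts K) \<inter> \<Omega>"
proof -
  have "z \<notin> frontier \<Omega> \<longleftrightarrow> z \<in> \<Omega>" if "K \<in> T" "z extreme_point_of K" for K z
    using frontier_iff[of z] that verts_subset unfolding verts_def by blast
  then show ?thesis unfolding interior_vertices_def verts_def by blast
qed

text \<open>
  The coefficient of an edge is the mean of the values of a piece at its endpoints. It is the same for
  both triangles, and zero for boundary edges, because an odd Legendre polynomial has opposite values
  at the endpoints. The bubbles with these coefficients reproduce the values of the pieces at all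
  vertices. The coefficients are unique since the matrix with \<open>-1\<close> on the diagonal and \<open>1\<close> elsewhere is
  invertible.
\<close>

lemma odd_basis:
  assumes p: "p \<ge> 1" "odd p"
  shows "basis_of (crouzeix_raviart0 \<Omega> T p)
    ({ae_class (lagrange T p z) | z. z \<in> nodes T p \<inter> \<Omega> - interior_vertices \<Omega> T}
     \<union> {ae_class (edge_bubble T p E) | E. E \<in> interior_edges \<Omega> T})"
proof (rule basis_criterion[OF p(1) _ _ cr_pieces_edge_bubble ae_class_edge_bubble])
  let ?J = "interior_edges \<Omega> T" and ?N = "nodes T p \<inter> \<Omega> - interior_vertices \<Omega> T"
  have J: "?J \<subseteq> edges T" by (auto simp: interior_edges_def)
  show "finite ?J" using J finite_edges finite_subset by blast
  show "?N \<subseteq> nodes T p \<inter> \<Omega>" by blast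
  have end1: "linepath u v 0 = u" "linepath u v 1 = v" for u v :: "real^2" by (simp_all add: linepath_def)
  {
    fix Q assume Q: "cr_pieces p Q"
    have qs: "Q K u + Q K v = Q K' u + Q K' v" if s: "shared K K' u v" for K K' u v
    proof -
      obtain c where c: "\<forall>t. Q K (linepath u v t) - Q K' (linepath u v t) = c * edge_legendre p t"
        using cr_piecesD(2)[OF Q s] by (elim exE)
      show ?thesis using c[rule_format, of 0] c[rule_format, of 1] p(2) by (simp add: end1)
    qed
    have qb: "Q K u + Q K v = 0" if b: "bedge K u v" for K u v
    proof -
      obtain c where c: "\<forall>t. Q K (linepath u v t) = c * edge_legendre p t"
        using cr_piecesD(3)[OF Q b] by (elim exE)
      show ?thesis using c[rule_format, of 0] c[rule_format, of 1] p(2) by (simp add: end1)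
    qed
    define \<beta> where "\<beta> = (\<lambda>E. (\<Sum>z | z extreme_point_of E. Q (SOME K. K \<in> T \<and> E \<subseteq> K) z) / 2)"
    have \<beta>: "\<beta> (closed_segment u v) = (Q K u + Q K v) / 2"
      if K: "K \<in> T" "u \<noteq> v" "u \<in> verts K" "v \<in> verts K" for K u v
    proof -
      let ?L = "SOME K. K \<in> T \<and> closed_segment u v \<subseteq> K"
      have "\<exists>K. K \<in> T \<and> closed_segment u v \<subseteq> K" using K edge_subset_triangle[OF K(1,3,4)] by blast
      then have "?L \<in> T \<and> closed_segment u v \<subseteq> ?L" by (rule someI_ex)
      then have L: "?L \<in> T" "{u, v} \<subseteq> verts ?L"
        using triangles_at_edge[OF K] by (auto simp: triangles_at_def)
      have "{z. z extreme_point_of closed_segment u v} = {u, v}" by (auto simp: extreme_point_of_segment)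
      then have eq: "\<beta> (closed_segment u v) = (Q ?L u + Q ?L v) / 2" using K(2) by (simp add: \<beta>_def)
      show ?thesis
      proof (cases "K = ?L")
        case True
        show ?thesis unfolding eq True[symmetric] ..
      next
        case False
        then have "shared K ?L u v" using K L by (simp add: shared_def)
        from qs[OF this] show ?thesis unfolding eq by simp
      qed
    qed
    let ?b = "\<lambda>E. if E \<in> ?J then \<beta> E else 0"
    have b: "?b (closed_segment u v) = (Q K u + Q K v) / 2"
      if K: "K \<in> T" "u \<noteq> v" "u \<in> verts K" "v \<in> verts K" for K u v
      using \<beta>[OF K] interior_edge_iff(1)[OF K] qb[of K u v] by simp
    let ?W = "\<lambda>K x. Q K x - (\<Sum>E\<in>?J. \<beta> E * edge_bubble_pieces p E K x)"
    have W0: "?W K a = 0" if K: "K \<in> T" "a \<in> verts K" for K a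
    proof -
      obtain u v where t: "tri a u v K" using K by (rule tri_atE)
      note v = tri_verts[OF t] and d = tri_distinct[OF t]
      have "(\<Sum>E\<in>?J. \<beta> E * edge_bubble_pieces p E K a)
        = - ?b (closed_segment u v) + ?b (closed_segment v a) + ?b (closed_segment a u)"
        by (rule edge_bubble_sum_at_vertex[OF K(1) v d J p(2)])
      also have "\<dots> = - ((Q K u + Q K v) / 2) + (Q K v + Q K a) / 2 + (Q K a + Q K u) / 2"
      proof -
        have b1: "?b (closed_segment u v) = (Q K u + Q K v) / 2" using v d by (intro b[OF K(1)]) auto
        have b2: "?b (closed_segment v a) = (Q K v + Q K a) / 2" using v d by (intro b[OF K(1)]) auto
        have b3: "?b (closed_segment a u) = (Q K a + Q K u) / 2" using v d by (intro b[OF K(1)]) auto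
        show ?thesis unfolding b1 b2 b3 ..
      qed
      also have "\<dots> = Q K a" by (simp add: field_simps)
      finally show ?thesis by simp
    qed
    have "cr_pieces p (\<lambda>K x. Q K x + (-1) * (\<Sum>E\<in>?J. \<beta> E * edge_bubble_pieces p E K x))"
      using cr_pieces_edge_bubble by (intro cr_pieces_add cr_pieces_scale cr_pieces_sum Q)
    then have crW: "cr_pieces p ?W" by simp
    have "conforming p ?W"
    proof (rule cr_imp_conforming[OF crW])
      show "?W K v = ?W K' v" if "shared K K' u v" for K K' u v
        using W0[of K v] W0[of K' v] that unfolding shared_def by simp
      show "?W K v = 0" if "bedge K u v" for K u v
        using W0[of K v] that unfolding bedge_def by simp
    qed
    moreover have "\<forall>K\<in>T. \<forall>z\<in>nodeset p K. z \<in> \<Omega> \<longrightarrow> z \<notin> ?N \<longrightarrow> ?W K z = 0"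
    proof (intro ballI impI)
      fix K z assume K: "K \<in> T" "z \<in> nodeset p K" "z \<in> \<Omega>" "z \<notin> ?N"
      then have "z \<in> interior_vertices \<Omega> T" using nodes_eq[OF p(1)] by blast
      then obtain K' where K': "K' \<in> T" "z \<in> verts K'" unfolding interior_vertices_eq by blast
      have "z \<in> K" using nodeset_subset[OF p(1) K(1)] K(2) by blast
      then have "z \<in> verts K" by (rule vertex_of_incident_triangle[OF K'(2,1) K(1)])
      then show "?W K z = 0" by (rule W0[OF K(1)])
    qed
    ultimately show "\<exists>\<beta>. conforming p (\<lambda>K x. Q K x - (\<Sum>j\<in>?J. \<beta> j * edge_bubble_pieces p j K x)) \<and>
        (\<forall>K\<in>T. \<forall>z\<in>nodeset p K. z \<in> \<Omega> \<longrightarrow> z \<notin> ?N \<longrightarrow> Q K z - (\<Sum>j\<in>?J. \<beta> j * edge_bubble_pieces p j K z) = 0)"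
      by (intro exI[of _ \<beta>] conjI)
  }
  fix \<alpha> \<beta>
  assume 0: "\<And>K x. K \<in> T \<Longrightarrow> (\<Sum>z\<in>?N. \<alpha> z * local_lagrange p K z x) + (\<Sum>j\<in>?J. \<beta> j * edge_bubble_pieces p j K x) = 0"
  let ?b = "\<lambda>E. if E \<in> ?J then \<beta> E else 0"
  have v0: "- ?b (closed_segment b c) + ?b (closed_segment c a) + ?b (closed_segment a b) = 0"
    if t: "tri a b c K" "K \<in> T" for a b c K
  proof -
    note K = tri_verts[OF t(1)] tri_distinct[OF t(1)]
    have "a \<notin> ?N" using t(2) K(1) unfolding interior_vertices_eq by blast
    moreover have "?N \<subseteq> nodes T p" by blast
    moreover have "a \<in> nodeset p K" using vertex_node[OF t(2)] K(1) by simp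
    ultimately have "(\<Sum>z\<in>?N. \<alpha> z * local_lagrange p K z a) = 0"
      using local_lagrange_sum_at_node[OF p(1) _ t(2), of ?N a \<alpha>] by (simp only: if_False)
    moreover have "(\<Sum>j\<in>?J. \<beta> j * edge_bubble_pieces p j K a)
       = - ?b (closed_segment b c) + ?b (closed_segment c a) + ?b (closed_segment a b)"
      by (rule edge_bubble_sum_at_vertex[OF t(2) K J p(2)])
    ultimately show ?thesis using 0[OF t(2), of a] by simp
  qed
  show "\<forall>E\<in>?J. \<beta> E = 0"
  proof
    fix E assume E: "E \<in> ?J"
    then have "E \<in> edges T" using J by blast
    then obtain K u v where K: "K \<in> T" "u \<noteq> v" "u \<in> verts K" "v \<in> verts K" "E = closed_segment u v"
      by (rule edgesE)
    have *: "?b (closed_segment a b) = 0" if t: "tri a b c K" for a b c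
      \<comment> \<open>The sum of the relations at \<open>a\<close> and \<open>b\<close> is twice the coefficient of the edge between them.\<close>
      using v0[OF t K(1)] v0[OF tri_rot[OF t] K(1)] by linarith
    obtain a b c where "tri a b c K" using triE[OF K(1)] .
    then have "(\<exists>w. tri u v w K) \<or> (\<exists>w. tri v u w K)" using tri_ordered K by blast
    then have "?b E = 0"
    proof
      assume "\<exists>w. tri u v w K"
      then show ?thesis using *[of u v] unfolding K(5) by (elim exE)
    next
      assume "\<exists>w. tri v u w K"
      then show ?thesis using *[of v u] unfolding K(5) closed_segment_commute[of u v] by (elim exE)
    qed
    then show "\<beta> E = 0" using E by simp
  qed
qed

end

theorem theorem3p3:
  fixes \<Omega> :: "(real^2) set" and T :: "(real^2) set set" and p :: nat
  assumes "bounded \<Omega>" and "polygonal_domain \<Omega>"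
    and "regular_triangulation T \<Omega>"
    and "p \<ge> 1"
  shows "(even p \<and> simply_connected \<Omega> \<longrightarrow>
      basis_of (crouzeix_raviart0 \<Omega> T p)
        ({ae_class (lagrange T p z) | z. z \<in> nodes T p \<inter> \<Omega>}
         \<union> {ae_class (triangle_bubble p K) | K. K \<in> T}))
    \<and> (odd p \<longrightarrow>
      basis_of (crouzeix_raviart0 \<Omega> T p)
        ({ae_class (lagrange T p z) | z. z \<in> nodes T p \<inter> \<Omega> - interior_vertices \<Omega> T}
         \<union> {ae_class (edge_bubble T p E) | E. E \<in> interior_edges \<Omega> T}))"
proof -
  interpret triangulation \<Omega> T by unfold_locales (rule assms(3))
  show ?thesis using even_basis[OF assms(4)] odd_basis[OF assms(4)] by blast
qed

end
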